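(* For the voting rule 3-approval, Exact Control by Adding Voters is $\mathrm{NP}$-complete (under polynomial-time many-one reductions), but Conformant Manipulation is in $\mathrm{P}$.
   Context: An election $(C,V)$ consists of a finite set of candidates $C$ and a finite collection (multiset, listed explicitly) of voters $V$; each voter has a vote, which is a strict total order over $C$. 3-Approval: in an election with $m$ candidates, a candidate receives 1 point from each vote in which it is ranked among the top 3 positions and 0 points from every other vote (scoring vector $\langle 1,1,1,0,\dots,0\rangle$). The winners are all candidates with the highest total score (several winners are allowed). 3-Approval Exact Control by Adding Voters. Given: an election $(C,V)$ ($V$ are the registered voters), a collection $U$ of unregistered voters with votes over $C$, an integer $k\ge 0$, and a preferred candidate $p\in C$. Question: does there exist a subcollection $U'\subseteq U$ of size exactly $k$ such that $p$ is a 3-approval winner of $(C,V\cup U')$? 3-Approval Conformant Manipulation. Given: an election $(C,V)$, a collection of manipulative voters $W$ (listed explicitly, votes not yet set), and a preferred candidate $p\in C$. Question: does there exist a way to set the votes of the manipulators in $W$ using only votes that occur in $V$ (a vote may be used by any number of manipulators; every manipulator must cast a vote) such that $p$ is a 3-approval winner of the election $(C,V\cup W)$? *)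

theory Defs
  imports
    "HOL-Combinatorics.Multiset_Permutations"
    "HOL-Computational_Algebra.Polynomial"
begin

section \<open>Deterministic multi-tape Turing machines\<close>

text \<open>Tapes are infinite in both directions. States and tape symbols are natural numbers taken from
  finite sets that belong to the machine. Symbol 0 is the blank; symbols 1 and 2 are the two bits.\<close>

type_synonym tape = "(int \<Rightarrow> nat) \<times> int"  \<comment> \<open>contents and head position\<close>
type_synonym config = "nat \<times> tape list"

record tm =
  num_tapes :: nat
  states :: "nat set"
  symbols :: "nat set"
  start_state :: nat
  accept_state :: nat
  reject_state :: nat
  trans :: "nat \<Rightarrow> nat list \<Rightarrow> nat \<times> (nat \<times> int) list"
    \<comment> \<open>new state and, for every tape, the symbol written and the head movement\<close>

definition wf_tm :: "tm \<Rightarrow> bool" where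
  "wf_tm M \<longleftrightarrow>
     num_tapes M \<ge> 1 \<and> finite (states M) \<and> finite (symbols M) \<and> {0, 1, 2} \<subseteq> symbols M \<and>
     {start_state M, accept_state M, reject_state M} \<subseteq> states M \<and>
     accept_state M \<noteq> reject_state M \<and>
     (\<forall>q \<in> states M - {accept_state M, reject_state M}.
        \<forall>xs. length xs = num_tapes M \<and> set xs \<subseteq> symbols M \<longrightarrow>
          fst (trans M q xs) \<in> states M \<and>
          length (snd (trans M q xs)) = num_tapes M \<and>
          set (snd (trans M q xs)) \<subseteq> symbols M \<times> {-1, 0, 1})"

definition step :: "tm \<Rightarrow> config \<Rightarrow> config" where
  "step M cfg =
     (case cfg of (q, ts) \<Rightarrow>
       if q \<in> {accept_state M, reject_state M} then cfg
       else case trans M q (map (\<lambda>(t, h). t h) ts) of (q', acts) \<Rightarrow>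
         (q', map2 (\<lambda>(t, h) (s, d). (t(h := s), h + d)) ts acts))"

definition sym :: "bool \<Rightarrow> nat" where
  "sym b = (if b then 2 else 1)"

definition input_tape :: "bool list \<Rightarrow> tape" where
  "input_tape x =
     ((\<lambda>i. if 0 \<le> i \<and> i < int (length x) then sym (x ! nat i) else 0), 0)"

definition init_config :: "tm \<Rightarrow> bool list \<Rightarrow> config" where
  "init_config M x = (start_state M, input_tape x # replicate (num_tapes M - 1) (input_tape []))"

definition run :: "tm \<Rightarrow> bool list \<Rightarrow> nat \<Rightarrow> config" where
  "run M x n = (step M ^^ n) (init_config M x)"

text \<open>The output is the word on the last tape that begins at position 0 and extends up to the first
  blank; the head position and the other cells are irrelevant.\<close>

definition has_output :: "config \<Rightarrow> bool list \<Rightarrow> bool" where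
  "has_output cfg y \<longleftrightarrow>
     (let t = fst (last (snd cfg)) in
       (\<forall>i < length y. t (int i) = sym (y ! i)) \<and> t (int (length y)) = 0)"


section \<open>The classes P and NP\<close>

type_synonym language = "bool list set"

definition decides_in_time :: "tm \<Rightarrow> language \<Rightarrow> (nat \<Rightarrow> nat) \<Rightarrow> bool" where
  "decides_in_time M L T \<longleftrightarrow>
     (\<forall>x. \<exists>n \<le> T (length x).
        fst (run M x n) = (if x \<in> L then accept_state M else reject_state M))"

definition computes_in_time :: "tm \<Rightarrow> (bool list \<Rightarrow> bool list) \<Rightarrow> (nat \<Rightarrow> nat) \<Rightarrow> bool" where
  "computes_in_time M f T \<longleftrightarrow>
     (\<forall>x. \<exists>n \<le> T (length x).
        fst (run M x n) = accept_state M \<and> has_output (run M x n) (f x))"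

definition class_P :: "language set" where
  "class_P = {L. \<exists>M (p :: nat poly). wf_tm M \<and> decides_in_time M L (poly p)}"

definition polytime_computable :: "(bool list \<Rightarrow> bool list) \<Rightarrow> bool" where
  "polytime_computable f \<longleftrightarrow> (\<exists>M (p :: nat poly). wf_tm M \<and> computes_in_time M f (poly p))"

text \<open>Self-delimiting encoding of lists: every element is preceded by the bit 1, and the bit 0 marks
  the end. If \<open>e\<close> is a prefix code, then so is \<open>enc_list e\<close>.\<close>

definition enc_list :: "('a \<Rightarrow> bool list) \<Rightarrow> 'a list \<Rightarrow> bool list" where
  "enc_list e xs = concat (map (\<lambda>x. True # e x) xs) @ [False]"

definition enc_word :: "bool list \<Rightarrow> bool list" where
  "enc_word = enc_list (\<lambda>b. [b])"

definition class_NP :: "language set" where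
  "class_NP =
     {L. \<exists>R \<in> class_P. \<exists>p :: nat poly. \<forall>x.
        x \<in> L \<longleftrightarrow> (\<exists>y. length y \<le> poly p (length x) \<and> enc_word x @ enc_word y \<in> R)}"

definition polytime_reducible :: "language \<Rightarrow> language \<Rightarrow> bool" where
  "polytime_reducible A B \<longleftrightarrow> (\<exists>f. polytime_computable f \<and> (\<forall>x. x \<in> A \<longleftrightarrow> f x \<in> B))"

definition NP_hard :: "language \<Rightarrow> bool" where
  "NP_hard B \<longleftrightarrow> (\<forall>A \<in> class_NP. polytime_reducible A B)"

definition NP_complete :: "language \<Rightarrow> bool" where
  "NP_complete B \<longleftrightarrow> B \<in> class_NP \<and> NP_hard B"


section \<open>Elections\<close>

text \<open>A strict total order over a finite set \<open>C\<close> is represented by the list of the elements of \<open>C\<close>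
  from most to least preferred, that is, by an element of \<^const>\<open>permutations_of_set\<close> \<open>C\<close>.
  A collection of voters is the multiset of their votes.\<close>

type_synonym 'a vote = "'a list"
type_synonym 'a voting_rule = "'a set \<Rightarrow> 'a vote multiset \<Rightarrow> 'a set"

definition approval_score :: "nat \<Rightarrow> 'a vote multiset \<Rightarrow> 'a \<Rightarrow> nat" where
  "approval_score t V c = size {# v \<in># V. c \<in> set (take t v) #}"

definition approval_winners :: "nat \<Rightarrow> 'a voting_rule" where
  "approval_winners t C V =
     {c \<in> C. \<forall>d \<in> C. approval_score t V d \<le> approval_score t V c}"

definition can_win_by_adding_exactly ::
  "'a voting_rule \<Rightarrow> 'a set \<Rightarrow> 'a vote multiset \<Rightarrow> 'a vote multiset \<Rightarrow> nat \<Rightarrow> 'a \<Rightarrow> bool" where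
  "can_win_by_adding_exactly F C V U k p \<longleftrightarrow>
     (\<exists>U'. U' \<subseteq># U \<and> size U' = k \<and> p \<in> F C (V + U'))"

text \<open>The manipulators are numbered \<open>0, \<dots>, w - 1\<close>; manipulator \<open>i\<close> casts the vote \<open>A ! i\<close>.\<close>

definition can_win_by_conformant_manipulation ::
  "'a voting_rule \<Rightarrow> 'a set \<Rightarrow> 'a vote multiset \<Rightarrow> nat \<Rightarrow> 'a \<Rightarrow> bool" where
  "can_win_by_conformant_manipulation F C V w p \<longleftrightarrow>
     (\<exists>A. length A = w \<and> set A \<subseteq> set_mset V \<and> p \<in> F C (V + mset A))"


section \<open>The decision problems as languages\<close>

text \<open>Candidate names are binary words. The candidates and the voters are listed explicitly; the
  listing order is arbitrary. The number \<open>k\<close> is written in binary, least significant bit first,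
  without leading zeros. The manipulators, whose votes are not yet set, contribute one bit each.
  Words that encode no instance are outside the language.\<close>

type_synonym name = "bool list"

fun binary :: "nat \<Rightarrow> bool list" where
  "binary n = (if n = 0 then [] else odd n # binary (n div 2))"

declare binary.simps [simp del]

definition enc_vote :: "name vote \<Rightarrow> bool list" where
  "enc_vote = enc_list enc_word"

definition enc_election :: "name list \<Rightarrow> name vote list \<Rightarrow> bool list" where
  "enc_election C V = enc_list enc_word C @ enc_list enc_vote V"

definition exact_control_by_adding_voters :: "name voting_rule \<Rightarrow> language" where
  "exact_control_by_adding_voters F =
     {enc_election C V @ enc_list enc_vote U @ enc_word (binary k) @ enc_word p | C V U k p.
        distinct C \<and> set V \<subseteq> permutations_of_set (set C) \<and>
        set U \<subseteq> permutations_of_set (set C) \<and> p \<in> set C \<and>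
        can_win_by_adding_exactly F (set C) (mset V) (mset U) k p}"

definition conformant_manipulation :: "name voting_rule \<Rightarrow> language" where
  "conformant_manipulation F =
     {enc_election C V @ enc_word p @ replicate w True @ [False] | C V w p.
        distinct C \<and> set V \<subseteq> permutations_of_set (set C) \<and> p \<in> set C \<and>
        can_win_by_conformant_manipulation F (set C) (mset V) w p}"

end

theory Submission
  imports Defs "HOL-Library.Countable"
begin

text \<open>Polynomial-time Turing machines are obtained from a closed class of functions on binary trees: a
  command language with six stacks is run by a Turing machine, and the class is closed under
  composition and polynomially bounded loops.

  Hardness. The tableau of an NP machine is a CNF formula. A satisfying assignment is a choice of
  pairwise disjoint triples, with a wheel of triples per variable that admits exactly two choices and
  one triple per clause. Each triple is the top of an unregistered vote. The only registered vote
  gives one point to \<open>p\<close> and to two dummies, which no unregistered vote ranks among the top three;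
  so \<open>p\<close> wins if and only if every other candidate gets at most one point from the added votes.

  Membership in P. The manipulators may assume to vote for \<open>p\<close>, provided that some vote in \<open>V\<close> does.
  Then the score of \<open>p\<close> is fixed, the other two approved candidates form an edge that may be repeated,
  and the question is whether there is a multiset of \<open>w\<close> edges with given bounds on the degrees.
  Replacing a candidate by as many copies as its bound, and adding vertices that absorb the copies left
  over, turns this into the existence of a perfect matching in a general graph. To decide it, start
  from an artificial perfect matching and remove its artificial edges one by one: an alternating tree
  with contraction of odd cycles either restores perfection or yields a Tutte barrier.\<close>


section \<open>A command language interpreted by Turing machines\<close>

text \<open>The classes quantify over raw machines, so every algorithm has to become one. With
  \<open>FP\<close> as an interface, machine code is written only for a few operations on trees, and
  everything else is composed. Since the functions in \<open>FP\<close> are total, size bounds must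
  hold on malformed input too, where no invariant of an algorithm is available.

  Hardness rests on the exact number of added votes: \<open>p\<close> already wins when nothing is
  added, so the count has to force a complete packing. In the manipulation problem a vote can be
  reused at will, and only bounds on degrees remain.

  The usual treatment of odd cycles lifts an augmenting path back through all contractions. Here
  every even vertex carries a whole near-perfect matching, a contraction restarts the tree, and the
  search returns a mere verdict. The artificial matching ensures that each search starts with
  exactly two exposed vertices, so that one verdict settles the round.\<close>

datatype com =
    Skip
  | Rej
  | Act nat nat nat
  | Seq com com
  | If nat nat com com
  | While nat "nat list" com

text \<open>Countability gives \<open>to_nat\<close>, which turns stacks of commands into the
  numbers that serve as states of a \<open>tm\<close>.\<close>

instance com :: countable
  by countable_datatype

abbreviation stay :: "nat list \<Rightarrow> (nat \<times> int) list" where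
  "stay \<equiv> map (\<lambda>s. (s, 0))"

text \<open>A state is a stack of commands that remain to be executed. In \<open>Act i w d\<close> a value
  \<open>w > 2\<close> leaves the cell unchanged, and \<open>d = 0, 1, 2\<close> stand for left, stay and right.\<close>

fun cstep :: "com list \<Rightarrow> nat list \<Rightarrow> com list \<times> (nat \<times> int) list" where
  "cstep [] xs = ([], stay xs)"
| "cstep (Skip # k) xs = (k, stay xs)"
| "cstep (Rej # k) xs = (Rej # k, stay xs)"
| "cstep (Act i w d # k) xs =
     (k, (stay xs)[i := (if w \<le> 2 then w else xs ! i, if d = 0 then -1 else if d = 1 then 0 else 1)])"
| "cstep (Seq a b # k) xs = (a # b # k, stay xs)"
| "cstep (If i s a b # k) xs = ((if xs ! i = s then a else b) # k, stay xs)"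
| "cstep (While i S a # k) xs = (if xs ! i \<in> set S then a # While i S a # k else k, stay xs)"

text \<open>Stacks of commands form an infinite set, whereas a machine has finitely many states.
  These sets contain the nonempty stacks reachable from \<open>[c]\<close>; they are finite because
  a loop keeps only one copy of itself under its body.\<close>

fun residuals :: "com \<Rightarrow> com list set" where
  "residuals Skip = {[Skip]}"
| "residuals Rej = {[Rej]}"
| "residuals (Act i w d) = {[Act i w d]}"
| "residuals (Seq a b) = {[Seq a b]} \<union> (\<lambda>xs. xs @ [b]) ` residuals a \<union> residuals b"
| "residuals (If i s a b) = {[If i s a b]} \<union> residuals a \<union> residuals b"
| "residuals (While i S a) = {[While i S a]} \<union> (\<lambda>xs. xs @ [While i S a]) ` residuals a"

lemma finite_residuals: "finite (residuals c)"
  by (induction c) auto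

lemma start_in_residuals: "[c] \<in> residuals c"
  by (cases c) auto

text \<open>The arbitrary rest \<open>k\<close> stands for the enclosing commands, so that the
  induction passes through \<open>Seq\<close> and \<open>While\<close>. The second alternative is
  the moment at which the command is used up.\<close>

lemma residuals_closed:
  "ys \<in> residuals c \<Longrightarrow>
     (\<exists>zs \<in> residuals c. fst (cstep (ys @ k) xs) = zs @ k) \<or> fst (cstep (ys @ k) xs) = k"
proof (induction c arbitrary: ys k)
  case (Seq a b)
  from Seq.prems consider "ys = [Seq a b]" | zs where "ys = zs @ [b]" "zs \<in> residuals a"
    | "ys \<in> residuals b" by auto
  then show ?case
  proof cases
    case 1
    have "[a, b] \<in> residuals (Seq a b)"
      using start_in_residuals[of a] by auto
    then show ?thesis using 1 by (intro disjI1 bexI[of _ "[a, b]"]) auto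
  next
    case (2 zs)
    from Seq.IH(1)[OF 2(2), of "b # k"] show ?thesis
    proof
      assume "\<exists>zs'\<in>residuals a. fst (cstep (zs @ b # k) xs) = zs' @ b # k"
      then obtain zs' where "zs' \<in> residuals a" "fst (cstep (zs @ b # k) xs) = zs' @ b # k" by auto
      then show ?thesis using 2 by (intro disjI1 bexI[of _ "zs' @ [b]"]) auto
    next
      assume "fst (cstep (zs @ b # k) xs) = b # k"
      then show ?thesis using 2 start_in_residuals[of b]
        by (intro disjI1 bexI[of _ "[b]"]) auto
    qed
  next
    case 3
    from Seq.IH(2)[OF this, of k] show ?thesis by auto
  qed
next
  case (If i s a b)
  from If.prems consider "ys = [If i s a b]" | "ys \<in> residuals a" | "ys \<in> residuals b" by auto
  then show ?case
  proof cases
    case 1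
    have "[a] \<in> residuals (If i s a b)" "[b] \<in> residuals (If i s a b)"
      using start_in_residuals[of a] start_in_residuals[of b] by auto
    then show ?thesis using 1
      by (intro disjI1 bexI[of _ "if xs ! i = s then [a] else [b]"]) auto
  next
    case 2
    from If.IH(1)[OF this, of k] show ?thesis by auto
  next
    case 3
    from If.IH(2)[OF this, of k] show ?thesis by auto
  qed
next
  case (While i S a)
  let ?w = "While i S a"
  from While.prems consider "ys = [?w]" | zs where "ys = zs @ [?w]" "zs \<in> residuals a" by auto
  then show ?case
  proof cases
    case 1
    have "[a, ?w] \<in> residuals ?w"
      using start_in_residuals[of a] by auto
    then show ?thesis using 1
      by (cases "xs ! i \<in> set S", intro disjI1 bexI[of _ "[a, ?w]"], simp_all)
  next
    case (2 zs)
    from While.IH[OF 2(2), of "?w # k"] show ?thesis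
    proof
      assume "\<exists>zs'\<in>residuals a. fst (cstep (zs @ ?w # k) xs) = zs' @ ?w # k"
      then obtain zs' where "zs' \<in> residuals a" "fst (cstep (zs @ ?w # k) xs) = zs' @ ?w # k" by auto
      then show ?thesis using 2 by (intro disjI1 bexI[of _ "zs' @ [?w]"]) auto
    next
      assume "fst (cstep (zs @ ?w # k) xs) = ?w # k"
      then show ?thesis using 2 by (intro disjI1 bexI[of _ "[?w]"]) auto
    qed
  qed
qed auto

text \<open>Halting is read off the stack: nothing left to do means acceptance, \<open>[Rej]\<close>
  means rejection. The six tapes are the input, the data stack, three scratch tapes and, in last
  place as \<open>has_output\<close> demands, the output.\<close>

definition machine :: "com \<Rightarrow> tm" where
  "machine c =
     \<lparr>num_tapes = 6,
      states = to_nat ` (residuals c \<union> {[], [Rej]}),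
      symbols = {0, 1, 2},
      start_state = to_nat [c],
      accept_state = to_nat ([] :: com list),
      reject_state = to_nat [Rej],
      trans = (\<lambda>q xs. case cstep (from_nat q) xs of (k, acts) \<Rightarrow> (to_nat k, acts))\<rparr>"

lemma cstep_acts:
  assumes "set xs \<subseteq> {0, 1, 2}"
  shows "length (snd (cstep k xs)) = length xs"
    and "set (snd (cstep k xs)) \<subseteq> {0, 1, 2} \<times> {-1, 0, 1}"
proof -
  show "length (snd (cstep k xs)) = length xs"
    by (induction k xs rule: cstep.induct) auto
  let ?D = "{0, 1, 2} \<times> {-1, 0, 1} :: (nat \<times> int) set"
  have stay: "set (stay xs) \<subseteq> ?D"
  proof
    fix p assume "p \<in> set (stay xs)"
    then obtain s where "p = (s, 0)" "s \<in> {0, 1, 2}" using assms by auto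
    then show "p \<in> ?D" by blast
  qed
  show "set (snd (cstep k xs)) \<subseteq> ?D"
  proof (cases "(k, xs)" rule: cstep.cases)
    case (4 i w d k' ys)
    define a :: "nat \<times> int" where
      "a = (if w \<le> 2 then w else xs ! i, if d = 0 then -1 else if d = 1 then 0 else 1)"
    have "set ((stay xs)[i := a]) \<subseteq> ?D"
    proof (cases "i < length xs")
      case True
      then have "(if w \<le> 2 then w else xs ! i) \<in> {0, 1, 2}"
        using subsetD[OF assms nth_mem[OF True]] by (simp add: numeral_2_eq_2 le_Suc_eq)
      then have "a \<in> ?D" unfolding a_def by simp
      then show ?thesis
        using set_update_subset_insert[of "stay xs" i a] stay
        by (meson insert_subset order_trans)
    next
      case False
      then have "(stay xs)[i := a] = stay xs" by (intro list_update_beyond) simp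
      then show ?thesis using stay by simp
    qed
    moreover have "snd (cstep k xs) = (stay xs)[i := a]" using 4 by (simp add: a_def)
    ultimately show ?thesis by metis
  qed (use stay in simp_all)
qed

lemma wf_machine: "wf_tm (machine c)"
proof -
  have closed: "fst (trans (machine c) q xs) \<in> states (machine c)"
    if q: "q \<in> states (machine c) - {accept_state (machine c), reject_state (machine c)}" for q xs
  proof -
    from q obtain k where k: "q = to_nat k" "k \<in> residuals c" by (auto simp: machine_def)
    from residuals_closed[OF k(2), of "[]" xs]
    have "fst (cstep k xs) \<in> residuals c \<union> {[]}" by auto
    moreover have "fst (trans (machine c) q xs) = to_nat (fst (cstep k xs))"
      by (simp add: k machine_def split: prod.split)
    ultimately show ?thesis by (auto simp: machine_def)
  qed
  have "snd (trans (machine c) q xs) = snd (cstep (from_nat q) xs)" for q xs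
    by (simp add: machine_def split: prod.split)
  then show ?thesis
    using closed cstep_acts finite_residuals[of c] start_in_residuals[of c]
    unfolding wf_tm_def by (simp add: machine_def)
qed

text \<open>The machine before its states are numbered. As \<open>cstep\<close> leaves
  \<open>[]\<close> and \<open>[Rej]\<close> unchanged, the halting test of \<open>step\<close> is
  already built in.\<close>

definition sstep :: "com list \<times> tape list \<Rightarrow> com list \<times> tape list" where
  "sstep = (\<lambda>(k, ts). case cstep k (map (\<lambda>(t, h). t h) ts) of
     (k', acts) \<Rightarrow> (k', map2 (\<lambda>(t, h) (s, d). (t(h := s), h + d)) ts acts))"

lemma map2_stay:
  "map2 (\<lambda>(t, h) (s, d). (t(h := s), h + d)) ts (stay (map (\<lambda>(t, h). t h) ts)) = (ts :: tape list)"
  by (induction ts) auto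

lemma step_machine:
  "step (machine c) (to_nat k, ts) = (case sstep (k, ts) of (k', ts') \<Rightarrow> (to_nat k', ts'))"
proof (cases "k = [] \<or> k = [Rej]")
  have accept: "accept_state (machine c) = to_nat ([] :: com list)"
    and reject: "reject_state (machine c) = to_nat [Rej]"
    and trans: "\<And>xs. trans (machine c) (to_nat k) xs = (case cstep k xs of (k, acts) \<Rightarrow> (to_nat k, acts))"
    by (simp_all add: machine_def)
  case True
  then have "cstep k (map (\<lambda>(t, h). t h) ts) = (k, stay (map (\<lambda>(t, h). t h) ts))" by auto
  then have "sstep (k, ts) = (k, ts)"
    using map2_stay[of ts] by (simp add: sstep_def)
  moreover have "step (machine c) (to_nat k, ts) = (to_nat k, ts)"
    using True by (elim disjE) (simp_all add: step_def accept reject)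
  ultimately show ?thesis by simp
next
  have accept: "accept_state (machine c) = to_nat ([] :: com list)"
    and reject: "reject_state (machine c) = to_nat [Rej]"
    and trans: "\<And>xs. trans (machine c) (to_nat k) xs = (case cstep k xs of (k, acts) \<Rightarrow> (to_nat k, acts))"
    by (simp_all add: machine_def)
  case False
  then have "to_nat k \<notin> {accept_state (machine c), reject_state (machine c)}"
    by (simp add: accept reject)
  then show ?thesis
    by (simp add: step_def sstep_def trans split: prod.split)
qed

lemma steps_machine:
  "(step (machine c) ^^ n) (to_nat k, ts) = (case (sstep ^^ n) (k, ts) of (k', ts') \<Rightarrow> (to_nat k', ts'))"
proof (induction n)
  case (Suc n)
  then show ?case
    using step_machine by (cases "(sstep ^^ n) (k, ts)") simp
qed simp


subsection \<open>Tapes as stacks\<close>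

text \<open>Tapes 0 to 4 are used as stacks whose top is under the head, the blank marking the bottom.
  Tape 5 is the output tape, to which bits are only appended.\<close>

definition stack_on :: "bool list \<Rightarrow> tape \<Rightarrow> bool" where
  "stack_on w = (\<lambda>(t, h). (\<forall>i < length w. t (h + int i) = sym (w ! i)) \<and> t (h + int (length w)) = 0)"

definition output_on :: "bool list \<Rightarrow> tape \<Rightarrow> bool" where
  "output_on w = (\<lambda>(t, h). h = int (length w) \<and> (\<forall>i < length w. t (int i) = sym (w ! i)) \<and> (\<forall>i \<ge> h. t i = 0))"

type_synonym stacks = "nat \<Rightarrow> bool list"

definition represents :: "stacks \<Rightarrow> tape list \<Rightarrow> bool" where
  "represents st ts \<longleftrightarrow> length ts = 6 \<and> (\<forall>i < 5. stack_on (st i) (ts ! i)) \<and> output_on (st 5) (ts ! 5)"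

text \<open>The tapes vary because \<open>represents\<close> ignores the cells outside the stacks.
  Step count and final tapes are chosen before the continuation \<open>k\<close>, so a command
  behaves alike on top of every stack; this makes \<open>exec\<close> compositional.\<close>

definition exec :: "com \<Rightarrow> stacks \<Rightarrow> nat \<Rightarrow> stacks \<Rightarrow> bool" where
  "exec c st B st' \<longleftrightarrow>
     (\<forall>ts. represents st ts \<longrightarrow>
       (\<exists>n \<le> B. \<exists>ts'. represents st' ts' \<and> (\<forall>k. (sstep ^^ n) (c # k, ts) = (k, ts'))))"

definition top :: "bool list \<Rightarrow> nat" where
  "top w = (case w of [] \<Rightarrow> 0 | b # _ \<Rightarrow> sym b)"

lemma top_simps [simp]: "top [] = 0" "top (b # w) = sym b"
  by (auto simp: top_def)

lemma sym_simps [simp]: "sym True = 2" "sym False = 1"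
  by (auto simp: sym_def)

lemma sym_eq [simp]: "sym a = sym b \<longleftrightarrow> a = b"
  by (auto simp: sym_def)

lemma read_top:
  assumes "represents st ts" "i < 5"
  shows "map (\<lambda>(t, h). t h) ts ! i = top (st i)"
proof -
  have "stack_on (st i) (ts ! i)" "i < length ts" using assms by (auto simp: represents_def)
  then show ?thesis
    by (cases "st i") (auto simp: stack_on_def split: prod.splits)
qed

lemma exec_weaken:
  assumes "exec c st B st'" "B \<le> B'" "st' = st''"
  shows "exec c st B' st''"
  using assms unfolding exec_def by (meson order_trans)

lemma exec_no_write:
  assumes "\<And>ts k. represents st ts \<Longrightarrow> cstep (c # k) (map (\<lambda>(t, h). t h) ts) = (k, stay (map (\<lambda>(t, h). t h) ts))"
  shows "exec c st 1 st"
proof -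
  have "(sstep ^^ 1) (c # k, ts) = (k, ts)" if "represents st ts" for ts k
    using assms[OF that] map2_stay[of ts] by (simp add: sstep_def)
  then show ?thesis unfolding exec_def by blast
qed

lemma exec_Skip: "exec Skip st 1 st"
  by (rule exec_no_write) simp

lemma funpow_compose:
  assumes "f x = y" "(f ^^ n) y = z" "(f ^^ m) z = u"
  shows "(f ^^ (m + n + 1)) x = u"
  using assms by (simp add: funpow_add funpow_swap1)

lemma exec_Seq:
  assumes "exec a st A st'" "exec b st' B st''"
  shows "exec (Seq a b) st (A + B + 1) st''"
  unfolding exec_def
proof (intro allI impI)
  fix ts assume "represents st ts"
  with assms(1) obtain n ts' where 1: "n \<le> A" "represents st' ts'"
    "\<And>k. (sstep ^^ n) (a # k, ts) = (k, ts')" unfolding exec_def by blast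
  with assms(2) obtain m ts'' where 2: "m \<le> B" "represents st'' ts''"
    "\<And>k. (sstep ^^ m) (b # k, ts') = (k, ts'')" unfolding exec_def by blast
  have "sstep (Seq a b # k, ts) = (a # b # k, ts)" for k
    using map2_stay[of ts] by (simp add: sstep_def)
  then have "(sstep ^^ (m + n + 1)) (Seq a b # k, ts) = (k, ts'')" for k
    by (rule funpow_compose[OF _ 1(3) 2(3)])
  then show "\<exists>n\<le>A + B + 1. \<exists>ts'. represents st'' ts' \<and> (\<forall>k. (sstep ^^ n) (Seq a b # k, ts) = (k, ts'))"
    using 1(1) 2 by (intro exI[of _ "m + n + 1"]) auto
qed

lemma exec_jump:
  assumes "\<And>ts k. represents st ts \<Longrightarrow>
      cstep (c # k) (map (\<lambda>(t, h). t h) ts) = (d # k, stay (map (\<lambda>(t, h). t h) ts))"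
    and "exec d st B st'"
  shows "exec c st (B + 1) st'"
  unfolding exec_def
proof (intro allI impI)
  fix ts assume r: "represents st ts"
  with assms(2) obtain n ts' where 1: "n \<le> B" "represents st' ts'"
    "\<And>k. (sstep ^^ n) (d # k, ts) = (k, ts')" unfolding exec_def by blast
  have "(sstep ^^ (n + 1)) (c # k, ts) = (k, ts')" for k
    using map2_stay[of ts] 1(3) assms(1)[OF r] by (simp add: funpow_swap1) (simp add: sstep_def)
  then show "\<exists>n\<le>B + 1. \<exists>ts'. represents st' ts' \<and> (\<forall>k. (sstep ^^ n) (c # k, ts) = (k, ts'))"
    using 1 by (intro exI[of _ "n + 1"]) auto
qed

lemma exec_If:
  assumes "i < 5" "exec (if top (st i) = s then a else b) st B st'"
  shows "exec (If i s a b) st (B + 1) st'"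
  by (rule exec_jump[OF _ assms(2)]) (simp add: read_top[OF _ assms(1)])

lemma exec_While_done:
  assumes "i < 5" "top (st i) \<notin> set S"
  shows "exec (While i S a) st 1 st"
  by (rule exec_no_write) (simp add: read_top[OF _ assms(1)] assms(2))

lemma exec_While_step:
  assumes "i < 5" "top (st i) \<in> set S" "exec a st A st'" "exec (While i S a) st' B st''"
  shows "exec (While i S a) st (A + B + 1) st''"
  unfolding exec_def
proof (intro allI impI)
  let ?w = "While i S a"
  fix ts assume r: "represents st ts"
  with assms(3) obtain n ts' where 1: "n \<le> A" "represents st' ts'"
    "\<And>k. (sstep ^^ n) (a # k, ts) = (k, ts')" unfolding exec_def by blast
  with assms(4) obtain m ts'' where 2: "m \<le> B" "represents st'' ts''"
    "\<And>k. (sstep ^^ m) (?w # k, ts') = (k, ts'')" unfolding exec_def by blast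
  have "sstep (?w # k, ts) = (a # ?w # k, ts)" for k
    using map2_stay[of ts] assms(2) by (simp add: sstep_def read_top[OF r assms(1)])
  then have "(sstep ^^ (m + n + 1)) (?w # k, ts) = (k, ts'')" for k
    by (rule funpow_compose[OF _ 1(3) 2(3)])
  then show "\<exists>n\<le>A + B + 1. \<exists>ts'. represents st'' ts' \<and> (\<forall>k. (sstep ^^ n) (?w # k, ts) = (k, ts'))"
    using 1(1) 2 by (intro exI[of _ "m + n + 1"]) auto
qed

text \<open>Stacks grow to the left: the head first moves without writing (3 leaves the cell alone),
  then the bit is written. Whatever a \<open>Pop\<close> left behind is thus overwritten before it
  can be read.\<close>

definition Push :: "nat \<Rightarrow> bool \<Rightarrow> com" where
  "Push i b = Seq (Act i 3 0) (Act i (sym b) 1)"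

definition Pop :: "nat \<Rightarrow> com" where
  "Pop i = Act i 3 2"

definition Out :: "bool \<Rightarrow> com" where
  "Out b = Act 5 (sym b) 2"

lemma map2_stay_update:
  assumes "i < length ts" "ts ! i = (t, h)"
  shows "map2 (\<lambda>(t, h) (s, d). (t(h := s), h + d)) ts ((stay (map (\<lambda>(t, h). t h) ts))[i := (s, d)])
    = (ts[i := (t(h := s), h + d)] :: tape list)"
proof (rule nth_equalityI)
  fix j assume "j < length (map2 (\<lambda>(t, h) (s, d). (t(h := s), h + d)) ts
    ((stay (map (\<lambda>(t, h). t h) ts))[i := (s, d)]))"
  then have "j < length ts" by simp
  then show "map2 (\<lambda>(t, h) (s, d). (t(h := s), h + d)) ts ((stay (map (\<lambda>(t, h). t h) ts))[i := (s, d)]) ! j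
    = ts[i := (t(h := s), h + d)] ! j"
    using assms by (cases "i = j") (auto split: prod.splits)
qed simp

lemma sstep_Act:
  assumes "i < length ts" "ts ! i = (t, h)"
  shows "sstep (Act i w d # k, ts) =
    (k, ts[i := (t(h := if w \<le> 2 then w else t h), h + (if d = 0 then -1 else if d = 1 then 0 else 1))])"
  using map2_stay_update[OF assms] assms by (simp add: sstep_def)

lemma sym_le2: "sym b \<le> 2"
  by (auto simp: sym_def)

lemma represents_update_stack:
  assumes "represents st ts" "i < 5" "stack_on w x"
  shows "represents (st(i := w)) (ts[i := x])"
  using assms by (auto simp: represents_def nth_list_update)

lemma exec_Push:
  assumes "i < 5"
  shows "exec (Push i b) st 3 (st(i := b # st i))"
  unfolding exec_def
proof (intro allI impI)
  fix ts assume r: "represents st ts"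
  obtain t h where th: "ts ! i = (t, h)" by fastforce
  have len: "i < length ts" using r assms by (simp add: represents_def)
  have s: "stack_on (st i) (t, h)" using r assms th by (auto simp: represents_def)
  let ?ts = "ts[i := (t(h - 1 := sym b), h - 1)]"
  have "(sstep ^^ 3) (Push i b # k, ts) = (k, ?ts)" for k
  proof -
    have 1: "sstep (Push i b # k, ts) = (Act i 3 0 # Act i (sym b) 1 # k, ts)"
      using map2_stay[of ts] by (simp add: sstep_def Push_def)
    have 2: "sstep (Act i 3 0 # Act i (sym b) 1 # k, ts) = (Act i (sym b) 1 # k, ts[i := (t, h - 1)])"
      using len th by (simp add: sstep_Act)
    have 3: "sstep (Act i (sym b) 1 # k, ts[i := (t, h - 1)]) = (k, ?ts)"
      using len by (subst sstep_Act[of _ _ t "h - 1"]) (auto simp: sym_le2)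
    have "sstep ^^ 3 = (\<lambda>x. sstep (sstep (sstep x)))" by (simp add: numeral_3_eq_3 fun_eq_iff)
    then show ?thesis by (simp only: 1 2 3)
  qed
  moreover have "stack_on (b # st i) (t(h - 1 := sym b), h - 1)"
  proof -
    have "(t(h - 1 := sym b)) (h - 1 + int j) = sym ((b # st i) ! j)" if "j < length (b # st i)" for j
      using s that by (cases j) (auto simp: stack_on_def)
    then show ?thesis using s by (auto simp: stack_on_def)
  qed
  ultimately show "\<exists>n\<le>3. \<exists>ts'. represents (st(i := b # st i)) ts' \<and> (\<forall>k. (sstep ^^ n) (Push i b # k, ts) = (k, ts'))"
    using represents_update_stack[OF r assms] by (intro exI[of _ 3] conjI exI[of _ ?ts]) auto
qed

lemma exec_Pop:
  assumes "i < 5" "st i = b # w"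
  shows "exec (Pop i) st 1 (st(i := w))"
  unfolding exec_def
proof (intro allI impI)
  fix ts assume r: "represents st ts"
  obtain t h where th: "ts ! i = (t, h)" by fastforce
  have len: "i < length ts" using r assms by (simp add: represents_def)
  have s: "stack_on (b # w) (t, h)" using r assms th by (auto simp: represents_def)
  let ?ts = "ts[i := (t, h + 1)]"
  have "(sstep ^^ 1) (Pop i # k, ts) = (k, ?ts)" for k
    using len th by (simp add: Pop_def sstep_Act)
  moreover have "stack_on w (t, h + 1)"
  proof -
    have "t (h + 1 + int j) = sym (w ! j)" if "j < length w" for j
    proof -
      have "t (h + int (Suc j)) = sym ((b # w) ! Suc j)"
        using s that unfolding stack_on_def by (simp only: prod.case) (metis length_Cons Suc_less_eq)
      then show ?thesis by (simp add: ac_simps)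
    qed
    then show ?thesis using s by (auto simp: stack_on_def ac_simps)
  qed
  ultimately show "\<exists>n\<le>1. \<exists>ts'. represents (st(i := w)) ts' \<and> (\<forall>k. (sstep ^^ n) (Pop i # k, ts) = (k, ts'))"
    using represents_update_stack[OF r assms(1)] by (intro exI[of _ 1] conjI exI[of _ ?ts]) auto
qed

lemma exec_Out: "exec (Out b) st 1 (st(5 := st 5 @ [b]))"
  unfolding exec_def
proof (intro allI impI)
  fix ts assume r: "represents st ts"
  obtain t h where th: "ts ! 5 = (t, h)" by fastforce
  have len: "5 < length ts" using r by (simp add: represents_def)
  have s: "output_on (st 5) (t, h)" using r th by (auto simp: represents_def)
  let ?ts = "ts[5 := (t(h := sym b), h + 1)]"
  have "(sstep ^^ 1) (Out b # k, ts) = (k, ?ts)" for k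
    using len th by (simp add: Out_def sstep_Act sym_le2)
  moreover have "output_on (st 5 @ [b]) (t(h := sym b), h + 1)"
    using s by (auto simp: output_on_def nth_append)
  then have "represents (st(5 := st 5 @ [b])) ?ts"
    using r by (auto simp: represents_def nth_list_update)
  ultimately show "\<exists>n\<le>1. \<exists>ts'. represents (st(5 := st 5 @ [b])) ts' \<and> (\<forall>k. (sstep ^^ n) (Out b # k, ts) = (k, ts'))"
    by (intro exI[of _ 1] conjI exI[of _ ?ts]) auto
qed


section \<open>Binary trees on the data stack\<close>

datatype tree = Leaf | Node tree tree

text \<open>The preorder word of a tree is self-delimiting, so values can be stacked on one tape
  without separators.\<close>

primrec bits :: "tree \<Rightarrow> bool list" where
  "bits Leaf = [False]"
| "bits (Node a b) = True # bits a @ bits b"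

lemma bits_prefix: "bits a @ r = bits b @ s \<Longrightarrow> a = b \<and> r = s"
proof (induction a arbitrary: b r s)
  case Leaf
  then show ?case by (cases b) auto
next
  case (Node a1 a2)
  show ?case
  proof (cases b)
    case Leaf
    then show ?thesis using Node.prems by simp
  next
    case (Node b1 b2)
    then have "bits a1 @ (bits a2 @ r) = bits b1 @ (bits b2 @ s)" using Node.prems by simp
    then have "a1 = b1" "bits a2 @ r = bits b2 @ s" using Node.IH(1) by blast+
    then show ?thesis using Node.IH(2) Node by blast
  qed
qed

lemma bits_inject [simp]: "bits a = bits b \<longleftrightarrow> a = b"
  using bits_prefix[of a "[]" b "[]"] by auto

lemma bits_ne [simp]: "bits a \<noteq> []"
  by (cases a) auto

lemma exec_Pop': "i < 5 \<Longrightarrow> st i \<noteq> [] \<Longrightarrow> exec (Pop i) st 1 (st(i := tl (st i)))"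
  using exec_Pop[of i st "hd (st i)" "tl (st i)"] by simp

lemma exec_If_top:
  assumes "i < 5" "st i = x # w" "exec (if x = y then a else b) st B st'"
  shows "exec (If i (sym y) a b) st (B + 1) st'"
  by (rule exec_If) (use assms in auto)

lemma exec_If_True:
  assumes "i < 5" "st i = x # w" "exec (if x then a else b) st B st'"
  shows "exec (If i 2 a b) st (B + 1) st'"
  using exec_If_top[of i st x w True a b B st'] assms by simp

text \<open>A node bit replaces one pending tree by its two subtrees, hence the push on tape 3; a
  leaf bit completes a pending tree, hence the pop.\<close>

definition move_body :: "nat \<Rightarrow> com" where
  "move_body d =
     If 1 2 (Seq (Pop 1) (Seq (Push d True) (Push 3 True)))
            (Seq (Pop 1) (Seq (Push d False) (Pop 3)))"

text \<open>The length of tape 3 counts the trees that remain to be read.\<close>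

lemma exec_move_forest:
  assumes d: "d = 2 \<or> d = 4"
  shows "st 1 = concat (map bits ts) @ r \<Longrightarrow> st 3 = replicate (length ts) True \<Longrightarrow>
    exec (While 3 [2] (move_body d)) st (20 * length (concat (map bits ts)) + 1)
      (st(1 := r, 3 := [], d := rev (concat (map bits ts)) @ st d))"
\<comment> \<open>Opening a node lengthens the list of pending trees, so the induction is on the
  number of remaining bits, which drops by one per round.\<close>
proof (induction "length (concat (map bits ts))" arbitrary: ts st rule: less_induct)
  case less
  show ?case
  proof (cases ts)
    case Nil
    show ?thesis
      by (rule exec_weaken[OF exec_While_done]) (use Nil less.prems in \<open>auto simp: fun_eq_iff\<close>)
  next
    case (Cons t us)
    show ?thesis
    proof (cases t)
      case Leaf
      let ?st = "st(1 := concat (map bits us) @ r, d := False # st d, 3 := replicate (length us) True)"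
      have 1: "exec (move_body d) st 10 ?st"
        unfolding move_body_def
        by (rule exec_weaken, rule exec_If_True[where x = False and w = "concat (map bits us) @ r"],
          simp, use less.prems Cons Leaf in simp, simp only: if_False,
          rule exec_Seq[OF exec_Pop' exec_Seq[OF exec_Push exec_Pop']])
          (use less.prems Cons Leaf d in \<open>auto simp: fun_eq_iff\<close>)
      have 2: "exec (While 3 [2] (move_body d)) ?st (20 * length (concat (map bits us)) + 1)
        (?st(1 := r, 3 := [], d := rev (concat (map bits us)) @ ?st d))"
        by (rule less.hyps) (use Cons Leaf d in auto)
      show ?thesis
        by (rule exec_weaken[OF exec_While_step[OF _ _ 1 2]])
          (use less.prems Cons Leaf d in \<open>auto simp: fun_eq_iff\<close>)
    next
      case (Node a b)
      let ?us = "a # b # us"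
      let ?st = "st(1 := concat (map bits ?us) @ r, d := True # st d, 3 := replicate (length ?us) True)"
      have 1: "exec (move_body d) st 11 ?st"
        unfolding move_body_def
        by (rule exec_weaken, rule exec_If_True[where x = True and w = "concat (map bits ?us) @ r"],
          simp, use less.prems Cons Node in simp, simp only: if_True,
          rule exec_Seq[OF exec_Pop' exec_Seq[OF exec_Push exec_Push]])
          (use less.prems Cons Node d in \<open>auto simp: fun_eq_iff\<close>)
      have 2: "exec (While 3 [2] (move_body d)) ?st (20 * length (concat (map bits ?us)) + 1)
        (?st(1 := r, 3 := [], d := rev (concat (map bits ?us)) @ ?st d))"
        by (rule less.hyps) (use Cons Node d in auto)
      show ?thesis
        by (rule exec_weaken[OF exec_While_step[OF _ _ 1 2]])
          (use less.prems Cons Node d in \<open>auto simp: fun_eq_iff\<close>)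
    qed
  qed
qed

definition move_tree :: "nat \<Rightarrow> com" where
  "move_tree d = Seq (Push 3 True) (While 3 [2] (move_body d))"

lemma exec_move_tree:
  assumes d: "d = 2 \<or> d = 4" and "st 1 = bits t @ r" "st 3 = []"
  shows "exec (move_tree d) st (20 * length (bits t) + 5) (st(1 := r, d := rev (bits t) @ st d))"
proof -
  have "exec (While 3 [2] (move_body d)) (st(3 := [True])) (20 * length (concat (map bits [t])) + 1)
      ((st(3 := [True]))(1 := r, 3 := [], d := rev (concat (map bits [t])) @ (st(3 := [True])) d))"
    using assms by (intro exec_move_forest) auto
  from exec_Seq[OF exec_Push[of 3 True st] this[folded assms(3)]] assms
  have "exec (Seq (Push 3 True) (While 3 [2] (move_body d))) st (3 + (20 * length (bits t) + 1) + 1)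
     ((st(3 := [True]))(1 := r, 3 := [], d := rev (bits t) @ st d))"
    using exec_Seq[OF exec_Push[of 3 True st]] by auto
  then show ?thesis
    unfolding move_tree_def by (rule exec_weaken) (use assms in \<open>auto simp: fun_eq_iff\<close>)
qed

definition flush :: "nat \<Rightarrow> nat \<Rightarrow> com" where
  "flush i j = While i [1, 2] (Seq (If i 2 (Push j True) (Push j False)) (Pop i))"

lemma exec_Push_copy:
  assumes "i < 5" "j < 5" "st i = b # w"
  shows "exec (If i 2 (Push j True) (Push j False)) st 4 (st(j := b # st j))"
proof -
  have "exec (if b then Push j True else Push j False) st 3 (st(j := b # st j))"
    using exec_Push[OF assms(2), of b st] by (cases b) auto
  from exec_weaken[OF exec_If_True[OF assms(1,3) this]] show ?thesis by simp
qed

lemma top_bit: "x = b # w \<Longrightarrow> top x \<in> set [1, 2]"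
  by (cases b) auto

lemma exec_flush:
  assumes ij: "i < 5" "j < 5" "i \<noteq> j"
  shows "exec (flush i j) st (8 * length (st i) + 1) (st(i := [], j := rev (st i) @ st j))"
proof (induction "st i" arbitrary: st)
  case Nil
  then show ?case unfolding flush_def
    by (intro exec_weaken[OF exec_While_done[OF ij(1)]]) (auto simp: fun_eq_iff)
next
  case (Cons b w)
  let ?st = "st(j := b # st j, i := w)"
  have 1: "exec (Seq (If i 2 (Push j True) (Push j False)) (Pop i)) st 6 ?st"
    by (rule exec_weaken[OF exec_Seq[OF exec_Push_copy exec_Pop']])
      (use ij in \<open>auto simp: Cons.hyps(2)[symmetric]\<close>)
  have 2: "exec (flush i j) ?st (8 * length (?st i) + 1) (?st(i := [], j := rev (?st i) @ ?st j))"
    by (rule Cons.hyps) simp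
  show ?case
    unfolding flush_def
    by (rule exec_weaken[OF exec_While_step[OF ij(1) top_bit[OF Cons.hyps(2)[symmetric]] 1 2[unfolded flush_def]]])
      (use ij in \<open>auto simp: fun_eq_iff Cons.hyps(2)[symmetric]\<close>)
qed

definition flush2 :: "nat \<Rightarrow> nat \<Rightarrow> nat \<Rightarrow> com" where
  "flush2 i j l = While i [1, 2]
     (Seq (If i 2 (Push j True) (Push j False)) (Seq (If i 2 (Push l True) (Push l False)) (Pop i)))"

lemma exec_flush2:
  assumes ij: "i < 5" "j < 5" "l < 5" "i \<noteq> j" "i \<noteq> l" "j \<noteq> l"
  shows "exec (flush2 i j l) st (13 * length (st i) + 1)
    (st(i := [], j := rev (st i) @ st j, l := rev (st i) @ st l))"
proof (induction "st i" arbitrary: st)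
  case Nil
  then show ?case unfolding flush2_def
    by (intro exec_weaken[OF exec_While_done[OF ij(1)]]) (auto simp: fun_eq_iff)
next
  case (Cons b w)
  let ?st = "st(j := b # st j, l := b # st l, i := w)"
  have 1: "exec (Seq (If i 2 (Push j True) (Push j False)) (Seq (If i 2 (Push l True) (Push l False)) (Pop i)))
      st 11 ?st"
    by (rule exec_weaken[OF exec_Seq[OF exec_Push_copy[where w = w] exec_Seq[OF exec_Push_copy[where w = w] exec_Pop']]])
      (use ij in \<open>auto simp: Cons.hyps(2)[symmetric]\<close>)
  have 2: "exec (flush2 i j l) ?st (13 * length (?st i) + 1)
      (?st(i := [], j := rev (?st i) @ ?st j, l := rev (?st i) @ ?st l))"
    by (rule Cons.hyps) simp
  show ?case
    unfolding flush2_def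
    by (rule exec_weaken[OF exec_While_step[OF ij(1) top_bit[OF Cons.hyps(2)[symmetric]] 1 2[unfolded flush2_def]]])
      (use ij in \<open>auto simp: fun_eq_iff Cons.hyps(2)[symmetric]\<close>)
qed

text \<open>The scratch tapes 2, 3 and 4 are empty between any two operations on the data stack.\<close>

definition clean :: "stacks \<Rightarrow> bool" where
  "clean st \<longleftrightarrow> st 2 = [] \<and> st 3 = [] \<and> st 4 = []"

lemma clean_upd [simp]: "clean (st(Suc 0 := w)) = clean st" "clean (st(1 := w)) = clean st"
    "clean (st(0 := w)) = clean st" "clean (st(5 := w)) = clean st"
  by (simp_all add: clean_def)

definition drop_tree :: com where
  "drop_tree = Seq (move_tree 2) (While 2 [1, 2] (Pop 2))"

lemma exec_clear:
  assumes i: "i < 5"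
  shows "exec (While i [1, 2] (Pop i)) st (2 * length (st i) + 1) (st(i := []))"
proof (induction "st i" arbitrary: st)
  case Nil
  then show ?case
    by (intro exec_weaken[OF exec_While_done[OF i]]) (auto simp: fun_eq_iff)
next
  case (Cons b w)
  have 1: "exec (Pop i) st 1 (st(i := w))"
    by (rule exec_Pop[OF i]) (rule Cons.hyps(2)[symmetric])
  have 2: "exec (While i [1, 2] (Pop i)) (st(i := w)) (2 * length ((st(i := w)) i) + 1) ((st(i := w))(i := []))"
    by (rule Cons.hyps) simp
  show ?case
    by (rule exec_weaken[OF exec_While_step[OF i top_bit[OF Cons.hyps(2)[symmetric]] 1 2]])
      (auto simp: Cons.hyps(2)[symmetric])
qed

lemma exec_drop_tree:
  assumes "clean st" "st 1 = bits t @ r"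
  shows "exec drop_tree st (30 * length (bits t) + 10) (st(1 := r))"
  unfolding drop_tree_def
  by (rule exec_weaken[OF exec_Seq[OF exec_move_tree exec_clear]])
    (use assms in \<open>auto simp: clean_def fun_eq_iff\<close>)

text \<open>Every transfer reverses the word. The copy sent back to tape 1 is in order at once; the
  one on tape 4 is in order where it lies, and therefore takes two more transfers to arrive on tape
  1 in order.\<close>

definition dup_tree :: com where
  "dup_tree = Seq (move_tree 2) (Seq (flush2 2 1 4) (Seq (flush 4 2) (flush 2 1)))"

lemma exec_dup_tree:
  assumes "clean st" "st 1 = bits t @ r"
  shows "exec dup_tree st (60 * length (bits t) + 20) (st(1 := bits t @ bits t @ r))"
  unfolding dup_tree_def
  by (rule exec_weaken[OF exec_Seq[OF exec_move_tree exec_Seq[OF exec_flush2 exec_Seq[OF exec_flush exec_flush]]]])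
    (use assms in \<open>auto simp: clean_def fun_eq_iff\<close>)

definition swap_tree :: com where
  "swap_tree = Seq (move_tree 2) (Seq (move_tree 4) (Seq (flush 2 1) (flush 4 1)))"

lemma exec_swap_tree:
  assumes "clean st" "st 1 = bits t @ bits u @ r"
  shows "exec swap_tree st (40 * length (bits t) + 40 * length (bits u) + 20) (st(1 := bits u @ bits t @ r))"
  unfolding swap_tree_def
  by (rule exec_weaken[OF exec_Seq[OF exec_move_tree[where r = "bits u @ r"]
      exec_Seq[OF exec_move_tree[where t = u and r = r] exec_Seq[OF exec_flush exec_flush]]]])
    (use assms in \<open>auto simp: clean_def fun_eq_iff\<close>)

primrec push_bits :: "bool list \<Rightarrow> com" where
  "push_bits [] = Skip"
| "push_bits (b # w) = Seq (push_bits w) (Push 1 b)"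

lemma exec_push_bits: "exec (push_bits w) st (5 * length w + 1) (st(1 := w @ st 1))"
proof (induction w)
  case Nil
  show ?case unfolding push_bits.simps by (rule exec_weaken[OF exec_Skip]) auto
next
  case (Cons b w)
  show ?case unfolding push_bits.simps
    by (rule exec_weaken[OF exec_Seq[OF Cons exec_Push]]) auto
qed


subsection \<open>Equality of trees\<close>

text \<open>Tape 3 receives a mark for each mismatch, including the case that tape 4 has run out; a
  remainder on tape 4 reveals that the second word is longer.\<close>

definition compare_body :: com where
  "compare_body = Seq (If 2 2 (If 4 2 (Pop 4) (Push 3 True)) (If 4 1 (Pop 4) (Push 3 True))) (Pop 2)"


text \<open>The value of tape 4 after a mismatch is irrelevant, so the specification leaves it open.\<close>

lemma exec_compare_loop:
  "\<exists>u v. exec (While 2 [1, 2] compare_body) st (10 * length (st 2) + 1)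
           (st(2 := [], 3 := u @ st 3, 4 := v)) \<and> length u \<le> length (st 2) \<and> length v \<le> length (st 4)
         \<and> (u = [] \<and> v = [] \<longleftrightarrow> st 2 = st 4) \<and> (u = [] \<longrightarrow> st 4 = st 2 @ v)"
proof (induction "st 2" arbitrary: st)
  case Nil
  show ?case
  proof (rule exI[of _ "[]"], rule exI[of _ "st 4"], intro conjI)
    show "exec (While 2 [1, 2] compare_body) st (10 * length (st 2) + 1)
           (st(2 := [], 3 := [] @ st 3, 4 := st 4))"
      by (rule exec_weaken[OF exec_While_done]) (use Nil in \<open>auto simp: fun_eq_iff\<close>)
  qed (use Nil in auto)
next
  case (Cons b w)
  note 2 = Cons.hyps(2)[symmetric]
  define eq where "eq = (case st 4 of [] \<Rightarrow> False | c # _ \<Rightarrow> c = b)"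
  define st' where "st' = (if eq then st(4 := tl (st 4)) else st(3 := True # st 3))(2 := w)"
  have 0: "top (st 4) = (if b then 2 else 1) \<longleftrightarrow> eq"
    by (cases "st 4") (auto simp: eq_def sym_def)
  have "exec (if b then If 4 2 (Pop 4) (Push 3 True) else If 4 1 (Pop 4) (Push 3 True)) st 4
     (if eq then st(4 := tl (st 4)) else st(3 := True # st 3))"
  proof (cases eq)
    case True
    then have "st 4 \<noteq> []" by (auto simp: eq_def split: list.splits)
    have "exec (If 4 (if b then 2 else 1) (Pop 4) (Push 3 True)) st (1 + 1) (st(4 := tl (st 4)))"
      by (rule exec_If) (use True 0 exec_Pop'[of 4 st] \<open>st 4 \<noteq> []\<close> in auto)
    then show ?thesis using True by (auto intro: exec_weaken)
  next
    case False
    have "exec (If 4 (if b then 2 else 1) (Pop 4) (Push 3 True)) st (3 + 1) (st(3 := True # st 3))"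
      by (rule exec_If) (use False 0 exec_Push[of 3 True st] in auto)
    then show ?thesis using False by (auto intro: exec_weaken)
  qed
  from exec_If_True[OF _ 2 this]
  have "exec (If 2 2 (If 4 2 (Pop 4) (Push 3 True)) (If 4 1 (Pop 4) (Push 3 True))) st 5
     (if eq then st(4 := tl (st 4)) else st(3 := True # st 3))" by simp
  from exec_Seq[OF this exec_Pop'[of 2]] have 1: "exec compare_body st 7 st'"
    using 2 unfolding compare_body_def st'_def by (auto split: if_splits)
  have "w = st' 2" by (simp add: st'_def)
  from Cons.hyps(1)[where st = st', OF this] obtain u v where uv:
    "exec (While 2 [1, 2] compare_body) st' (10 * length w + 1) (st'(2 := [], 3 := u @ st' 3, 4 := v))"
    "length u \<le> length w" "length v \<le> length (st' 4)" "u = [] \<and> v = [] \<longleftrightarrow> w = st' 4" "u = [] \<longrightarrow> st' 4 = w @ v"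
    using \<open>w = st' 2\<close> by auto
  define u' where "u' = (if eq then u else u @ [True])"
  have "exec (While 2 [1, 2] compare_body) st (10 * length (st 2) + 1) (st(2 := [], 3 := u' @ st 3, 4 := v))"
    by (rule exec_weaken[OF exec_While_step[OF _ top_bit[OF 2] 1 uv(1)]])
      (auto simp: fun_eq_iff u'_def st'_def 2)
  moreover have "length u' \<le> length (st 2)" "length v \<le> length (st 4)"
    using uv(2,3) 2 by (auto simp: u'_def st'_def split: if_splits)
  moreover have "(u' = [] \<and> v = [] \<longleftrightarrow> st 2 = st 4) \<and> (u' = [] \<longrightarrow> st 4 = st 2 @ v)"
    using uv(4,5) by (cases "st 4") (auto simp: u'_def st'_def eq_def 2 split: if_splits)
  ultimately show ?case by blast
qed

definition equal_trees :: com where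
  "equal_trees = Seq (move_tree 2) (Seq (move_tree 4) (Seq (While 2 [1, 2] compare_body)
     (Seq (If 3 0 (If 4 0 (push_bits [True, False, False]) (push_bits [False])) (push_bits [False]))
       (Seq (While 3 [1, 2] (Pop 3)) (While 4 [1, 2] (Pop 4))))))"

lemma exec_equal_trees:
  assumes "clean st" "st 1 = bits t @ bits u @ r"
  shows "exec equal_trees st (100 * (length (bits t) + length (bits u)) + 100)
    (st(1 := (if t = u then [True, False, False] else [False]) @ r))"
proof -
  let ?st = "st(1 := r, 2 := rev (bits t), 4 := rev (bits u))"
  obtain x y where xy: "exec (While 2 [1, 2] compare_body) ?st (10 * length (?st 2) + 1)
           (?st(2 := [], 3 := x @ ?st 3, 4 := y))" "length x \<le> length (?st 2)" "length y \<le> length (?st 4)"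
         "x = [] \<and> y = [] \<longleftrightarrow> ?st 2 = ?st 4"
    using exec_compare_loop[of ?st] by blast
  let ?st2 = "?st(2 := [], 3 := x @ ?st 3, 4 := y)"
  let ?st3 = "?st2(1 := (if t = u then [True, False, False] else [False]) @ r)"
  have 1: "exec (move_tree 2) st (20 * length (bits t) + 5) (st(1 := bits u @ r, 2 := rev (bits t)))"
    by (rule exec_weaken[OF exec_move_tree[where r = "bits u @ r"]]) (use assms in \<open>auto simp: clean_def\<close>)
  have 2: "exec (move_tree 4) (st(1 := bits u @ r, 2 := rev (bits t))) (20 * length (bits u) + 5) ?st"
    by (rule exec_weaken[OF exec_move_tree[where r = r and t = u]])
      (use assms in \<open>auto simp: clean_def fun_eq_iff\<close>)
  have eq: "t = u \<longleftrightarrow> x = [] \<and> y = []" using xy(4) by auto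
  have push: "exec (push_bits z) ?st2 16 (?st2(1 := z @ r))" if "length z \<le> 3" for z
    by (rule exec_weaken[OF exec_push_bits]) (use that in \<open>auto simp: fun_eq_iff\<close>)
  have "exec (if y = [] then push_bits [True, False, False] else push_bits [False]) ?st2 16
     (?st2(1 := (if y = [] then [True, False, False] else [False]) @ r))"
    using push[of "[True, False, False]"] push[of "[False]"]
    by (cases "y = []") (simp_all del: push_bits.simps)
  then have "exec (If 4 0 (push_bits [True, False, False]) (push_bits [False])) ?st2 17
     (?st2(1 := (if y = [] then [True, False, False] else [False]) @ r))"
    by (intro exec_weaken[OF exec_If]) (auto simp: top_def sym_def split: list.splits)
  then have "exec (if x = [] then If 4 0 (push_bits [True, False, False]) (push_bits [False]) else push_bits [False])
      ?st2 17 ?st3"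
    using eq exec_weaken[OF push[of "[False]"], of 17 ?st3] by (cases "x = []") (auto simp del: push_bits.simps)
  then have 3: "exec (If 3 0 (If 4 0 (push_bits [True, False, False]) (push_bits [False])) (push_bits [False]))
      ?st2 18 ?st3"
    using assms(1)
    by (intro exec_weaken[OF exec_If]) (auto simp: clean_def top_def sym_def split: list.splits)
  show ?thesis
    unfolding equal_trees_def
    by (rule exec_weaken[OF exec_Seq[OF 1 exec_Seq[OF 2 exec_Seq[OF xy(1) exec_Seq[OF 3
        exec_Seq[OF exec_clear exec_clear]]]]]])
      (use assms(1) xy(2,3) in \<open>auto simp: clean_def fun_eq_iff\<close>)
qed

section \<open>Functions computable in polynomial time\<close>

class data =
  fixes tree_of :: "'a \<Rightarrow> tree"
  assumes tree_of_inject: "tree_of x = tree_of y \<Longrightarrow> x = y"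

lemma tree_of_eq [simp]: "tree_of x = tree_of y \<longleftrightarrow> x = y"
  using tree_of_inject by auto

instantiation unit :: data
begin
definition tree_of_unit :: "unit \<Rightarrow> tree" where "tree_of_unit x = Leaf"
instance by standard simp
end

instantiation bool :: data
begin
definition tree_of_bool :: "bool \<Rightarrow> tree" where
  "tree_of_bool b = (if b then Node Leaf Leaf else Leaf)"
instance by standard (auto simp: tree_of_bool_def split: if_splits)
end

text \<open>Numbers are unary, so time is polynomial in their value. This suits both problems: the
  number of manipulators is given in unary, and the binary \<open>k\<close> is never decoded but
  compared with \<open>binary\<close> of a count.\<close>

instantiation nat :: data
begin
primrec tree_of_nat :: "nat \<Rightarrow> tree" where
  "tree_of_nat 0 = Leaf"
| "tree_of_nat (Suc n) = Node Leaf (tree_of_nat n)"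
instance
proof
  fix m n :: nat
  show "tree_of m = tree_of n \<Longrightarrow> m = n"
  proof (induction m arbitrary: n)
    case 0
    then show ?case by (cases n) auto
  next
    case (Suc m)
    then show ?case by (cases n) auto
  qed
qed
end

instantiation prod :: (data, data) data
begin
definition tree_of_prod :: "'a \<times> 'b \<Rightarrow> tree" where
  "tree_of_prod p = Node (tree_of (fst p)) (tree_of (snd p))"
instance by standard (auto simp: tree_of_prod_def prod_eq_iff)
end

instantiation list :: (data) data
begin
primrec tree_of_list :: "'a list \<Rightarrow> tree" where
  "tree_of_list [] = Leaf"
| "tree_of_list (x # xs) = Node (tree_of x) (tree_of_list xs)"
instance
proof
  fix xs ys :: "'a list"
  show "tree_of xs = tree_of ys \<Longrightarrow> xs = ys"
  proof (induction xs arbitrary: ys)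
    case Nil
    then show ?case by (cases ys) auto
  next
    case (Cons x xs)
    then show ?case by (cases ys) auto
  qed
qed
end

definition code :: "'a :: data \<Rightarrow> bool list" where
  "code x = bits (tree_of x)"

definition csize :: "'a :: data \<Rightarrow> nat" where
  "csize x = length (code x)"

lemma code_simps [simp]:
  "code () = [False]"
  "code True = [True, False, False]" "code False = [False]"
  "code (0 :: nat) = [False]" "code (Suc n) = True # False # code n"
  "code (a, b) = True # code a @ code b"
  "code ([] :: 'a :: data list) = [False]" "code (x # xs) = True # code x @ code xs"
  by (auto simp: code_def tree_of_unit_def tree_of_bool_def tree_of_prod_def)

text \<open>A number and a list of that many units are the same word on the tape, so arithmetic
  reduces to list operations.\<close>

lemma code_nat_eq_list: "code n = code (replicate n ())"
  by (induction n) auto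

lemma csize_simps [simp]:
  "csize () = 1" "csize (n :: nat) = 2 * n + 1"
  "csize (a, b) = csize a + csize b + 1"
  "csize ([] :: 'a :: data list) = 1" "csize (x # xs) = csize x + csize xs + 1"
  by (auto simp: csize_def) (induction n; simp)+

lemma csize_bool: "csize (b :: bool) \<le> 3"
  by (cases b) (auto simp: csize_def)

lemma csize_pos: "csize x > 0"
  by (simp add: csize_def code_def)

lemma csize_append [simp]: "csize (xs @ ys) + 1 = csize xs + csize ys"
  by (induction xs) auto

lemma csize_rev [simp]: "csize (rev xs) = csize xs"
proof (induction xs)
  case (Cons x xs)
  then show ?case using csize_append[of "rev xs" "[x]"] by simp
qed simp

lemma length_le_csize: "length xs < csize xs"
  by (induction xs) (auto simp: less_Suc_eq_le)

lemma csize_member: "x \<in> set xs \<Longrightarrow> csize x < csize xs"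
  by (induction xs) auto

lemma csize_list_le: "(\<And>x. x \<in> set xs \<Longrightarrow> csize x \<le> B) \<Longrightarrow> csize xs \<le> length xs * (B + 1) + 1"
proof (induction xs)
  case (Cons x xs)
  then have "csize x \<le> B" "csize xs \<le> length xs * (B + 1) + 1" by auto
  then show ?case by simp
qed simp

lemma poly_nat_mono: "m \<le> n \<Longrightarrow> poly p m \<le> poly p (n :: nat)" for p :: "nat poly"
  by (induction p) (auto intro!: add_mono mult_mono)

section \<open>Polynomial bounds and polynomial-time functions\<close>

definition poly_bounded :: "('a :: data \<Rightarrow> nat) \<Rightarrow> bool" where
  "poly_bounded f \<longleftrightarrow> (\<exists>p :: nat poly. \<forall>x. f x \<le> poly p (csize x))"

lemma poly_boundedE:
  assumes "poly_bounded f"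
  obtains p :: "nat poly" where "\<And>x. f x \<le> poly p (csize x)"
  using assms unfolding poly_bounded_def by blast

lemma poly_bounded_mono: "poly_bounded g \<Longrightarrow> (\<And>x. f x \<le> g x) \<Longrightarrow> poly_bounded f"
  unfolding poly_bounded_def by (meson order_trans)

lemma poly_bounded_const: "poly_bounded (\<lambda>_. c)"
  unfolding poly_bounded_def by (intro exI[of _ "[:c:]"]) auto

lemma poly_bounded_csize: "poly_bounded csize"
  unfolding poly_bounded_def by (intro exI[of _ "[:0, 1:]"]) auto

lemma poly_bounded_add: "poly_bounded f \<Longrightarrow> poly_bounded g \<Longrightarrow> poly_bounded (\<lambda>x. f x + g x)"
  unfolding poly_bounded_def
proof safe
  fix p q :: "nat poly" assume "\<forall>x. f x \<le> poly p (csize x)" "\<forall>x. g x \<le> poly q (csize x)"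
  then show "\<exists>p. \<forall>x. f x + g x \<le> poly p (csize x)"
    by (intro exI[of _ "p + q"]) (auto intro: add_mono)
qed

lemma poly_bounded_mult: "poly_bounded f \<Longrightarrow> poly_bounded g \<Longrightarrow> poly_bounded (\<lambda>x. f x * g x)"
  unfolding poly_bounded_def
proof safe
  fix p q :: "nat poly" assume "\<forall>x. f x \<le> poly p (csize x)" "\<forall>x. g x \<le> poly q (csize x)"
  then show "\<exists>p. \<forall>x. f x * g x \<le> poly p (csize x)"
    by (intro exI[of _ "p * q"]) (auto intro: mult_mono)
qed

lemma poly_bounded_poly: "poly_bounded f \<Longrightarrow> poly_bounded (\<lambda>x. poly p (f x))" for p :: "nat poly"
  unfolding poly_bounded_def
proof safe
  fix q :: "nat poly" assume "\<forall>x. f x \<le> poly q (csize x)"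
  then show "\<exists>r. \<forall>x. poly p (f x) \<le> poly r (csize x)"
    by (intro exI[of _ "p \<circ>\<^sub>p q"]) (auto simp: poly_pcompose intro: poly_nat_mono)
qed

lemma poly_bounded_Suc: "poly_bounded f \<Longrightarrow> poly_bounded (\<lambda>x. Suc (f x))"
  using poly_bounded_add[OF _ poly_bounded_const[of 1]] by simp

lemmas poly_bounded_intros = poly_bounded_const poly_bounded_add poly_bounded_mult poly_bounded_poly
  poly_bounded_csize poly_bounded_Suc

definition implements :: "com \<Rightarrow> ('a :: data \<Rightarrow> 'b :: data) \<Rightarrow> ('a \<Rightarrow> nat) \<Rightarrow> bool" where
  "implements c f B \<longleftrightarrow>
     (\<forall>x st r. clean st \<longrightarrow> st 1 = code x @ r \<longrightarrow> exec c st (B x) (st(1 := code (f x) @ r)))"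

text \<open>The bound on the size of the value is carried along because the time of a composition
  depends on the size of the inner value.\<close>

definition FP :: "('a :: data \<Rightarrow> 'b :: data) \<Rightarrow> bool" where
  "FP f \<longleftrightarrow> poly_bounded (\<lambda>x. csize (f x)) \<and> (\<exists>c B. poly_bounded B \<and> implements c f B)"

lemma FP_I:
  assumes "poly_bounded (\<lambda>x. csize (f x))" "poly_bounded B"
    "\<And>x st r. clean st \<Longrightarrow> st 1 = code x @ r \<Longrightarrow> exec c st (B x) (st(1 := code (f x) @ r))"
  shows "FP f"
  using assms unfolding FP_def implements_def by blast

lemma FP_csize: "FP f \<Longrightarrow> poly_bounded (\<lambda>x. csize (f x))"
  by (simp add: FP_def)

lemma FP_E:
  assumes "FP f"
  obtains c B where "poly_bounded B"
    "\<And>x st r. clean st \<Longrightarrow> st 1 = code x @ r \<Longrightarrow> exec c st (B x) (st(1 := code (f x) @ r))"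
  using assms unfolding FP_def implements_def by blast

lemma poly_bounded_comp:
  assumes "poly_bounded B" "poly_bounded (\<lambda>x. csize (f x))"
  shows "poly_bounded (\<lambda>x. B (f x))"
proof -
  from assms(1) obtain p :: "nat poly" where "\<And>x. B x \<le> poly p (csize x)"
    by (auto simp: poly_bounded_def)
  then show ?thesis
    by (intro poly_bounded_mono[OF poly_bounded_poly[OF assms(2), of p]]) auto
qed

lemma FP_comp:
  fixes f :: "'a :: data \<Rightarrow> 'b :: data" and g :: "'b \<Rightarrow> 'c :: data"
  assumes "FP g" "FP f"
  shows "FP (\<lambda>x. g (f x))"
proof -
  from assms(1) obtain c B where 1: "poly_bounded B"
    "\<And>x st r. clean st \<Longrightarrow> st 1 = code x @ r \<Longrightarrow> exec c st (B x) (st(1 := code (g x) @ r))"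
    by (rule FP_E) (rule that; assumption)
  from assms(2) obtain d D where 2: "poly_bounded D"
    "\<And>x st r. clean st \<Longrightarrow> st 1 = code x @ r \<Longrightarrow> exec d st (D x) (st(1 := code (f x) @ r))"
    by (rule FP_E) (rule that; assumption)
  note pb = FP_csize[OF assms(2)]
  show ?thesis
  proof (rule FP_I[where B = "\<lambda>x. D x + B (f x) + 1" and c = "Seq d c"])
    fix x :: 'a and st r assume st: "clean st" "st 1 = code x @ r"
    show "exec (Seq d c) st (D x + B (f x) + 1) (st(1 := code (g (f x)) @ r))"
      by (rule exec_weaken[OF exec_Seq[OF 2(2)[OF st] 1(2)[where r = r and x = "f x"]]]) (use st in auto)
  qed (intro poly_bounded_intros 2(1) poly_bounded_comp[OF 1(1) pb]
      poly_bounded_comp[OF FP_csize[OF assms(1)] pb])+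
qed

lemma exec_dup:
  "clean st \<Longrightarrow> st 1 = code x @ r \<Longrightarrow> exec dup_tree st (60 * csize x + 20) (st(1 := code x @ code x @ r))"
  using exec_dup_tree[of st "tree_of x" r] by (simp add: code_def csize_def)

lemma exec_swap:
  "clean st \<Longrightarrow> st 1 = code x @ code y @ r \<Longrightarrow>
    exec swap_tree st (40 * csize x + 40 * csize y + 20) (st(1 := code y @ code x @ r))"
  using exec_swap_tree[of st "tree_of x" "tree_of y" r] by (simp add: code_def csize_def)

lemma exec_drop:
  "clean st \<Longrightarrow> st 1 = code x @ r \<Longrightarrow> exec drop_tree st (30 * csize x + 10) (st(1 := r))"
  using exec_drop_tree[of st "tree_of x" r] by (simp add: code_def csize_def)

text \<open>Free conversions between data with equal codes, such as a pair and the list with that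
  head and tail, or a number and a list of units.\<close>

lemma FP_recode:
  assumes "\<And>x. code (f x) = code x"
  shows "FP f"
proof (rule FP_I[where B = "\<lambda>_. 1" and c = Skip])
  have "csize (f x) = csize x" for x using assms[of x] by (simp add: csize_def)
  then show "poly_bounded (\<lambda>x. csize (f x))" by (simp add: poly_bounded_csize)
next
  fix x :: 'a and r and st :: stacks assume "st 1 = code x @ r"
  then show "exec Skip st 1 (st(1 := code (f x) @ r))"
    by (intro exec_weaken[OF exec_Skip]) (auto simp: assms fun_eq_iff)
qed (rule poly_bounded_const)

lemma FP_id: "FP (\<lambda>x. x)"
  by (rule FP_recode) simp

lemma FP_const: "FP (\<lambda>_. c)"
proof (rule FP_I[where B = "\<lambda>x. 30 * csize x + 10 + (5 * csize c + 1) + 1" and c = "Seq drop_tree (push_bits (code c))"])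
  fix x :: 'a and st r assume st: "clean st" "st 1 = code x @ r"
  show "exec (Seq drop_tree (push_bits (code c))) st (30 * csize x + 10 + (5 * csize c + 1) + 1)
     (st(1 := code c @ r))"
    by (rule exec_weaken[OF exec_Seq[OF exec_drop[OF st] exec_push_bits]]) (auto simp: csize_def)
qed (intro poly_bounded_intros)+

lemma FP_Pair:
  assumes "FP f" "FP g"
  shows "FP (\<lambda>x. (f x, g x))"
proof -
  from assms(1) obtain c B where 1: "poly_bounded B"
    "\<And>x st r. clean st \<Longrightarrow> st 1 = code x @ r \<Longrightarrow> exec c st (B x) (st(1 := code (f x) @ r))"
    by (rule FP_E) (rule that; assumption)
  from assms(2) obtain d D where 2: "poly_bounded D"
    "\<And>x st r. clean st \<Longrightarrow> st 1 = code x @ r \<Longrightarrow> exec d st (D x) (st(1 := code (g x) @ r))"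
    by (rule FP_E) (rule that; assumption)
  let ?P = "\<lambda>x. (60 * csize x + 20) + ((D x) + ((40 * csize (g x) + 40 * csize x + 20) + (B x + 3 + 1) + 1) + 1) + 1"
  let ?c = "Seq dup_tree (Seq d (Seq swap_tree (Seq c (Push 1 True))))"
  show ?thesis
  proof (rule FP_I[where B = ?P and c = ?c])
    show "poly_bounded ?P"
      by (intro poly_bounded_intros 1 2 FP_csize[OF assms(2)])
    have "poly_bounded (\<lambda>x. csize (f x) + csize (g x) + 1)"
      by (intro poly_bounded_intros FP_csize assms)
    then show "poly_bounded (\<lambda>x. csize (f x, g x))" by simp
    fix x :: 'a and st r assume st: "clean st" "st 1 = code x @ r"
    show "exec ?c st (?P x) (st(1 := code (f x, g x) @ r))"
      by (rule exec_weaken[OF exec_Seq[OF exec_dup[OF st] exec_Seq[OF 2(2)[where x = x and r = "code x @ r"]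
          exec_Seq[OF exec_swap[where x = "g x" and y = x and r = r]
            exec_Seq[OF 1(2)[where x = x and r = "code (g x) @ r"] exec_Push]]]]]) (use st in auto)
  qed
qed

lemma FP_fst_raw: "FP (fst :: 'a :: data \<times> 'b :: data \<Rightarrow> 'a)"
proof (rule FP_I[where B = "\<lambda>x. 1 + ((40 * csize x + 40 * csize x + 20) + (30 * csize x + 10) + 1) + 1"
      and c = "Seq (Pop 1) (Seq swap_tree drop_tree)"])
  show "poly_bounded (\<lambda>x :: 'a \<times> 'b. csize (fst x))"
    by (rule poly_bounded_mono[OF poly_bounded_csize]) auto
  fix x :: "'a \<times> 'b" and st r assume st: "clean st" "st 1 = code x @ r"
  obtain a b where x: "x = (a, b)" by fastforce
  show "exec (Seq (Pop 1) (Seq swap_tree drop_tree)) st (1 + ((40 * csize x + 40 * csize x + 20) +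
      (30 * csize x + 10) + 1) + 1) (st(1 := code (fst x) @ r))"
    by (rule exec_weaken[OF exec_Seq[OF exec_Pop' exec_Seq[OF exec_swap[where x = a and y = b and r = r]
      exec_drop[where x = b and r = "code a @ r"]]]]) (use st x in auto)
qed (intro poly_bounded_intros)+

lemma FP_snd_raw: "FP (snd :: 'a :: data \<times> 'b :: data \<Rightarrow> 'b)"
proof (rule FP_I[where B = "\<lambda>x. 1 + (30 * csize x + 10) + 1" and c = "Seq (Pop 1) drop_tree"])
  show "poly_bounded (\<lambda>x :: 'a \<times> 'b. csize (snd x))"
    by (rule poly_bounded_mono[OF poly_bounded_csize]) auto
  fix x :: "'a \<times> 'b" and st r assume st: "clean st" "st 1 = code x @ r"
  obtain a b where x: "x = (a, b)" by fastforce
  show "exec (Seq (Pop 1) drop_tree) st (1 + (30 * csize x + 10) + 1) (st(1 := code (snd x) @ r))"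
    by (rule exec_weaken[OF exec_Seq[OF exec_Pop' exec_drop[where x = a and r = "code b @ r"]]]) (use st x in auto)
qed (intro poly_bounded_intros)+

lemmas FP_fst = FP_comp[OF FP_fst_raw]
lemmas FP_snd = FP_comp[OF FP_snd_raw]

lemma FP_If:
  assumes "FP b" "FP f" "FP g"
  shows "FP (\<lambda>x. if b x then f x else g x)"
proof -
  from assms(1) obtain a A where 0: "poly_bounded A"
    "\<And>x st r. clean st \<Longrightarrow> st 1 = code x @ r \<Longrightarrow> exec a st (A x) (st(1 := code (b x) @ r))"
    by (rule FP_E) (rule that; assumption)
  from assms(2) obtain c B where 1: "poly_bounded B"
    "\<And>x st r. clean st \<Longrightarrow> st 1 = code x @ r \<Longrightarrow> exec c st (B x) (st(1 := code (f x) @ r))"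
    by (rule FP_E) (rule that; assumption)
  from assms(3) obtain d D where 2: "poly_bounded D"
    "\<And>x st r. clean st \<Longrightarrow> st 1 = code x @ r \<Longrightarrow> exec d st (D x) (st(1 := code (g x) @ r))"
    by (rule FP_E) (rule that; assumption)
  let ?P = "\<lambda>x. 60 * csize x + 20 + (A x + (B x + D x + 10) + 1) + 1"
  let ?i = "If 1 2 (Seq (Pop 1) (Seq (Pop 1) (Seq (Pop 1) c))) (Seq (Pop 1) d)"
  let ?c = "Seq dup_tree (Seq a ?i)"
  show ?thesis
  proof (rule FP_I[where B = ?P and c = ?c])
    show "poly_bounded ?P"
      by (intro poly_bounded_intros 0 1 2)
    show "poly_bounded (\<lambda>x. csize (if b x then f x else g x))"
      by (rule poly_bounded_mono[OF poly_bounded_add[OF FP_csize[OF assms(2)] FP_csize[OF assms(3)]]]) auto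
    fix x :: 'a and st r assume st: "clean st" "st 1 = code x @ r"
    let ?st = "st(1 := code (b x) @ code x @ r)"
    let ?st' = "st(1 := code (if b x then f x else g x) @ r)"
    have 3: "exec ?i ?st (B x + D x + 10) ?st'"
    proof (cases "b x")
      case True
      have "exec (Seq (Pop 1) (Seq (Pop 1) (Seq (Pop 1) c))) ?st (B x + 9) ?st'"
        by (rule exec_weaken[OF exec_Seq[OF exec_Pop' exec_Seq[OF exec_Pop' exec_Seq[OF exec_Pop'
            1(2)[where x = x and r = r]]]]]) (use st True in auto)
      then show ?thesis
        by (intro exec_weaken[OF exec_If_True[where x = True and w = "False # False # code x @ r"]])
          (use True in auto)
    next
      case False
      have "exec (Seq (Pop 1) d) ?st (D x + 9) ?st'"
        by (rule exec_weaken[OF exec_Seq[OF exec_Pop' 2(2)[where x = x and r = r]]]) (use st False in auto)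
      then show ?thesis
        by (intro exec_weaken[OF exec_If_True[where x = False and w = "code x @ r"]]) (use False in auto)
    qed
    have 4: "exec a (st(1 := code x @ code x @ r)) (A x) ?st"
      using 0(2)[of "st(1 := code x @ code x @ r)" x "code x @ r"] st by simp
    show "exec ?c st (?P x) ?st'"
      by (rule exec_Seq[OF exec_dup[OF st] exec_Seq[OF 4 3]])
  qed
qed

lemma FP_case_list:
  assumes "FP l" "FP f" "FP (\<lambda>z. g (fst z) (fst (snd z)) (snd (snd z)))"
  shows "FP (\<lambda>x. case l x of [] \<Rightarrow> f x | y # ys \<Rightarrow> g x y ys)"
proof -
  from assms(1) obtain a A where 0: "poly_bounded A"
    "\<And>x st r. clean st \<Longrightarrow> st 1 = code x @ r \<Longrightarrow> exec a st (A x) (st(1 := code (l x) @ r))"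
    by (rule FP_E) (rule that; assumption)
  from assms(2) obtain c B where 1: "poly_bounded B"
    "\<And>x st r. clean st \<Longrightarrow> st 1 = code x @ r \<Longrightarrow> exec c st (B x) (st(1 := code (f x) @ r))"
    by (rule FP_E) (rule that; assumption)
  let ?g = "\<lambda>z. g (fst z) (fst (snd z)) (snd (snd z))"
  from assms(3) obtain d D where 2: "poly_bounded D"
    "\<And>x st r. clean st \<Longrightarrow> st 1 = code x @ r \<Longrightarrow> exec d st (D x) (st(1 := code (?g x) @ r))"
    by (rule FP_E) (rule that; assumption)
  obtain p :: "nat poly" where p: "\<And>x. D x \<le> poly p (csize x)"
    using 2(1) by (rule poly_boundedE) (rule that; assumption)
  obtain q :: "nat poly" where q: "\<And>x. csize (?g x) \<le> poly q (csize x)"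
    using FP_csize[OF assms(3)] by (rule poly_boundedE) (rule that; assumption)
  \<comment> \<open>This is the size of \<open>(x, y, ys)\<close>, the argument handed to
    \<open>g\<close>: the pair \<open>(y, ys)\<close> and the list \<open>y # ys\<close> have equal
    codes.\<close>
  let ?N = "\<lambda>x. csize x + csize (l x) + 1"
  let ?I = "\<lambda>x. B x + (100 * ?N x + 100) + poly p (?N x)"
  let ?P = "\<lambda>x. 60 * csize x + 20 + (A x + ?I x + 1) + 1"
  let ?i = "If 1 2 (Seq (Pop 1) (Seq (Push 1 True) (Seq swap_tree (Seq (Push 1 True) d)))) (Seq (Pop 1) c)"
  let ?c = "Seq dup_tree (Seq a ?i)"
  let ?h = "\<lambda>x. case l x of [] \<Rightarrow> f x | y # ys \<Rightarrow> g x y ys"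
  show ?thesis
  proof (rule FP_I[where B = ?P and c = ?c])
    show "poly_bounded ?P"
      by (intro poly_bounded_intros 0 1 FP_csize[OF assms(1)])
    have "csize (?h x) \<le> csize (f x) + poly q (?N x)" for x
    proof (cases "l x")
      case (Cons y ys)
      then show ?thesis using q[of "(x, (y, ys))"] by simp
    qed simp
    then show "poly_bounded (\<lambda>x. csize (?h x))"
      by (rule poly_bounded_mono[rotated]) (intro poly_bounded_intros FP_csize assms)
    fix x :: 'a and st r assume st: "clean st" "st 1 = code x @ r"
    let ?st = "st(1 := code (l x) @ code x @ r)"
    let ?st' = "st(1 := code (?h x) @ r)"
    have 3: "exec ?i ?st (?I x) ?st'"
    proof (cases "l x")
      case (Cons y ys)
      have "D (x, y, ys) \<le> poly p (?N x)" using p[of "(x, y, ys)"] Cons by simp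
      then have "exec (Seq (Pop 1) (Seq (Push 1 True) (Seq swap_tree (Seq (Push 1 True) d)))) ?st
          (99 * ?N x + 99 + poly p (?N x)) ?st'"
        by (intro exec_weaken[OF exec_Seq[OF exec_Pop' exec_Seq[OF exec_Push
            exec_Seq[OF exec_swap[where x = "(y, ys)" and y = x and r = r]
              exec_Seq[OF exec_Push 2(2)[where x = "(x, y, ys)" and r = r]]]]]]) (use st Cons in auto)
      then show ?thesis
        by (intro exec_weaken[OF exec_If_True[where x = True and w = "code y @ code ys @ code x @ r"]])
          (use Cons in auto)
    next
      case Nil
      have "exec (Seq (Pop 1) c) ?st (B x + 9) ?st'"
        by (rule exec_weaken[OF exec_Seq[OF exec_Pop' 1(2)[where x = x and r = r]]]) (use st Nil in auto)
      then show ?thesis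
        by (intro exec_weaken[OF exec_If_True[where x = False and w = "code x @ r"]]) (use Nil in auto)
    qed
    have 4: "exec a (st(1 := code x @ code x @ r)) (A x) ?st"
      using 0(2)[of "st(1 := code x @ code x @ r)" x "code x @ r"] st by simp
    show "exec ?c st (?P x) ?st'"
      by (rule exec_Seq[OF exec_dup[OF st] exec_Seq[OF 4 3]])
  qed
qed

lemma FP_eq_raw: "FP (\<lambda>p :: 'a :: data \<times> 'a. fst p = snd p)"
proof (rule FP_I[where B = "\<lambda>x. 1 + (100 * csize x + 100) + 1" and c = "Seq (Pop 1) equal_trees"])
  show "poly_bounded (\<lambda>p :: 'a \<times> 'a. csize (fst p = snd p))"
    by (rule poly_bounded_mono[OF poly_bounded_const csize_bool])
  fix x :: "'a \<times> 'a" and st r assume st: "clean st" "st 1 = code x @ r"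
  obtain a b where x: "x = (a, b)" by fastforce
  show "exec (Seq (Pop 1) equal_trees) st (1 + (100 * csize x + 100) + 1) (st(1 := code (fst x = snd x) @ r))"
    by (rule exec_weaken[OF exec_Seq[OF exec_Pop' exec_equal_trees[where t = "tree_of a" and u = "tree_of b" and r = r]]])
      (use st x in \<open>auto simp: code_def csize_def tree_of_prod_def tree_of_bool_def\<close>)
qed (intro poly_bounded_intros)+

lemma FP_eq: "FP f \<Longrightarrow> FP g \<Longrightarrow> FP (\<lambda>x. f x = g x)"
  using FP_comp[OF FP_eq_raw FP_Pair, of f g] by simp

text \<open>The loop runs until the first component of the state is exhausted.\<close>

lemma FP_while:
  fixes body :: "'l :: data list \<times> 's :: data \<Rightarrow> 'l list \<times> 's" and init :: "'a :: data \<Rightarrow> 'l list \<times> 's"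
  assumes "FP body" "FP init" "poly_bounded R" "poly_bounded Q"
    and N: "\<And>x. N x \<le> R x" "\<And>x. fst ((body ^^ N x) (init x)) = []"
      "\<And>x j. j < N x \<Longrightarrow> fst ((body ^^ j) (init x)) \<noteq> []"
    and Q: "\<And>x j. j \<le> N x \<Longrightarrow> csize ((body ^^ j) (init x)) \<le> Q x"
  shows "FP (\<lambda>x. snd ((body ^^ N x) (init x)))"
proof -
  from assms(1) obtain a A where 0: "poly_bounded A"
    "\<And>x st r. clean st \<Longrightarrow> st 1 = code x @ r \<Longrightarrow> exec a st (A x) (st(1 := code (body x) @ r))"
    by (rule FP_E) (rule that; assumption)
  from assms(2) obtain c B where 1: "poly_bounded B"
    "\<And>x st r. clean st \<Longrightarrow> st 1 = code x @ r \<Longrightarrow> exec c st (B x) (st(1 := code (init x) @ r))"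
    by (rule FP_E) (rule that; assumption)
  from 0(1) obtain p :: "nat poly" where p: "\<And>x. A x \<le> poly p (csize x)"
    by (rule poly_boundedE) (rule that; assumption)
  let ?w = "While 1 [2] (Seq (Push 1 True) (Seq a (Pop 1)))"
  let ?c = "Seq c (Seq (Pop 1) (Seq ?w (Pop 1)))"
  let ?W = "\<lambda>x. R x * (poly p (Q x) + 10) + 10"
  let ?P = "\<lambda>x. B x + (1 + (?W x + 1 + 1) + 1) + 1"
  let ?h = "\<lambda>x. snd ((body ^^ N x) (init x))"
  show ?thesis
  proof (rule FP_I[where B = ?P and c = ?c])
    show "poly_bounded ?P" by (intro poly_bounded_intros assms 1)
    have "csize (?h x) \<le> Q x" for x
    proof -
      have "csize (?h x) \<le> csize ((body ^^ N x) (init x))"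
        by (cases "(body ^^ N x) (init x)") simp
      with Q[of "N x" x] show ?thesis by simp
    qed
    then show "poly_bounded (\<lambda>x. csize (?h x))" by (rule poly_bounded_mono[OF assms(4)])
    fix x :: 'a and st r assume st: "clean st" "st 1 = code x @ r"
    \<comment> \<open>The loop keeps the code of the pair without its leading node bit. The top of
      the stack is then the constructor bit of the first component, which is the loop test; the bit
      is restored around each call of the body.\<close>
    let ?s = "\<lambda>j. st(1 := tl (code ((body ^^ j) (init x)) @ r))"
    have hd: "code z = True # tl (code z)" for z :: "'l list \<times> 's" by (cases z) simp
    have hd': "True # tl (code z @ w) = code z @ w" for z :: "'l list \<times> 's" and w by (cases z) simp
    have step: "exec (Seq (Push 1 True) (Seq a (Pop 1))) (?s j) (poly p (Q x) + 8) (?s (Suc j))" if "j \<le> N x" for j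
    proof -
      have "A ((body ^^ j) (init x)) \<le> poly p (Q x)"
        using p[of "(body ^^ j) (init x)"] Q[OF that] poly_nat_mono order_trans by blast
      then show ?thesis
        by (intro exec_weaken[OF exec_Seq[OF exec_Push exec_Seq[OF 0(2)[where x = "(body ^^ j) (init x)" and r = r] exec_Pop']]])
          (use st hd[of "(body ^^ j) (init x)"] hd[of "body ((body ^^ j) (init x))"] in \<open>auto simp: fun_eq_iff hd' simp del: code_simps\<close>)
    qed
    have loop: "exec ?w (?s (N x - i)) (i * (poly p (Q x) + 9) + 1) (?s (N x))" if "i \<le> N x" for i
      using that
    proof (induction i)
      case 0
      have "top (?s (N x) 1) = 1"
        using N(2)[of x] by (cases "(body ^^ N x) (init x)") simp
      then show ?case
        by (intro exec_weaken[OF exec_While_done]) auto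
    next
      case (Suc i)
      let ?j = "N x - Suc i"
      have j: "N x - i = Suc ?j" using Suc.prems by simp
      obtain u us v where "(body ^^ ?j) (init x) = (u # us, v)"
        using N(3)[of ?j x] Suc.prems by (cases "(body ^^ ?j) (init x)") (auto simp: neq_Nil_conv)
      then have "top (?s ?j 1) \<in> set [2]" by simp
      from exec_While_step[OF _ this step[of ?j] Suc.IH[OF Suc_leD[OF Suc.prems], unfolded j]]
      show ?case by (rule exec_weaken) auto
    qed
    have "N x * (poly p (Q x) + 9) \<le> R x * (poly p (Q x) + 10)"
      using N(1)[of x] by (intro mult_mono) auto
    then have loop': "exec ?w (?s 0) (?W x) (?s (N x))"
      using exec_weaken[OF loop[of "N x"]] by simp
    have "tl (code ((body ^^ N x) (init x)) @ r) = False # code (?h x) @ r"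
      using N(2)[of x] by (cases "(body ^^ N x) (init x)") simp
    then have fin: "exec (Pop 1) (?s (N x)) 1 (st(1 := code (?h x) @ r))"
      by (intro exec_weaken[OF exec_Pop']) auto
    have start: "exec (Pop 1) (st(1 := code (init x) @ r)) 1 (?s 0)"
      by (rule exec_weaken[OF exec_Pop']) (use hd[of "init x"] in auto)
    show "exec ?c st (?P x) (st(1 := code (?h x) @ r))"
      by (rule exec_Seq[OF 1(2)[OF st] exec_Seq[OF start exec_Seq[OF loop' fin]]])
  qed
qed


section \<open>From data to words on tapes\<close>

definition init_tapes :: "bool list \<Rightarrow> tape list" where
  "init_tapes x = input_tape x # replicate 5 (input_tape [])"

abbreviation input_stacks :: "bool list \<Rightarrow> stacks" where
  "input_stacks x \<equiv> (\<lambda>_. [])(0 := x)"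

lemma represents_init: "represents (input_stacks x) (init_tapes x)"
proof -
  have "input_tape [] = (\<lambda>_. 0, 0)"
    by (auto simp: input_tape_def fun_eq_iff)
  then have "stack_on [] (input_tape [])" "output_on [] (input_tape [])"
    by (auto simp: stack_on_def output_on_def)
  moreover have "stack_on x (input_tape x)"
    by (auto simp: stack_on_def input_tape_def)
  ultimately show ?thesis
    by (auto simp: represents_def init_tapes_def nth_Cons split: nat.splits)
qed

lemma run_machine:
  "run (machine c) x n = (case (sstep ^^ n) ([c], init_tapes x) of (k, ts) \<Rightarrow> (to_nat k, ts))"
proof -
  have "init_config (machine c) x = (to_nat [c], init_tapes x)"
    by (simp add: init_config_def init_tapes_def machine_def)
  then show ?thesis unfolding run_def using steps_machine by simp
qed

text \<open>The code of a list is built from its end, so the input is first reversed onto tape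
  2.\<close>

definition read_input :: com where
  "read_input = Seq (flush 0 2) (Seq (Push 1 False)
     (While 2 [1, 2] (Seq (If 2 2 (push_bits (True # code True)) (push_bits (True # code False))) (Pop 2))))"

lemma exec_read_loop:
  "st 1 = code w \<Longrightarrow>
    exec (While 2 [1, 2] (Seq (If 2 2 (push_bits (True # code True)) (push_bits (True # code False))) (Pop 2)))
      st (30 * length (st 2) + 1) (st(1 := code (rev (st 2) @ w), 2 := []))"
proof (induction "st 2" arbitrary: st w)
  case Nil
  then show ?case by (intro exec_weaken[OF exec_While_done]) (auto simp: fun_eq_iff)
next
  case (Cons b v)
  note 2 = Cons.hyps(2)[symmetric]
  let ?st = "st(1 := code (b # w), 2 := v)"
  have "exec (if b then push_bits (True # code True) else push_bits (True # code False)) st 21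
    (st(1 := code (b # w)))"
    using exec_weaken[OF exec_push_bits[of "True # code b" st]] Cons.prems
    by (cases b) (simp_all del: push_bits.simps)
  from exec_If_True[OF _ 2 this]
  have 1: "exec (Seq (If 2 2 (push_bits (True # code True)) (push_bits (True # code False))) (Pop 2)) st 24 ?st"
    by (intro exec_weaken[OF exec_Seq[OF _ exec_Pop']]) (use 2 in auto)
  have 3: "exec (While 2 [1, 2] (Seq (If 2 2 (push_bits (True # code True)) (push_bits (True # code False))) (Pop 2)))
      ?st (30 * length (?st 2) + 1) (?st(1 := code (rev (?st 2) @ (b # w)), 2 := []))"
    by (rule Cons.hyps) auto
  show ?case
    by (rule exec_weaken[OF exec_While_step[OF _ top_bit[OF 2] 1 3]]) (auto simp: 2 fun_eq_iff)
qed

lemma exec_read_input: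
  "exec read_input (input_stacks x) (40 * length x + 10) ((input_stacks [])(1 := code x))"
  unfolding read_input_def
  by (rule exec_weaken[OF exec_Seq[OF exec_flush exec_Seq[OF exec_Push exec_read_loop[where w = "[]"]]]])
    (auto simp: fun_eq_iff)

definition write_output :: com where
  "write_output = While 1 [2] (Seq (Pop 1)
     (If 1 2 (Seq (Pop 1) (Seq (Pop 1) (Seq (Pop 1) (Out True)))) (Seq (Pop 1) (Out False))))"

lemma exec_write_output:
  "st 1 = code y \<Longrightarrow> exec write_output st (20 * length y + 1) (st(1 := [False], 5 := st 5 @ y))"
proof (induction y arbitrary: st)
  case Nil
  then show ?case unfolding write_output_def
    by (intro exec_weaken[OF exec_While_done]) (auto simp: fun_eq_iff)
next
  case (Cons b y)
  let ?st = "st(1 := code y, 5 := st 5 @ [b])"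
  let ?i = "If 1 2 (Seq (Pop 1) (Seq (Pop 1) (Seq (Pop 1) (Out True)))) (Seq (Pop 1) (Out False))"
  have "exec ?i (st(1 := code b @ code y)) 10 ?st"
  proof (cases b)
    case True
    have "exec (Seq (Pop 1) (Seq (Pop 1) (Seq (Pop 1) (Out True)))) (st(1 := code b @ code y)) 9 ?st"
      by (rule exec_weaken[OF exec_Seq[OF exec_Pop' exec_Seq[OF exec_Pop' exec_Seq[OF exec_Pop' exec_Out]]]])
        (auto simp: True fun_eq_iff)
    then show ?thesis
      by (intro exec_weaken[OF exec_If_True[where x = True and w = "False # False # code y"]]) (auto simp: True)
  next
    case False
    have "exec (Seq (Pop 1) (Out False)) (st(1 := code b @ code y)) 9 ?st"
      by (rule exec_weaken[OF exec_Seq[OF exec_Pop' exec_Out]]) (auto simp: False fun_eq_iff)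
    then show ?thesis
      by (intro exec_weaken[OF exec_If_True[where x = False and w = "code y"]]) (auto simp: False)
  qed
  then have 1: "exec (Seq (Pop 1) ?i) st 12 ?st"
    by (intro exec_weaken[OF exec_Seq[OF exec_Pop]]) (use Cons.prems in auto)
  have 2: "exec write_output ?st (20 * length y + 1) (?st(1 := [False], 5 := ?st 5 @ y))"
    by (rule Cons.IH) simp
  show ?case
    unfolding write_output_def
    by (rule exec_weaken[OF exec_While_step[OF _ _ 1 2[unfolded write_output_def]]])
      (use Cons.prems in \<open>auto simp: fun_eq_iff\<close>)
qed

lemma csize_word: "csize x \<le> 4 * length x + 1" for x :: "bool list"
proof (induction x)
  case (Cons b x)
  then show ?case using csize_bool[of b] by simp
qed simp

lemma FP_on_words:
  fixes f :: "bool list \<Rightarrow> 'a :: data"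
  assumes "FP f"
  obtains c and p :: "nat poly" where
    "\<And>x. exec c (input_stacks x) (poly p (length x)) ((input_stacks [])(1 := code (f x)))"
    "\<And>x. csize (f x) \<le> poly p (length x)"
proof -
  from assms obtain c B where c: "poly_bounded B"
    "\<And>x st r. clean st \<Longrightarrow> st 1 = code x @ r \<Longrightarrow> exec c st (B x) (st(1 := code (f x) @ r))"
    by (rule FP_E) (rule that; assumption)
  have "poly_bounded (\<lambda>x. csize (f x) + (40 * csize x + 10 + B x + 1))"
    by (intro poly_bounded_intros FP_csize assms c)
  then obtain p :: "nat poly" where p: "\<And>x. csize (f x) + (40 * csize x + 10 + B x + 1) \<le> poly p (csize x)"
    by (rule poly_boundedE) (rule that; assumption)
  \<comment> \<open>The polynomial \<open>p\<close> refers to the size of the code;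
    \<open>csize_word\<close> bounds it by four times the length plus one.\<close>
  have le: "csize (f x) + (40 * csize x + 10 + B x + 1) \<le> poly (p \<circ>\<^sub>p [:1, 4:]) (length x)" for x
  proof -
    have "poly p (csize x) \<le> poly p (1 + length x * 4)"
      by (rule poly_nat_mono) (use csize_word[of x] in simp)
    with p[of x] show ?thesis by (simp add: poly_pcompose)
  qed
  show ?thesis
  proof (rule that[of "Seq read_input c" "p \<circ>\<^sub>p [:1, 4:]"])
    fix x
    have 1: "exec c ((input_stacks [])(1 := code x)) (B x) ((input_stacks [])(1 := code (f x)))"
      using c(2)[of "(input_stacks [])(1 := code x)" x "[]"] by (simp add: clean_def)
    show "exec (Seq read_input c) (input_stacks x) (poly (p \<circ>\<^sub>p [:1, 4:]) (length x)) ((input_stacks [])(1 := code (f x)))"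
      by (rule exec_weaken[OF exec_Seq[OF exec_read_input 1]]) (use le[of x] length_le_csize[of x] in auto)
    show "csize (f x) \<le> poly (p \<circ>\<^sub>p [:1, 4:]) (length x)"
      using le[of x] by simp
  qed
qed

theorem FP_in_class_P:
  assumes "FP (\<lambda>x. x \<in> L)"
  shows "L \<in> class_P"
proof -
  obtain c and p :: "nat poly" where c:
    "\<And>x. exec c (input_stacks x) (poly p (length x)) ((input_stacks [])(1 := code (x \<in> L)))"
    using assms by (rule FP_on_words) (rule that; assumption)
  let ?i = "If 1 2 Skip Rej"
  let ?M = "machine (Seq c ?i)"
  \<comment> \<open>The three extra steps unfold \<open>Seq\<close>, evaluate the branch and execute
    \<open>Skip\<close>.\<close>
  have "decides_in_time ?M L (poly (p + [:3:]))"
    unfolding decides_in_time_def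
  proof
    fix x
    let ?st = "(input_stacks [])(1 := code (x \<in> L))"
    obtain n ts where n: "n \<le> poly p (length x)" "represents ?st ts"
      "\<And>k. (sstep ^^ n) (c # k, init_tapes x) = (k, ts)"
      using c[of x] represents_init[of x] unfolding exec_def by blast
    have start: "sstep ([Seq c ?i], init_tapes x) = ([c, ?i], init_tapes x)"
      using map2_stay[of "init_tapes x"] by (simp add: sstep_def)
    have branch: "sstep ([?i], ts) = ([if x \<in> L then Skip else Rej], ts)"
      using map2_stay[of ts] read_top[OF n(2), of 1] by (simp add: sstep_def split: if_splits)
    have skip: "sstep ([Skip], ts) = ([], ts)"
      using map2_stay[of ts] by (simp add: sstep_def)
    have 1: "(sstep ^^ (1 + n + 1)) ([Seq c ?i], init_tapes x) = ([if x \<in> L then Skip else Rej], ts)"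
      by (rule funpow_compose[where f = sstep and n = n and m = 1, OF start n(3)]) (use branch in simp)
    have 2: "(sstep ^^ (2 + n + 1)) ([Seq c ?i], init_tapes x) = ([], ts)" if "x \<in> L"
      by (rule funpow_compose[where f = sstep and n = n and m = 2, OF start n(3)])
        (use branch skip that in \<open>simp add: numeral_2_eq_2\<close>)
    show "\<exists>m\<le>poly (p + [:3:]) (length x).
        fst (run ?M x m) = (if x \<in> L then accept_state ?M else reject_state ?M)"
    proof (cases "x \<in> L")
      case True
      then show ?thesis using n(1) 2
        by (intro exI[of _ "2 + n + 1"]) (simp add: run_machine, simp add: machine_def)
    next
      case False
      then show ?thesis using n(1) 1
        by (intro exI[of _ "1 + n + 1"]) (simp add: run_machine, simp add: machine_def)
    qed
  qed
  then show ?thesis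
    unfolding class_P_def using wf_machine by blast
qed

theorem FP_polytime_computable:
  assumes "FP f"
  shows "polytime_computable f"
proof -
  obtain c and p :: "nat poly" where c:
    "\<And>x. exec c (input_stacks x) (poly p (length x)) ((input_stacks [])(1 := code (f x)))"
    "\<And>x. csize (f x) \<le> poly p (length x)"
    using assms by (rule FP_on_words) (rule that; assumption)
  let ?M = "machine (Seq c write_output)"
  have "computes_in_time ?M f (poly (p + [:20:] * p + [:2:]))"
    unfolding computes_in_time_def
  proof
    fix x
    let ?st = "(input_stacks [])(1 := code (f x))"
    have "exec write_output ?st (20 * length (f x) + 1) (?st(1 := [False], 5 := ?st 5 @ f x))"
      by (rule exec_write_output) simp
    from exec_Seq[OF c(1) this] represents_init[of x] obtain n ts where n:
      "n \<le> poly p (length x) + (20 * length (f x) + 1) + 1"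
      "represents (?st(1 := [False], 5 := f x)) ts"
      "(sstep ^^ n) ([Seq c write_output], init_tapes x) = ([], ts)"
      unfolding exec_def by fastforce
    have run: "run ?M x n = (to_nat ([] :: com list), ts)"
      using n(3) by (simp add: run_machine)
    obtain t h where th: "ts ! 5 = (t, h)" by fastforce
    have "output_on (f x) (t, h)" "length ts = 6" using n(2) th by (auto simp: represents_def)
    moreover have "last ts = ts ! 5" using \<open>length ts = 6\<close> by (subst last_conv_nth) auto
    ultimately have "has_output (run ?M x n) (f x)"
      using th by (auto simp: has_output_def run output_on_def Let_def)
    moreover have "fst (run ?M x n) = accept_state ?M" by (simp add: run) (simp add: machine_def)
    moreover have "n \<le> poly (p + [:20:] * p + [:2:]) (length x)"
      using n(1) c(2)[of x] length_le_csize[of "f x"] by simp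
    ultimately show "\<exists>n\<le>poly (p + [:20:] * p + [:2:]) (length x).
        fst (run ?M x n) = accept_state ?M \<and> has_output (run ?M x n) (f x)" by blast
  qed
  then show ?thesis
    unfolding polytime_computable_def using wf_machine by blast
qed


section \<open>Closure properties of polynomial-time functions\<close>

named_theorems FP_intros

declare FP_id [FP_intros] FP_const [FP_intros] FP_Pair [FP_intros] FP_fst [FP_intros] FP_snd [FP_intros]
  FP_If [FP_intros] FP_case_list [FP_intros] FP_eq [FP_intros]

text \<open>The pattern for functions of several arguments: membership in \<open>FP\<close> is shown
  once for the uncurried function, and the arguments may then depend on a context
  \<open>x\<close>.\<close>

lemma FP_comp2:
  assumes "FP (\<lambda>z. g (fst z) (snd z))" "FP a" "FP b"
  shows "FP (\<lambda>x. g (a x) (b x))"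
  using FP_comp[OF assms(1) FP_Pair[OF assms(2,3)]] by simp

lemma FP_comp3:
  assumes "FP (\<lambda>z. g (fst z) (fst (snd z)) (snd (snd z)))" "FP a" "FP b" "FP c"
  shows "FP (\<lambda>x. g (a x) (b x) (c x))"
  using FP_comp[OF assms(1) FP_Pair[OF assms(2) FP_Pair[OF assms(3,4)]]] by simp

lemma FP_comp4:
  assumes "FP (\<lambda>z. g (fst z) (fst (snd z)) (fst (snd (snd z))) (snd (snd (snd z))))" "FP a" "FP b" "FP c" "FP d"
  shows "FP (\<lambda>x. g (a x) (b x) (c x) (d x))"
  using FP_comp[OF assms(1) FP_Pair[OF assms(2) FP_Pair[OF assms(3) FP_Pair[OF assms(4,5)]]]] by simp

lemma FP_case_prod [FP_intros]:
  assumes "FP (\<lambda>x. g x (fst (p x)) (snd (p x)))"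
  shows "FP (\<lambda>x. case p x of (a, b) \<Rightarrow> g x a b)"
  using assms by (simp add: case_prod_beta)

lemma FP_Let [FP_intros]:
  assumes "FP f" "FP (\<lambda>z. g (fst z) (snd z))"
  shows "FP (\<lambda>x. let y = f x in g x y)"
  using FP_comp2[OF assms(2) FP_id assms(1)] by simp

lemma FP_Cons [FP_intros]:
  assumes "FP f" "FP g"
  shows "FP (\<lambda>x. f x # g x)"
proof -
  have "FP (\<lambda>p. fst p # snd p)" by (rule FP_recode) auto
  from FP_comp[OF this FP_Pair[OF assms]] show ?thesis by simp
qed

lemma FP_not [FP_intros]:
  assumes "FP b" shows "FP (\<lambda>x. \<not> b x)"
proof -
  have "FP (\<lambda>x. if b x then False else True)" by (intro FP_intros assms)
  moreover have "(if p then False else True) \<longleftrightarrow> \<not> p" for p by simp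
  ultimately show ?thesis by (simp only:)
qed

lemma FP_conj [FP_intros]:
  assumes "FP a" "FP b" shows "FP (\<lambda>x. a x \<and> b x)"
proof -
  have "FP (\<lambda>x. if a x then b x else False)" by (intro FP_intros assms)
  moreover have "(if p then q else False) \<longleftrightarrow> p \<and> q" for p q by simp
  ultimately show ?thesis by simp
qed

lemma FP_disj [FP_intros]: "FP a \<Longrightarrow> FP b \<Longrightarrow> FP (\<lambda>x. a x \<or> b x)"
  using FP_not[OF FP_conj[OF FP_not FP_not], of a b] by simp

lemma FP_tl [FP_intros]:
  assumes "FP l" shows "FP (\<lambda>x. tl (l x))"
  unfolding tl_def by (intro FP_intros assms)

lemma FP_hd [FP_intros]:
  assumes "FP l" shows "FP (\<lambda>x. hd (l x))"
proof -
  have "(\<lambda>x. hd (l x)) = (\<lambda>x. case l x of [] \<Rightarrow> hd [] | y # ys \<Rightarrow> y)"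
    by (auto split: list.splits)
  moreover have "FP (\<lambda>x. case l x of [] \<Rightarrow> hd [] | y # ys \<Rightarrow> y)"
    by (intro FP_intros assms)
  ultimately show ?thesis by simp
qed

text \<open>Iterating a polynomially bounded function can blow sizes up exponentially, so a bound
  \<open>B\<close> on all intermediate values must be supplied; the prefixes \<open>ys\<close>
  describe the rounds.\<close>

lemma FP_fold:
  assumes "FP l" "FP i" "FP (\<lambda>z. f (fst z) (fst (snd z)) (snd (snd z)))" "poly_bounded B"
    and B: "\<And>x ys zs. l x = ys @ zs \<Longrightarrow> csize (fold (f x) ys (i x)) \<le> B x"
  shows "FP (\<lambda>x. fold (f x) (l x) (i x))"
proof -
  \<comment> \<open>The argument \<open>x\<close> travels along in the state, since
    \<open>f x\<close> must be available in every round.\<close>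
  let ?body = "\<lambda>z. case fst z of [] \<Rightarrow> z | y # ys \<Rightarrow> (ys, (fst (snd z), f (fst (snd z)) y (snd (snd z))))"
  let ?init = "\<lambda>x. (l x, (x, i x))"
  have pow: "(?body ^^ j) (?init x) = (drop j (l x), (x, fold (f x) (take j (l x)) (i x)))"
    if "j \<le> length (l x)" for j x
    using that
  proof (induction j)
    case (Suc j)
    then have "drop j (l x) = l x ! j # drop (Suc j) (l x)" by (intro Cons_nth_drop_Suc[symmetric]) simp
    moreover have "take (Suc j) (l x) = take j (l x) @ [l x ! j]"
      using Suc.prems by (intro take_Suc_conv_app_nth) simp
    ultimately show ?case using Suc by simp
  qed simp
  have f: "FP (\<lambda>x. f (a x) (b x) (c x))" if "FP a" "FP b" "FP c" for a b c
    by (rule FP_comp3[OF assms(3) that])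
  let ?Q = "\<lambda>x. csize (l x) + csize x + B x + 2"
  have "FP (\<lambda>x. snd ((?body ^^ length (l x)) (?init x)))"
  proof (rule FP_while[where R = "\<lambda>x. csize (l x)" and Q = ?Q])
    show "FP ?body" by (intro FP_intros f)
    show "FP ?init" by (intro FP_intros assms)
    show "poly_bounded ?Q" by (intro poly_bounded_intros FP_csize assms)
    show "poly_bounded (\<lambda>x. csize (l x))" by (intro FP_csize assms)
    fix x
    show "length (l x) \<le> csize (l x)" using length_le_csize[of "l x"] by simp
    show "fst ((?body ^^ length (l x)) (?init x)) = []" by (subst pow) auto
    fix j
    show "fst ((?body ^^ j) (?init x)) \<noteq> []" if "j < length (l x)" using that by (subst pow) auto
    show "csize ((?body ^^ j) (?init x)) \<le> ?Q x" if "j \<le> length (l x)"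
    proof -
      have "csize (drop j (l x)) + csize (take j (l x)) = csize (l x) + 1"
        using csize_append[of "take j (l x)" "drop j (l x)"] by simp
      moreover have "csize (take j (l x)) > 0" by (rule csize_pos)
      moreover have "csize (fold (f x) (take j (l x)) (i x)) \<le> B x"
        by (rule B[of _ _ "drop j (l x)"]) simp
      ultimately show ?thesis using that by (subst pow) auto
    qed
  qed
  from FP_snd[OF this] show ?thesis by (simp add: pow)
qed

lemma FP_rev [FP_intros]:
  assumes "FP l" shows "FP (\<lambda>x. rev (l x))"
proof -
  have "FP (\<lambda>x. fold (\<lambda>y s. y # s) (l x) [])"
  proof (rule FP_fold[where B = "\<lambda>x. csize (l x)"])
    fix x ys zs assume "l x = ys @ zs"
    then show "csize (fold (\<lambda>y s. y # s) ys []) \<le> csize (l x)"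
      using csize_append[of ys zs] csize_pos[of zs] by (simp add: fold_Cons_rev)
  qed (intro FP_intros FP_csize assms)+
  then show ?thesis by (simp add: fold_Cons_rev)
qed

lemma FP_append [FP_intros]:
  assumes "FP a" "FP b" shows "FP (\<lambda>x. a x @ b x)"
proof -
  have "FP (\<lambda>x. fold (\<lambda>y s. y # s) (rev (a x)) (b x))"
  proof (rule FP_fold[where B = "\<lambda>x. csize (a x) + csize (b x)"])
    fix x ys zs assume *: "rev (a x) = ys @ zs"
    then have "csize (a x) + 1 = csize ys + csize zs"
      using csize_append[of ys zs] csize_rev[of "a x"] by simp
    then show "csize (fold (\<lambda>y s. y # s) ys (b x)) \<le> csize (a x) + csize (b x)"
      using csize_pos[of zs] csize_append[of "rev ys" "b x"] by (simp add: fold_Cons_rev)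
  qed (intro FP_intros FP_csize assms poly_bounded_intros)+
  then show ?thesis by (simp add: fold_Cons_rev)
qed

lemma FP_map [FP_intros]:
  assumes "FP (\<lambda>z. f (fst z) (snd z))" "FP l"
  shows "FP (\<lambda>x. map (f x) (l x))"
proof -
  obtain q :: "nat poly" where q: "\<And>z. csize (f (fst z) (snd z)) \<le> poly q (csize z)"
    using FP_csize[OF assms(1)] by (rule poly_boundedE) (rule that; assumption)
  let ?B = "\<lambda>x. csize (l x) * (poly q (csize x + csize (l x) + 1) + 1) + 1"
  have eq: "fold (\<lambda>y s. f x y # s) ys [] = rev (map (f x) ys)" for x ys
  proof -
    have "fold (\<lambda>y s. f x y # s) ys s = rev (map (f x) ys) @ s" for s
      by (induction ys arbitrary: s) auto
    then show ?thesis by simp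
  qed
  have "FP (\<lambda>x. fold (\<lambda>y s. f x y # s) (l x) [])"
  proof (rule FP_fold[where B = ?B])
    fix x ys zs assume l: "l x = ys @ zs"
    have "csize (map (f x) ys) \<le> length (map (f x) ys) * (poly q (csize x + csize (l x) + 1) + 1) + 1"
    proof (rule csize_list_le)
      fix w assume "w \<in> set (map (f x) ys)"
      then obtain y where y: "y \<in> set ys" "w = f x y" by auto
      then have "csize y < csize (l x)" using l by (intro csize_member) auto
      then have "poly q (csize (x, y)) \<le> poly q (csize x + csize (l x) + 1)" by (intro poly_nat_mono) simp
      with q[of "(x, y)"] y show "csize w \<le> poly q (csize x + csize (l x) + 1)" by simp
    qed
    also have "\<dots> \<le> ?B x"
      using length_le_csize[of "l x"] l by (intro add_mono mult_mono) auto
    finally show "csize (fold (\<lambda>y s. f x y # s) ys []) \<le> ?B x" by (simp add: eq)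
  next
    have "FP (\<lambda>z. f (fst z) (fst (snd z)))"
      by (intro FP_comp2[OF assms(1)] FP_intros)
    then show "FP (\<lambda>z. f (fst z) (fst (snd z)) # snd (snd z))"
      by (intro FP_intros)
  qed (intro FP_intros FP_csize assms poly_bounded_intros)+
  from FP_rev[OF this] show ?thesis by (simp add: eq)
qed

lemma FP_concat [FP_intros]:
  assumes "FP l" shows "FP (\<lambda>x. concat (l x))"
proof -
  have eq: "fold (\<lambda>y s. s @ y) ys [] = concat ys" for ys :: "'b list list"
  proof -
    have "fold (\<lambda>y s. s @ y) ys s = s @ concat ys" for s
      by (induction ys arbitrary: s) auto
    then show ?thesis by simp
  qed
  have le: "csize (concat ys) \<le> csize ys" for ys :: "'b list list"
  proof (induction ys)
    case (Cons y ys)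
    then show ?case using csize_append[of y "concat ys"] by simp
  qed simp
  have "FP (\<lambda>x. fold (\<lambda>y s. s @ y) (l x) [])"
  proof (rule FP_fold[where B = "\<lambda>x. csize (l x)"])
    fix x ys zs assume "l x = ys @ zs"
    then show "csize (fold (\<lambda>y s. s @ y) ys []) \<le> csize (l x)"
      using le[of ys] csize_append[of ys zs] csize_pos[of zs] by (simp add: eq)
  qed (intro FP_intros FP_csize assms)+
  then show ?thesis by (simp add: eq)
qed

lemma FP_filter [FP_intros]:
  assumes "FP (\<lambda>z. P (fst z) (snd z))" "FP l"
  shows "FP (\<lambda>x. filter (P x) (l x))"
proof -
  have "filter (P x) ys = concat (map (\<lambda>y. if P x y then [y] else []) ys)" for x ys
    by (induction ys) auto
  then show ?thesis by simp (intro FP_intros assms)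
qed

lemma FP_Bex [FP_intros]:
  assumes "FP (\<lambda>z. P (fst z) (snd z))" "FP l"
  shows "FP (\<lambda>x. \<exists>y \<in> set (l x). P x y)"
proof -
  have "(\<exists>y \<in> set ys. P x y) \<longleftrightarrow> filter (P x) ys \<noteq> []" for x ys
    by (auto simp: filter_empty_conv)
  then show ?thesis by simp (intro FP_intros assms)
qed

lemma FP_Ball [FP_intros]:
  assumes "FP (\<lambda>z. P (fst z) (snd z))" "FP l"
  shows "FP (\<lambda>x. \<forall>y \<in> set (l x). P x y)"
proof -
  have "(\<forall>y \<in> set ys. P x y) \<longleftrightarrow> \<not> (\<exists>y \<in> set ys. \<not> P x y)" for x ys by auto
  then show ?thesis by (simp only:) (intro FP_not FP_Bex assms)
qed

lemma FP_member [FP_intros]: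
  assumes "FP a" "FP l"
  shows "FP (\<lambda>x. a x \<in> set (l x))"
proof -
  have "FP (\<lambda>z. a (fst z) = snd z)"
    by (intro FP_eq FP_comp[OF assms(1)] FP_intros)
  then have "FP (\<lambda>x. \<exists>y \<in> set (l x). a x = y)" by (intro FP_Bex assms)
  moreover have "(\<exists>y \<in> set ys. v = y) \<longleftrightarrow> v \<in> set ys" for v :: 'b and ys by auto
  ultimately show ?thesis by (simp only:)
qed

section \<open>Arithmetic on unary numbers through lists of units\<close>

lemma FP_unit_list [FP_intros]: "FP n \<Longrightarrow> FP (\<lambda>x. replicate (n x) ())"
  by (rule FP_comp[OF FP_recode]) (simp add: code_nat_eq_list)

lemma FP_length [FP_intros]:
  assumes "FP l" shows "FP (\<lambda>x. length (l x))"
proof -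
  have 1: "FP (\<lambda>us :: unit list. length us)"
  proof (rule FP_recode)
    fix us :: "unit list"
    have "replicate (length us) () = us" by (induction us) auto
    then show "code (length us) = code us" by (simp add: code_nat_eq_list)
  qed
  have "FP (\<lambda>x. map (\<lambda>_. ()) (l x))" by (intro FP_intros assms)
  from FP_comp[OF 1 this] show ?thesis by simp
qed

lemma FP_replicate [FP_intros]:
  assumes "FP n" "FP f" shows "FP (\<lambda>x. replicate (n x) (f x))"
proof -
  have "FP (\<lambda>z. f (fst z))" by (intro FP_comp[OF assms(2)] FP_intros)
  then have "FP (\<lambda>x. map (\<lambda>_. f x) (replicate (n x) ()))"
    by (intro FP_map FP_unit_list assms)
  then show ?thesis by simp
qed

lemma FP_plus [FP_intros]: "FP m \<Longrightarrow> FP n \<Longrightarrow> FP (\<lambda>x. m x + n x :: nat)"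
  using FP_length[OF FP_append[OF FP_unit_list FP_unit_list], of m n] by simp

lemma FP_Suc [FP_intros]: "FP n \<Longrightarrow> FP (\<lambda>x. Suc (n x))"
  using FP_plus[OF _ FP_const, of n "Suc 0"] by simp

lemma FP_times [FP_intros]:
  assumes "FP m" "FP n" shows "FP (\<lambda>x. m x * n x :: nat)"
proof -
  have "FP (\<lambda>x. length (concat (replicate (m x) (replicate (n x) ()))))"
    by (intro FP_intros assms)
  then show ?thesis by (simp add: length_concat sum_list_replicate)
qed

lemma FP_fold_bounded:
  assumes "FP l" "FP i" "FP (\<lambda>z. f (fst z) (fst (snd z)) (snd (snd z)))" "FP B"
    and "\<And>x ys zs. l x = ys @ zs \<Longrightarrow> csize (fold (f x) ys (i x)) \<le> csize (B x)"
  shows "FP (\<lambda>x. fold (f x) (l x) (i x))"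
  using FP_fold[OF assms(1-3) FP_csize[OF assms(4)] assms(5)] .

lemma FP_drop [FP_intros]:
  assumes "FP n" "FP l" shows "FP (\<lambda>x. drop (n x) (l x))"
proof -
  have eq: "fold (\<lambda>_ s. tl s) us s = drop (length us) s" for us :: "unit list" and s :: "'b list"
    by (induction us arbitrary: s) (auto simp: drop_Suc)
  have "FP (\<lambda>x. fold (\<lambda>_ s. tl s) (replicate (n x) ()) (l x))"
  proof (rule FP_fold_bounded[where B = l])
    fix x and ys zs :: "unit list"
    have "csize (drop (length ys) (l x)) \<le> csize (l x)"
      using csize_append[of "take (length ys) (l x)" "drop (length ys) (l x)"]
        csize_pos[of "take (length ys) (l x)"] by simp
    then show "csize (fold (\<lambda>_ s. tl s) ys (l x)) \<le> csize (l x)" by (simp add: eq)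
  qed (intro FP_intros assms)+
  then show ?thesis by (simp only: eq length_replicate)
qed

lemma FP_minus [FP_intros]: "FP m \<Longrightarrow> FP n \<Longrightarrow> FP (\<lambda>x. m x - n x :: nat)"
  using FP_length[OF FP_drop[OF _ FP_unit_list], of n m] by simp

lemma FP_take [FP_intros]:
  assumes "FP n" "FP l" shows "FP (\<lambda>x. take (n x) (l x))"
proof -
  have "FP (\<lambda>x. rev (drop (length (l x) - n x) (rev (l x))))"
    by (intro FP_intros assms)
  moreover have "rev (drop (length ys - k) (rev ys)) = take k ys" for k and ys :: "'b list"
    by (cases "k \<le> length ys") (auto simp: rev_drop)
  ultimately show ?thesis by (simp only:)
qed

lemma FP_less [FP_intros]: "FP m \<Longrightarrow> FP n \<Longrightarrow> FP (\<lambda>x. m x < (n x :: nat))"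
  using FP_not[OF FP_eq[OF FP_minus FP_const], of n m 0] by (simp add: not_le)

lemma FP_le [FP_intros]: "FP m \<Longrightarrow> FP n \<Longrightarrow> FP (\<lambda>x. m x \<le> (n x :: nat))"
  using FP_not[OF FP_less, of n m] by (simp add: not_less)

lemma FP_upt [FP_intros]:
  assumes "FP m" "FP n" shows "FP (\<lambda>x. [m x..<n x])"
proof -
  have eq: "fold (\<lambda>_ s. s @ [length s]) us [0..<k] = [0..<k + length us]" for us :: "unit list" and k
    by (induction us arbitrary: k) (auto simp: upt_Suc_append[symmetric] simp del: upt_Suc)
  have "FP (\<lambda>x. fold (\<lambda>_ s. s @ [length s]) (replicate (n x) ()) [])"
  proof (rule FP_fold[where B = "\<lambda>x. csize (n x) * (csize (n x) + 1) + 1"])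
    fix x and ys zs :: "unit list" assume "replicate (n x) () = ys @ zs"
    then have le: "length ys \<le> n x" by (metis length_append length_replicate le_add1)
    have "csize [0..<length ys] \<le> length [0..<length ys] * (csize (n x) + 1) + 1"
      by (rule csize_list_le) (use le in auto)
    also have "\<dots> \<le> csize (n x) * (csize (n x) + 1) + 1"
      using le by (intro add_mono mult_mono) auto
    finally show "csize (fold (\<lambda>_ s. s @ [length s]) ys []) \<le> csize (n x) * (csize (n x) + 1) + 1"
      using eq[of ys 0] by simp
  qed (intro FP_intros FP_csize poly_bounded_intros assms)+
  moreover have "fold (\<lambda>_ s. s @ [length s]) us [] = [0..<length us]" for us :: "unit list"
    using eq[of us 0] by simp
  ultimately have "FP (\<lambda>x. [0..<n x])" by (simp only: length_replicate)
  then have "FP (\<lambda>x. drop (m x) [0..<n x])"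
    by (intro FP_intros assms)
  then show ?thesis by simp
qed

lemma FP_poly [FP_intros]:
  fixes p :: "nat poly"
  assumes "FP n" shows "FP (\<lambda>x. poly p (n x))"
  by (induction p) (auto intro!: FP_intros assms)

text \<open>Distinctness is restated by counting occurrences, which needs only filters and a
  quantifier over a list.\<close>

lemma FP_distinct [FP_intros]:
  assumes "FP l" shows "FP (\<lambda>x. distinct (l x))"
proof -
  have eq: "distinct ys \<longleftrightarrow> (\<forall>y \<in> set ys. length (filter (\<lambda>z. z = y) ys) = 1)" for ys :: "'b list"
  proof (induction ys)
    case (Cons a ys)
    have "(\<forall>y \<in> set (a # ys). length (filter (\<lambda>z. z = y) (a # ys)) = 1)
      \<longleftrightarrow> filter (\<lambda>z. z = a) ys = [] \<and> (\<forall>y \<in> set ys. y \<noteq> a \<longrightarrow> length (filter (\<lambda>z. z = y) ys) = 1)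
        \<and> (\<forall>y \<in> set ys. y = a \<longrightarrow> filter (\<lambda>z. z = y) ys = [])"
      by auto
    also have "\<dots> \<longleftrightarrow> a \<notin> set ys \<and> distinct ys"
      unfolding Cons filter_empty_conv by auto
    finally show ?case by simp
  qed simp
  have "FP (\<lambda>z. l (fst z))" by (intro FP_comp[OF assms] FP_intros)
  then show ?thesis unfolding eq by (intro FP_intros assms FP_comp[OF assms])
qed

lemma FP_zip [FP_intros]:
  assumes "FP a" "FP b" shows "FP (\<lambda>x. zip (a x) (b x))"
proof -
  have eq: "zip xs ys = map (\<lambda>i. (hd (drop i xs), hd (drop i ys))) [0..<length (take (length xs) ys)]"
    for xs :: "'b list" and ys :: "'c list"
    by (rule nth_equalityI) (auto simp: hd_drop_conv_nth)
  have "FP (\<lambda>z. a (fst z))" "FP (\<lambda>z. b (fst z))"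
    by (intro FP_comp[OF assms(1)] FP_comp[OF assms(2)] FP_intros)+
  then show ?thesis unfolding eq by (intro FP_intros assms)
qed

lemma FP_funpow:
  fixes f :: "'a :: data \<Rightarrow> 'b :: data \<Rightarrow> 'b"
  assumes "FP n" "FP i" "FP (\<lambda>z. f (fst z) (snd z))" "poly_bounded B"
    and B: "\<And>x j. j \<le> n x \<Longrightarrow> csize ((f x ^^ j) (i x)) \<le> B x"
  shows "FP (\<lambda>x. (f x ^^ n x) (i x))"
proof -
  have eq: "fold (\<lambda>_. f x) us s = (f x ^^ length us) s" for us :: "unit list" and x s
    by (induction us arbitrary: s) (auto simp: funpow_swap1)
  have f: "FP (\<lambda>z. f (fst z) (snd (snd z)))"
    by (intro FP_comp2[OF assms(3)] FP_intros)
  have "FP (\<lambda>x. fold (\<lambda>_. f x) (replicate (n x) ()) (i x))"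
  proof (rule FP_fold[where B = B])
    fix x and ys zs :: "unit list" assume "replicate (n x) () = ys @ zs"
    then have le: "length ys \<le> n x" by (metis length_append length_replicate le_add1)
    then show "csize (fold (\<lambda>_. f x) ys (i x)) \<le> B x" unfolding eq by (rule B)
  qed (intro FP_intros assms f)+
  then show ?thesis by (simp only: eq length_replicate)
qed


section \<open>Parsing\<close>

lemma FP_enc_list [FP_intros]:
  assumes "FP (\<lambda>z. e (fst z) (snd z))" "FP l"
  shows "FP (\<lambda>x. enc_list (e x) (l x))"
  unfolding enc_list_def by (intro FP_intros assms)

lemma FP_enc_word [FP_intros]: "FP f \<Longrightarrow> FP (\<lambda>x. enc_word (f x))"
  unfolding enc_word_def by (intro FP_intros)

lemma FP_enc_vote [FP_intros]: "FP f \<Longrightarrow> FP (\<lambda>x. enc_vote (f x))"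
  unfolding enc_vote_def by (intro FP_intros)

lemma FP_enc_election [FP_intros]: "FP f \<Longrightarrow> FP g \<Longrightarrow> FP (\<lambda>x. enc_election (f x) (g x))"
  unfolding enc_election_def by (intro FP_intros)

lemma length_enc_list: "length xs < length (enc_list e xs)"
proof -
  have "length xs \<le> length (concat (map (\<lambda>x. True # e x) xs))" by (induction xs) auto
  then show ?thesis by (simp add: enc_list_def)
qed

definition dec_step :: "(bool list \<Rightarrow> 'a \<times> bool list) \<Rightarrow> 'a list \<times> bool list \<Rightarrow> 'a list \<times> bool list" where
  "dec_step d s = (case snd s of [] \<Rightarrow> s | b # v \<Rightarrow> if b then (fst s @ [fst (d v)], snd (d v)) else s)"

text \<open>\<open>length w\<close> rounds suffice because every element takes at least its marker
  bit; at the end marker the steps idle, and \<open>tl\<close> finally removes it.\<close>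

definition dec_list :: "(bool list \<Rightarrow> 'a \<times> bool list) \<Rightarrow> bool list \<Rightarrow> 'a list \<times> bool list" where
  "dec_list d w = (case (dec_step d ^^ length w) ([], w) of (acc, v) \<Rightarrow> (acc, tl v))"

lemma dec_list_enc_list:
  assumes "\<And>a r. a \<in> set xs \<Longrightarrow> d (e a @ r) = (a, r)"
  shows "dec_list d (enc_list e xs @ r) = (xs, r)"
proof -
  have 1: "(dec_step d ^^ length xs) (acc, enc_list e xs @ r) = (acc @ xs, False # r)" for acc
    using assms
  proof (induction xs arbitrary: acc)
    case (Cons a xs)
    then have "dec_step d (acc, enc_list e (a # xs) @ r) = (acc @ [a], enc_list e xs @ r)"
      by (simp add: dec_step_def enc_list_def)
    with Cons.IH[of "acc @ [a]"] Cons.prems show ?case by (simp add: funpow_swap1)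
  qed (simp add: enc_list_def)
  have 2: "(dec_step d ^^ k) (xs, False # r) = (xs, False # r)" for k
    by (induction k) (auto simp: dec_step_def)
  have "length (enc_list e xs @ r) = (length (enc_list e xs @ r) - length xs) + length xs"
    using length_enc_list[of xs e] by simp
  then have "(dec_step d ^^ length (enc_list e xs @ r)) ([], enc_list e xs @ r) = (xs, False # r)"
    using 1[of "[]"] 2 by (metis append_Nil comp_apply funpow_add)
  then show ?thesis by (simp add: dec_list_def)
qed

text \<open>On words that are not codes a parser returns junk, whose size is nevertheless linear in the
  number of consumed bits.\<close>

definition linear_parser :: "nat \<Rightarrow> (bool list \<Rightarrow> 'a :: data \<times> bool list) \<Rightarrow> bool" where
  "linear_parser K d \<longleftrightarrow>
     (\<forall>w. csize (fst (d w)) + K * length (snd (d w)) \<le> K * length w + K \<and> length (snd (d w)) \<le> length w)"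

text \<open>An amortised count: the marker bit in front of an element pays for the additive constant
  \<open>K\<close> of the inner parser and for the list cell. This costs one unit more per bit,
  whence \<open>Suc K\<close>.\<close>

lemma dec_steps_bound:
  assumes "linear_parser K d"
  shows "csize (fst ((dec_step d ^^ j) ([], w))) + Suc K * length (snd ((dec_step d ^^ j) ([], w)))
           \<le> Suc K * length w + 1
         \<and> length (snd ((dec_step d ^^ j) ([], w))) \<le> length w"
proof (induction j)
  case (Suc j)
  obtain acc v where s: "(dec_step d ^^ j) ([], w) = (acc, v)" by fastforce
  show ?case
  proof (cases "v \<noteq> [] \<and> hd v")
    case True
    then obtain u where v: "v = True # u" by (cases v) auto
    obtain a v' where a: "d u = (a, v')" by fastforce
    have d: "csize a + K * length v' \<le> K * length u + K" "length v' \<le> length u"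
      using assms a unfolding linear_parser_def by (metis fst_conv snd_conv)+
    then obtain m where m: "length u = length v' + m" using le_Suc_ex by blast
    have "csize a \<le> K * m + K" using d(1) by (simp add: m algebra_simps)
    moreover have "csize (acc @ [a]) = csize acc + csize a + 1"
      using csize_append[of acc "[a]"] by simp
    moreover have "dec_step d (acc, v) = (acc @ [a], v')" by (simp add: dec_step_def v a)
    ultimately show ?thesis using Suc s v m by (simp add: algebra_simps)
  next
    case False
    then have "dec_step d (acc, v) = (acc, v)" by (cases v) (auto simp: dec_step_def)
    then show ?thesis using Suc s by simp
  qed
qed simp

lemma linear_dec_list:
  assumes "linear_parser K d"
  shows "linear_parser (Suc K) (dec_list d)"
  unfolding linear_parser_def
proof
  fix w
  obtain acc v where s: "(dec_step d ^^ length w) ([], w) = (acc, v)" by fastforce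
  have "csize acc + Suc K * length v \<le> Suc K * length w + 1" "length v \<le> length w"
    using dec_steps_bound[OF assms, of "length w" w] s by auto
  moreover have "Suc K * length (tl v) \<le> Suc K * length v" by (intro mult_le_mono2) simp
  ultimately show "csize (fst (dec_list d w)) + Suc K * length (snd (dec_list d w)) \<le> Suc K * length w + Suc K
      \<and> length (snd (dec_list d w)) \<le> length w"
    using s by (auto simp: dec_list_def)
qed

lemma FP_dec_list:
  assumes d: "FP d" "linear_parser K d"
  shows "FP (dec_list d)"
proof -
  let ?B = "\<lambda>w :: bool list. Suc K * csize w + 1 + (4 * csize w + 1) + 1"
  have "FP (\<lambda>w. (dec_step d ^^ length w) ([], w))"
  proof (rule FP_funpow[where B = ?B])
    fix w j
    obtain acc v where s: "(dec_step d ^^ j) ([], w) = (acc, v)" by fastforce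
    have "csize acc + Suc K * length v \<le> Suc K * length w + 1" "length v \<le> length w"
      using dec_steps_bound[OF d(2), of j w] s by auto
    moreover have "Suc K * length w \<le> Suc K * csize w" by (intro mult_le_mono2) (simp add: length_le_csize less_imp_le)
    ultimately show "csize ((dec_step d ^^ j) ([], w)) \<le> ?B w"
      using s csize_word[of v] length_le_csize[of w] by simp
  next
    note d' = FP_comp[OF d(1)]
    show "FP (\<lambda>z. dec_step d (snd z))"
      unfolding dec_step_def by (intro FP_intros d')
  qed (intro FP_intros poly_bounded_intros)+
  then show ?thesis
    unfolding dec_list_def by (intro FP_intros)
qed

definition dec_bit :: "bool list \<Rightarrow> bool \<times> bool list" where
  "dec_bit w = (hd w, tl w)"

definition dec_word :: "bool list \<Rightarrow> bool list \<times> bool list" where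
  "dec_word = dec_list dec_bit"

definition dec_vote :: "bool list \<Rightarrow> name list \<times> bool list" where
  "dec_vote = dec_list dec_word"

definition dec_votes :: "bool list \<Rightarrow> name list list \<times> bool list" where
  "dec_votes = dec_list dec_vote"

lemma dec_word_enc [simp]: "dec_word (enc_word w @ r) = (w, r)"
  unfolding dec_word_def enc_word_def by (rule dec_list_enc_list) (simp add: dec_bit_def)

lemma dec_vote_enc [simp]: "dec_vote (enc_list enc_word v @ r) = (v, r)" "dec_vote (enc_vote v @ r) = (v, r)"
  unfolding dec_vote_def enc_vote_def by (rule dec_list_enc_list; simp)+

lemma dec_votes_enc [simp]: "dec_votes (enc_list enc_vote V @ r) = (V, r)"
  unfolding dec_votes_def by (rule dec_list_enc_list) simp

text \<open>Three is the largest size of a bit. The additive constant of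
  \<open>linear_parser\<close> covers the empty word, where a bit is returned although nothing is
  consumed.\<close>

lemma linear_dec_bit: "linear_parser 3 dec_bit"
  unfolding linear_parser_def dec_bit_def
proof
  fix w :: "bool list"
  show "csize (fst (hd w, tl w)) + 3 * length (snd (hd w, tl w)) \<le> 3 * length w + 3
      \<and> length (snd (hd w, tl w)) \<le> length w"
    using csize_bool[of "hd w"] by simp
qed

lemma linear_dec_word: "linear_parser (Suc 3) dec_word"
  unfolding dec_word_def by (rule linear_dec_list[OF linear_dec_bit])

lemma linear_dec_vote: "linear_parser (Suc (Suc 3)) dec_vote"
  unfolding dec_vote_def by (rule linear_dec_list[OF linear_dec_word])

lemma FP_dec_word_raw: "FP dec_word"
  unfolding dec_word_def
  by (rule FP_dec_list[OF _ linear_dec_bit]) (unfold dec_bit_def, intro FP_intros)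

lemma FP_dec_vote_raw: "FP dec_vote"
  unfolding dec_vote_def
  by (rule FP_dec_list[OF FP_dec_word_raw linear_dec_word])

lemma FP_dec_votes_raw: "FP dec_votes"
  unfolding dec_votes_def
  by (rule FP_dec_list[OF FP_dec_vote_raw linear_dec_vote])

lemmas FP_dec = FP_comp[OF FP_dec_word_raw] FP_comp[OF FP_dec_vote_raw] FP_comp[OF FP_dec_votes_raw]


subsection \<open>Binary numbers\<close>

text \<open>Binary numbers are obtained by counting up from zero, which is affordable because the
  argument is unary; only the increment has to be computed.\<close>

fun add_carry :: "bool \<Rightarrow> bool list \<Rightarrow> bool list" where
  "add_carry c [] = (if c then [True] else [])"
| "add_carry c (b # w) = (b \<noteq> c) # add_carry (b \<and> c) w"

lemma add_carry_False [simp]: "add_carry False w = w"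
  by (induction w) auto

lemma binary_Suc: "binary (Suc n) = add_carry True (binary n)"
proof (induction n rule: less_induct)
  case (less n)
  show ?case
  proof (cases "n = 0")
    case True
    then show ?thesis by (simp add: binary.simps)
  next
    case n: False
    show ?thesis
    proof (cases "even n")
      case True
      then have "Suc n div 2 = n div 2" by auto
      then show ?thesis using True n by (simp add: binary.simps[of "Suc n"] binary.simps[of n])
    next
      case False
      then have "Suc n div 2 = Suc (n div 2)" by (auto elim: oddE)
      moreover have "binary (Suc (n div 2)) = add_carry True (binary (n div 2))"
        using n by (intro less) simp
      ultimately show ?thesis using False n by (simp add: binary.simps[of "Suc n"] binary.simps[of n])
    qed
  qed
qed

text \<open>The ripple of the carry becomes a fold that collects the output bits in reverse, a form
  to which \<open>FP_fold\<close> applies.\<close>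

lemma add_carry_fold:
  "rev (snd (fold (\<lambda>b s. (b \<and> fst s, (b \<noteq> fst s) # snd s)) w (c, acc)))
     @ (if fst (fold (\<lambda>b s. (b \<and> fst s, (b \<noteq> fst s) # snd s)) w (c, acc)) then [True] else [])
   = rev acc @ add_carry c w"
  by (induction w arbitrary: c acc) auto

lemma length_binary: "length (binary n) \<le> n"
proof (induction n rule: less_induct)
  case (less n)
  show ?case
  proof (cases "n = 0")
    case False
    then have "length (binary (n div 2)) \<le> n div 2" by (intro less) simp
    then show ?thesis using False by (simp add: binary.simps[of n])
  qed (simp add: binary.simps)
qed

lemma FP_add_carry: "FP f \<Longrightarrow> FP (\<lambda>x. add_carry True (f x))"
proof (rule FP_comp[of "\<lambda>w. add_carry True w"])
  let ?f = "\<lambda>b s. (b \<and> fst s, (b \<noteq> fst s) # snd s)"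
  have len: "length (snd (fold ?f w s)) = length w + length (snd s)" for w s
    by (induction w arbitrary: s) auto
  have "FP (\<lambda>w. fold ?f w (True, []))"
  proof (rule FP_fold[where B = "\<lambda>w. 3 + (4 * csize w + 1) + 1"])
    fix x ys zs :: "bool list" assume "x = ys @ zs"
    obtain c acc where s: "fold ?f ys (True, []) = (c, acc)" by fastforce
    have "length acc = length ys" using len[of ys "(True, [])"] s by simp
    then show "csize (fold ?f ys (True, [])) \<le> 3 + (4 * csize x + 1) + 1"
      using s csize_bool[of c] csize_word[of acc] length_le_csize[of x] \<open>x = ys @ zs\<close> by simp
  qed (intro FP_intros poly_bounded_intros)+
  then have "FP (\<lambda>w. rev (snd (fold ?f w (True, []))) @ (if fst (fold ?f w (True, [])) then [True] else []))"
    by (intro FP_intros)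
  then show "FP (\<lambda>w. add_carry True w)" by (simp only: add_carry_fold rev.simps append_Nil)
qed

lemma FP_binary [FP_intros]:
  assumes "FP n" shows "FP (\<lambda>x. binary (n x))"
proof (rule FP_comp[OF _ assms])
  have eq: "(add_carry True ^^ n) [] = binary n" for n
    by (induction n) (auto simp: binary_Suc binary.simps[of 0])
  have "FP (\<lambda>n. (add_carry True ^^ n) [])"
  proof (rule FP_funpow[where B = "\<lambda>n. 4 * csize n + 1"])
    fix n j :: nat assume "j \<le> n"
    then show "csize ((add_carry True ^^ j) []) \<le> 4 * csize n + 1"
      using csize_word[of "binary j"] length_binary[of j] by (simp add: eq)
  qed (intro FP_intros FP_add_carry poly_bounded_intros)+
  then show "FP binary" by (simp add: eq)
qed


section \<open>Exact control by adding voters is in NP\<close>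

definition score3 :: "name vote list \<Rightarrow> name \<Rightarrow> nat" where
  "score3 V c = length (filter (\<lambda>v. c \<in> set (take 3 v)) V)"

lemma approval_score_mset: "approval_score 3 (mset V) c = score3 V c"
  by (simp add: approval_score_def score3_def flip: mset_filter)

lemma FP_score3 [FP_intros]:
  assumes "FP V" "FP c" shows "FP (\<lambda>x. score3 (V x) (c x))"
  unfolding score3_def
  by (rule FP_comp2[where g = "\<lambda>V c. length (filter (\<lambda>v. c \<in> set (take 3 v)) V)", OF _ assms])
    (intro FP_intros)

definition wins3 :: "name list \<Rightarrow> name vote list \<Rightarrow> name \<Rightarrow> bool" where
  "wins3 C V p \<longleftrightarrow> (\<forall>d \<in> set C. score3 V d \<le> score3 V p)"

lemma wins3_iff: "p \<in> set C \<Longrightarrow> p \<in> approval_winners 3 (set C) (mset V) \<longleftrightarrow> wins3 C V p"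
  by (simp add: approval_winners_def wins3_def approval_score_mset)

lemma FP_wins3 [FP_intros]:
  assumes "FP C" "FP V" "FP p" shows "FP (\<lambda>x. wins3 (C x) (V x) (p x))"
  unfolding wins3_def
  by (rule FP_comp3[where g = "\<lambda>C V p. \<forall>d \<in> set C. score3 V d \<le> score3 V p", OF _ assms])
    (intro FP_intros)

definition valid_votes :: "name list \<Rightarrow> name vote list \<Rightarrow> bool" where
  "valid_votes C V \<longleftrightarrow>
     (\<forall>v \<in> set V. distinct v \<and> (\<forall>a \<in> set v. a \<in> set C) \<and> (\<forall>a \<in> set C. a \<in> set v))"

lemma valid_votes_iff: "valid_votes C V \<longleftrightarrow> set V \<subseteq> permutations_of_set (set C)"
  by (auto simp: valid_votes_def permutations_of_set_def)

lemma FP_valid_votes [FP_intros]: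
  assumes "FP C" "FP V" shows "FP (\<lambda>x. valid_votes (C x) (V x))"
  unfolding valid_votes_def
  by (rule FP_comp2[where g = "\<lambda>C V. \<forall>v \<in> set V. distinct v \<and> (\<forall>a \<in> set v. a \<in> set C) \<and> (\<forall>a \<in> set C. a \<in> set v)",
      OF _ assms])
    (intro FP_intros)

text \<open>The certificate is a bit mask over the listed unregistered voters. A mask of wrong
  length is harmless, as \<open>zip\<close> truncates.\<close>

definition select :: "bool list \<Rightarrow> 'a list \<Rightarrow> 'a list" where
  "select y U = map snd (filter fst (zip y U))"

lemma select_subset: "mset (select y U) \<subseteq># mset U"
proof -
  have "mset (map snd (filter fst (zip y U))) \<subseteq># mset (map snd (zip y U))"
    using image_mset_subseteq_mono[OF multiset_filter_subset[of fst "mset (zip y U)"], of snd] by simp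
  also have "mset (map snd (zip y U)) \<subseteq># mset U"
    by (simp add: map_snd_zip_take) (metis append_take_drop_id mset_append mset_subset_eq_add_left)
  finally show ?thesis by (simp add: select_def)
qed

lemma select_exists: "U' \<subseteq># mset U \<Longrightarrow> \<exists>y. length y = length U \<and> mset (select y U) = U'"
proof (induction U arbitrary: U')
  case (Cons u U)
  show ?case
  proof (cases "u \<in># U'")
    case True
    then have "U' - {#u#} \<subseteq># mset U" using Cons.prems
      by (metis add_mset_remove_trivial_If insert_DiffM mset.simps(2) mset_subset_eq_add_mset_cancel)
    from Cons.IH[OF this] obtain y where "length y = length U" "mset (select y U) = U' - {#u#}" by blast
    then show ?thesis using True
      by (intro exI[of _ "True # y"]) (auto simp: select_def)
  next
    case False
    then have "U' \<subseteq># mset U" using Cons.prems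
      by (metis diff_single_trivial mset.simps(2) subset_eq_diff_conv add_mset_add_single)
    from Cons.IH[OF this] obtain y where "length y = length U" "mset (select y U) = U'" by blast
    then show ?thesis
      by (intro exI[of _ "False # y"]) (auto simp: select_def)
  qed
qed (auto simp: select_def)

text \<open>Parsers return junk on words that encode nothing; comparing \<open>x\<close> with the
  re-encoded components rejects these words. The number \<open>k\<close> stays a word, since its
  value may be exponential in the input.\<close>

definition check_adding :: "bool list \<Rightarrow> bool list \<Rightarrow> bool" where
  "check_adding x y \<longleftrightarrow>
     (case dec_vote x of (C, x1) \<Rightarrow>
      case dec_votes x1 of (V, x2) \<Rightarrow>
      case dec_votes x2 of (U, x3) \<Rightarrow>
      case dec_word x3 of (k, x4) \<Rightarrow>
      case dec_word x4 of (p, x5) \<Rightarrow>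
        x = enc_election C V @ enc_list enc_vote U @ enc_word k @ enc_word p \<and>
        distinct C \<and> valid_votes C V \<and> valid_votes C U \<and> p \<in> set C \<and>
        k = binary (length (select y U)) \<and> wins3 C (V @ select y U) p)"

lemma FP_check_adding: "FP (\<lambda>z. check_adding (fst z) (snd z))"
  unfolding check_adding_def select_def
  by (intro FP_intros FP_dec)

lemma check_adding_enc:
  "check_adding (enc_election C V @ enc_list enc_vote U @ enc_word k @ enc_word p) y \<longleftrightarrow>
     distinct C \<and> valid_votes C V \<and> valid_votes C U \<and> p \<in> set C \<and>
     k = binary (length (select y U)) \<and> wins3 C (V @ select y U) p"
proof -
  have "dec_word (enc_word p) = (p, [])" using dec_word_enc[of p "[]"] by simp
  then show ?thesis by (simp add: check_adding_def enc_election_def)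
qed

lemma exact_control_iff_check:
  "x \<in> exact_control_by_adding_voters (approval_winners 3) \<longleftrightarrow>
     (\<exists>y. length y \<le> length x \<and> check_adding x y)"
proof
  assume "x \<in> exact_control_by_adding_voters (approval_winners 3)"
  then obtain C V U k p where x: "x = enc_election C V @ enc_list enc_vote U @ enc_word (binary k) @ enc_word p"
    and valid: "distinct C" "set V \<subseteq> permutations_of_set (set C)" "set U \<subseteq> permutations_of_set (set C)" "p \<in> set C"
    and win: "can_win_by_adding_exactly (approval_winners 3) (set C) (mset V) (mset U) k p"
    unfolding exact_control_by_adding_voters_def by blast
  from win obtain U' where U': "U' \<subseteq># mset U" "size U' = k" "p \<in> approval_winners 3 (set C) (mset V + U')"
    unfolding can_win_by_adding_exactly_def by blast
  from select_exists[OF U'(1)] obtain y where y: "length y = length U" "mset (select y U) = U'" by blast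
  have "length (select y U) = k" using y(2) U'(2) by (metis size_mset)
  moreover have "wins3 C (V @ select y U) p" using U'(3) y(2) valid(4) wins3_iff[of p C "V @ select y U"] by simp
  ultimately have "check_adding x y"
    using valid by (simp add: x check_adding_enc valid_votes_iff)
  moreover have "length y \<le> length x"
    using y(1) length_enc_list[of U enc_vote] by (simp add: x)
  ultimately show "\<exists>y. length y \<le> length x \<and> check_adding x y" by blast
next
  assume "\<exists>y. length y \<le> length x \<and> check_adding x y"
  then obtain y where y: "check_adding x y" by blast
  then obtain C V U k p where x: "x = enc_election C V @ enc_list enc_vote U @ enc_word k @ enc_word p"
    unfolding check_adding_def by (auto split: prod.splits)
  with y have c: "distinct C" "valid_votes C V" "valid_votes C U" "p \<in> set C"
    "k = binary (length (select y U))" "wins3 C (V @ select y U) p"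
    by (simp_all add: check_adding_enc)
  have "can_win_by_adding_exactly (approval_winners 3) (set C) (mset V) (mset U) (length (select y U)) p"
    unfolding can_win_by_adding_exactly_def
    using select_subset[of y U] c(4,6) wins3_iff[of p C "V @ select y U"]
    by (intro exI[of _ "mset (select y U)"]) simp
  then show "x \<in> exact_control_by_adding_voters (approval_winners 3)"
    unfolding exact_control_by_adding_voters_def x c(5) mem_Collect_eq
    using c(1-4) unfolding valid_votes_iff by blast
qed

theorem exact_control_in_NP: "exact_control_by_adding_voters (approval_winners 3) \<in> class_NP"
proof -
  let ?R = "{z. check_adding (fst (dec_word z)) (fst (dec_word (snd (dec_word z))))}"
  have "FP (\<lambda>z. check_adding (fst (dec_word z)) (fst (dec_word (snd (dec_word z)))))"
    by (intro FP_comp2[OF FP_check_adding] FP_intros FP_dec)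
  then have "?R \<in> class_P" by (intro FP_in_class_P) simp
  moreover have "\<forall>x. x \<in> exact_control_by_adding_voters (approval_winners 3) \<longleftrightarrow>
      (\<exists>y. length y \<le> poly [:0, 1:] (length x) \<and> enc_word x @ enc_word y \<in> ?R)"
  proof
    fix x
    have "dec_word (enc_word y) = (y, [])" for y using dec_word_enc[of y "[]"] by simp
    then show "x \<in> exact_control_by_adding_voters (approval_winners 3) \<longleftrightarrow>
      (\<exists>y. length y \<le> poly [:0, 1:] (length x) \<and> enc_word x @ enc_word y \<in> ?R)"
      by (simp add: exact_control_iff_check)
  qed
  ultimately show ?thesis unfolding class_NP_def by blast
qed


section \<open>Perfect matchings in general graphs\<close>

definition graph :: "'v set \<Rightarrow> ('v \<times> 'v) set \<Rightarrow> bool" where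
  "graph V E \<longleftrightarrow> finite V \<and> E \<subseteq> V \<times> V \<and> Relation.sym E \<and> irrefl E"

definition pmatch :: "'v set \<Rightarrow> ('v \<times> 'v) set \<Rightarrow> ('v \<times> 'v) set \<Rightarrow> bool" where
  "pmatch V E M \<longleftrightarrow> M \<subseteq> E \<and> M \<subseteq> V \<times> V \<and> Relation.sym M \<and> (\<forall>x \<in> V. \<exists>!y. (x, y) \<in> M)"

definition matchable :: "'v set \<Rightarrow> ('v \<times> 'v) set \<Rightarrow> bool" where
  "matchable V E \<longleftrightarrow> (\<exists>M. pmatch V E M)"

lemma graphD:
  assumes "graph V E"
  shows "finite V" "E \<subseteq> V \<times> V" "(x, y) \<in> E \<Longrightarrow> (y, x) \<in> E" "(x, x) \<notin> E"
    "(x, y) \<in> E \<Longrightarrow> x \<in> V" "(x, y) \<in> E \<Longrightarrow> y \<in> V"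
  using assms by (auto simp: graph_def irrefl_def dest: symD)

lemma pmatchD:
  assumes "pmatch V E M"
  shows "(x, y) \<in> M \<Longrightarrow> (y, x) \<in> M" "(x, y) \<in> M \<Longrightarrow> (x, y) \<in> E"
    "(x, y) \<in> M \<Longrightarrow> x \<in> V" "(x, y) \<in> M \<Longrightarrow> y \<in> V"
  using assms by (auto simp: pmatch_def dest: symD)

lemma pmatch_unique: "pmatch V E M \<Longrightarrow> (x, y) \<in> M \<Longrightarrow> (x, z) \<in> M \<Longrightarrow> y = z"
  unfolding pmatch_def by blast

lemma pmatch_partner: "pmatch V E M \<Longrightarrow> x \<in> V \<Longrightarrow> \<exists>y. (x, y) \<in> M"
  unfolding pmatch_def by blast

lemma pmatchI:
  assumes "\<And>x y. (x, y) \<in> M \<Longrightarrow> (x, y) \<in> E \<and> x \<in> V \<and> (y, x) \<in> M"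
    "\<And>x. x \<in> V \<Longrightarrow> \<exists>y. (x, y) \<in> M" "\<And>x y z. (x, y) \<in> M \<Longrightarrow> (x, z) \<in> M \<Longrightarrow> y = z"
  shows "pmatch V E M"
proof -
  have "M \<subseteq> E" "M \<subseteq> V \<times> V" using assms(1) by auto
  moreover have "Relation.sym M" using assms(1) by (auto intro: symI)
  moreover have "\<forall>x \<in> V. \<exists>!y. (x, y) \<in> M" using assms(2,3) by blast
  ultimately show ?thesis by (simp add: pmatch_def)
qed

lemma pmatch_mono: "pmatch V E M \<Longrightarrow> M \<subseteq> E' \<Longrightarrow> pmatch V E' M"
  by (auto simp: pmatch_def)

lemma matchable_mono: "matchable V E \<Longrightarrow> E \<subseteq> E' \<Longrightarrow> matchable V E'"
  unfolding matchable_def by (meson pmatch_def pmatch_mono subset_trans)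

lemma pmatch_union:
  assumes A: "pmatch A E M" and B: "pmatch B E N" and disj: "A \<inter> B = {}"
  shows "pmatch (A \<union> B) E (M \<union> N)"
proof (rule pmatchI)
  fix x y assume "(x, y) \<in> M \<union> N"
  then show "(x, y) \<in> E \<and> x \<in> A \<union> B \<and> (y, x) \<in> M \<union> N"
    using pmatchD[OF A] pmatchD[OF B] by blast
next
  fix x assume "x \<in> A \<union> B"
  then show "\<exists>y. (x, y) \<in> M \<union> N" using pmatch_partner[OF A] pmatch_partner[OF B] by blast
next
  fix x y z assume "(x, y) \<in> M \<union> N" "(x, z) \<in> M \<union> N"
  then show "y = z"
    using pmatch_unique[OF A] pmatch_unique[OF B] pmatchD(3)[OF A] pmatchD(3)[OF B] disj by blast
qed

lemma pmatch_pair: "(x, y) \<in> E \<Longrightarrow> (y, x) \<in> E \<Longrightarrow> pmatch {x, y} E {(x, y), (y, x)}"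
  by (rule pmatchI) auto

lemma pmatch_empty: "pmatch {} E {}"
  by (rule pmatchI) auto

lemma pmatch_restrict:
  assumes M: "pmatch V E M" and A: "\<And>x y. (x, y) \<in> M \<Longrightarrow> x \<in> A \<Longrightarrow> y \<in> A"
  shows "pmatch (V \<inter> A) E {e \<in> M. fst e \<in> A}" "pmatch (V - A) E {e \<in> M. fst e \<notin> A}"
proof -
  note p = pmatchD[OF M]
  have A': "(x, y) \<in> M \<Longrightarrow> y \<in> A \<Longrightarrow> x \<in> A" for x y using A p(1) by blast
  show "pmatch (V \<inter> A) E {e \<in> M. fst e \<in> A}"
  proof (rule pmatchI)
    fix x assume "x \<in> V \<inter> A"
    then show "\<exists>y. (x, y) \<in> {e \<in> M. fst e \<in> A}" using pmatch_partner[OF M] by auto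
  qed (use p A pmatch_unique[OF M] in auto)
  show "pmatch (V - A) E {e \<in> M. fst e \<notin> A}"
  proof (rule pmatchI)
    fix x assume "x \<in> V - A"
    then show "\<exists>y. (x, y) \<in> {e \<in> M. fst e \<notin> A}" using pmatch_partner[OF M] by auto
  qed (use p A' pmatch_unique[OF M] in auto)
qed

lemma pmatch_remove:
  assumes M: "pmatch V E M" and xy: "(x, y) \<in> M"
  shows "pmatch (V - {x, y}) E (M - {(x, y), (y, x)})"
proof -
  have eq: "{e \<in> M. fst e \<notin> {x, y}} = M - {(x, y), (y, x)}"
    using pmatchD(1)[OF M xy] xy pmatch_unique[OF M] by auto
  show ?thesis
    using pmatch_restrict(2)[OF M, of "{x, y}"] pmatchD(1)[OF M xy] xy pmatch_unique[OF M]
    unfolding eq by blast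
qed

lemma even_card_pmatch:
  assumes "finite V" "pmatch V E M" "irrefl E"
  shows "even (card V)"
  using assms
proof (induction "card V" arbitrary: V M rule: less_induct)
  case less
  show ?case
  proof (cases "V = {}")
    case False
    then obtain x y where xy: "(x, y) \<in> M" "x \<in> V" using pmatch_partner[OF less.prems(2)] by blast
    have y: "y \<in> V" "x \<noteq> y"
      using pmatchD(2,4)[OF less.prems(2) xy(1)] less.prems(3) by (auto simp: irrefl_def)
    have "card {x, y} = 2" "{x, y} \<subseteq> V" using xy(2) y by auto
    then have c: "card V = card (V - {x, y}) + 2"
      using card_Diff_subset[of "{x, y}" V] card_mono[of V "{x, y}"] less.prems(1) by simp
    have "even (card (V - {x, y}))"
      by (rule less.hyps[OF _ _ pmatch_remove[OF less.prems(2) xy(1)] less.prems(3)]) (use c less.prems(1) in auto)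
    then show ?thesis using c by simp
  qed simp
qed

definition odd_classes :: "'v set \<Rightarrow> 'v set \<Rightarrow> ('v \<Rightarrow> 'l) \<Rightarrow> 'l set" where
  "odd_classes V S f = {l. odd (card {v \<in> V - S. f v = l})}"

text \<open>A barrier is the certificate of Tutte's theorem. The labels name unions of components
  of the graph without \<open>S\<close>.\<close>

definition barrier :: "'v set \<Rightarrow> ('v \<times> 'v) set \<Rightarrow> 'v set \<Rightarrow> ('v \<Rightarrow> 'v) \<Rightarrow> bool" where
  "barrier V E S f \<longleftrightarrow> S \<subseteq> V \<and>
     (\<forall>x \<in> V - S. \<forall>y \<in> V - S. (x, y) \<in> E \<longrightarrow> f x = f y) \<and> card S < card (odd_classes V S f)"

lemma odd_classes_subset: "odd_classes V S f \<subseteq> f ` (V - S)"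
proof
  fix l assume "l \<in> odd_classes V S f"
  then have "{v \<in> V - S. f v = l} \<noteq> {}" unfolding odd_classes_def by (metis (mono_tags, lifting) card.empty even_zero mem_Collect_eq)
  then show "l \<in> f ` (V - S)" by auto
qed

text \<open>The easy direction of Tutte's theorem for a matching that misses \<open>X\<close>. An
  odd class cannot be matched within itself, so it contains a missed vertex or sends an edge into
  \<open>S\<close>. Besides \<open>X = {}\<close>, the case of two exposed vertices is what
  \<open>contract_barrier\<close> requires.\<close>

lemma card_odd_classes_le:
  assumes g: "graph V E" and M: "pmatch (V - X) E M" and X: "finite X" and S: "finite S"
    and f: "\<And>x y. x \<in> V - S \<Longrightarrow> y \<in> V - S \<Longrightarrow> (x, y) \<in> E \<Longrightarrow> f x = f y"
  shows "card (odd_classes V S f) \<le> card (S - X) + card (X - S)"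
proof -
  \<comment> \<open>The vertex \<open>v\<close> witnesses that class \<open>l\<close> is not matched
    internally: either a missed vertex of the class or a vertex of \<open>S\<close> matched into it.
    Either way it determines the class, which makes the choice \<open>h\<close> injective.\<close>
  define P where "P l v \<longleftrightarrow> (v \<in> X - S \<and> v \<in> V \<and> f v = l) \<or>
      (v \<in> S - X \<and> (\<exists>u \<in> V - S. f u = l \<and> (u, v) \<in> M))" for l v
  have ex: "\<exists>v. P l v" if l: "l \<in> odd_classes V S f" for l
  proof (rule ccontr)
    assume no: "\<not> (\<exists>v. P l v)"
    let ?B = "{v \<in> V - S. f v = l}"
    have sub: "?B \<subseteq> V - X" using no by (auto simp: P_def)
    have closed: "y \<in> ?B" if "(x, y) \<in> M" "x \<in> ?B" for x y
    proof -
      have y: "y \<in> V - X" "(x, y) \<in> E" using pmatchD[OF M] that by blast+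
      have "y \<notin> S" using no that y by (auto simp: P_def)
      then show ?thesis using f[of x y] that(2) y by auto
    qed
    have "pmatch ((V - X) \<inter> ?B) E {e \<in> M. fst e \<in> ?B}"
      by (rule pmatch_restrict(1)[OF M]) (rule closed)
    moreover have "(V - X) \<inter> ?B = ?B" using sub by blast
    ultimately have "pmatch ?B E {e \<in> M. fst e \<in> ?B}" by simp
    then have "even (card ?B)"
      by (rule even_card_pmatch[rotated]) (use g in \<open>auto simp: graph_def\<close>)
    then show False using l by (simp add: odd_classes_def)
  qed
  define h where "h l = (SOME v. P l v)" for l
  have h: "P l (h l)" if "l \<in> odd_classes V S f" for l
    unfolding h_def using someI_ex[OF ex[OF that]] .
  have "inj_on h (odd_classes V S f)"
  proof (rule inj_onI)
    fix l l' assume "l \<in> odd_classes V S f" "l' \<in> odd_classes V S f" "h l = h l'"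
    then have 1: "P l (h l)" "P l' (h l)" using h by metis+
    show "l = l'"
    proof (cases "h l \<in> S")
      case True
      then obtain u u' where "f u = l" "f u' = l'" "(u, h l) \<in> M" "(u', h l) \<in> M"
        using 1 unfolding P_def by blast
      then show ?thesis using pmatchD(1)[OF M] pmatch_unique[OF M] by metis
    next
      case False
      then show ?thesis using 1 unfolding P_def by auto
    qed
  qed
  moreover have "h ` odd_classes V S f \<subseteq> (S - X) \<union> (X - S)"
    using h unfolding P_def by blast
  ultimately have "card (odd_classes V S f) \<le> card ((S - X) \<union> (X - S))"
    by (intro card_inj_on_le) (use X S in auto)
  also have "\<dots> = card (S - X) + card (X - S)"
    by (rule card_Un_disjoint) (use X S in auto)
  finally show ?thesis .
qed

lemma barrier_not_matchable:
  assumes "graph V E" "barrier V E S f"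
  shows "\<not> matchable V E"
proof
  assume "matchable V E"
  then obtain M where "pmatch (V - {}) E M" by (auto simp: matchable_def)
  from card_odd_classes_le[OF assms(1) this, of S f] assms(2) show False
    using finite_subset[OF _ graphD(1)[OF assms(1)]] by (auto simp: barrier_def)
qed


subsection \<open>Contraction\<close>

text \<open>A member \<open>x\<close> of \<open>C\<close> stands for the contracted set, so the
  vertex type stays the same.\<close>

definition collapse :: "'v set \<Rightarrow> 'v \<Rightarrow> 'v \<Rightarrow> 'v" where
  "collapse C x v = (if v \<in> C then x else v)"

definition contract :: "'v set \<Rightarrow> 'v \<Rightarrow> ('v \<times> 'v) set \<Rightarrow> ('v \<times> 'v) set" where
  "contract C x E = {(collapse C x u, collapse C x v) | u v. (u, v) \<in> E \<and> collapse C x u \<noteq> collapse C x v}"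

lemma in_contract:
  "(a, b) \<in> contract C x E \<longleftrightarrow>
     (\<exists>u v. (u, v) \<in> E \<and> a = collapse C x u \<and> b = collapse C x v \<and> a \<noteq> b)"
  by (auto simp: contract_def)

lemma graph_contract:
  assumes "graph V E" "C \<subseteq> V" "x \<in> C"
  shows "graph (V - (C - {x})) (contract C x E)"
proof -
  note g = graphD[OF assms(1)]
  have "contract C x E \<subseteq> (V - (C - {x})) \<times> (V - (C - {x}))"
    using g(2) assms(2,3) by (auto simp: contract_def collapse_def)
  moreover have "Relation.sym (contract C x E)"
    by (rule symI) (use g(3) in \<open>fastforce simp: contract_def\<close>)
  moreover have "irrefl (contract C x E)" by (auto simp: contract_def irrefl_def)
  ultimately show ?thesis using g(1) by (simp add: graph_def)
qed

text \<open>The matching edge at the contracted vertex lifts to an edge that leaves \<open>C\<close>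
  at some \<open>u\<close>; by \<open>crit\<close> the rest of \<open>C\<close> can be matched
  internally.\<close>

lemma contract_matchable:
  assumes g: "graph V E" and C: "C \<subseteq> V" "x \<in> C"
    and crit: "\<And>c. c \<in> C \<Longrightarrow> matchable (C - {c}) E"
    and "matchable (V - (C - {x})) (contract C x E)"
  shows "matchable V E"
proof -
  note gd = graphD[OF g]
  let ?V = "V - (C - {x})"
  obtain N where N: "pmatch ?V (contract C x E) N" using assms(5) by (auto simp: matchable_def)
  have "x \<in> ?V" using C by auto
  then obtain y where y: "(x, y) \<in> N" using pmatch_partner[OF N] by blast
  then have "(x, y) \<in> contract C x E" "y \<in> ?V" using pmatchD[OF N] by blast+
  then obtain u v where uv: "(u, v) \<in> E" "x = collapse C x u" "y = collapse C x v" "x \<noteq> y"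
    unfolding in_contract by blast
  have "v \<notin> C" using uv by (auto simp: collapse_def)
  moreover have "u \<in> C" using uv(2) C(2) by (auto simp: collapse_def split: if_splits)
  ultimately have u: "u \<in> C" "(u, y) \<in> E" "y \<notin> C" using uv by (auto simp: collapse_def)
  obtain K where K: "pmatch (C - {u}) E K" using crit[OF u(1)] by (auto simp: matchable_def)
  have "pmatch (?V - {x, y}) (contract C x E) (N - {(x, y), (y, x)})"
    by (rule pmatch_remove[OF N y])
  moreover have "N - {(x, y), (y, x)} \<subseteq> E"
  proof
    fix e assume e: "e \<in> N - {(x, y), (y, x)}"
    obtain a b where ab: "e = (a, b)" by fastforce
    have "a \<noteq> x" "b \<noteq> x" using e ab y pmatch_unique[OF N] pmatchD(1)[OF N] by blast+
    moreover have "(a, b) \<in> contract C x E" using e ab pmatchD(2)[OF N] by blast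
    ultimately show "e \<in> E" using ab by (auto simp: contract_def collapse_def split: if_splits)
  qed
  ultimately have "pmatch (?V - {x, y}) E (N - {(x, y), (y, x)})" by (rule pmatch_mono)
  moreover have "pmatch {u, y} E {(u, y), (y, u)}" using u(2) gd(3) by (intro pmatch_pair) auto
  moreover have "(?V - {x, y}) \<inter> {u, y} = {}" using u C by auto
  ultimately have "pmatch ((?V - {x, y}) \<union> {u, y}) E ((N - {(x, y), (y, x)}) \<union> {(u, y), (y, u)})"
    by (rule pmatch_union)
  from pmatch_union[OF this K]
  have "pmatch (((?V - {x, y}) \<union> {u, y}) \<union> (C - {u})) E (((N - {(x, y), (y, x)}) \<union> {(u, y), (y, u)}) \<union> K)"
    using u C by blast
  moreover have "((?V - {x, y}) \<union> {u, y}) \<union> (C - {u}) = V"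
    using u C \<open>y \<in> ?V\<close> by blast
  ultimately show ?thesis by (auto simp: matchable_def)
qed

text \<open>The contracted vertex is not covered by the near-perfect matching \<open>M\<close>, so it cannot belong to \<open>S\<close>.\<close>

lemma contract_barrier:
  assumes g: "graph V E" and C: "C \<subseteq> V" "x \<in> C" and odd: "odd (card C)"
    and b: "b \<in> V" "b \<notin> C" and M: "pmatch (V - (C - {x}) - {x, b}) (contract C x E) M"
    and bar: "barrier (V - (C - {x})) (contract C x E) S f"
  shows "barrier V E S (\<lambda>v. f (collapse C x v))"
proof -
  let ?V = "V - (C - {x})" and ?f = "\<lambda>v. f (collapse C x v)"
  note gd = graphD[OF g]
  have S: "S \<subseteq> ?V" and f: "\<And>u v. u \<in> ?V - S \<Longrightarrow> v \<in> ?V - S \<Longrightarrow> (u, v) \<in> contract C x E \<Longrightarrow> f u = f v"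
    and card: "card S < card (odd_classes ?V S f)"
    using bar by (auto simp: barrier_def)
  have fin: "finite V" by (rule gd(1))
  have finC: "finite C" and finS: "finite S" using C(1) S fin by (auto intro: finite_subset)
  have le: "card (odd_classes ?V S f) \<le> card (S - {x, b}) + card ({x, b} - S)"
    by (rule card_odd_classes_le[OF graph_contract[OF g C] M _ finS f]) auto
  have "x \<notin> S"
  proof
    assume x: "x \<in> S"
    \<comment> \<open>Removing \<open>x\<close> from \<open>S\<close> lowers the count by one, and
      at most \<open>b\<close> is added; so \<open>le\<close> would contradict the strict inequality
      of a barrier.\<close>
    have "card (S - {x, b}) + card ({x, b} - S) \<le> card S"
    proof (cases "b \<in> S")
      case True
      then have "{x, b} - S = {}" using x by auto
      then show ?thesis using finS by (simp add: card_mono)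
    next
      case False
      then have "{x, b} - S = {b}" "S - {x, b} = S - {x}" using x by auto
      then show ?thesis using card_Suc_Diff1[OF finS x] by simp
    qed
    then show False using le card by simp
  qed
  then have SC: "S \<inter> C = {}" using S by auto
  \<comment> \<open>Undoing the contraction enlarges only the class of \<open>x\<close>, and it does
    so by the even number of vertices in \<open>C - {x}\<close>.\<close>
  have "odd (card {v \<in> V - S. ?f v = l}) \<longleftrightarrow> odd (card {v \<in> ?V - S. f v = l})" for l
  proof (cases "l = f x")
    case True
    have "{v \<in> V - S. ?f v = l} = {v \<in> ?V - S. f v = l} \<union> (C - {x})"
      using True C SC by (auto simp: collapse_def)
    then have "card {v \<in> V - S. ?f v = l} = card {v \<in> ?V - S. f v = l} + card (C - {x})"
      using fin finC by (simp add: card_Un_disjoint disjoint_iff)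
    moreover have "even (card (C - {x}))" using odd C(2) finC by (simp add: card_Diff_singleton)
    ultimately show ?thesis by simp
  next
    case False
    then have "{v \<in> V - S. ?f v = l} = {v \<in> ?V - S. f v = l}"
      by (auto simp: collapse_def)
    then show ?thesis by simp
  qed
  then have "odd_classes V S ?f = odd_classes ?V S f" by (simp add: odd_classes_def)
  moreover have "?f u = ?f v" if "u \<in> V - S" "v \<in> V - S" "(u, v) \<in> E" for u v
  proof (cases "collapse C x u = collapse C x v")
    case False
    have "collapse C x u \<in> ?V - S" "collapse C x v \<in> ?V - S"
      using that(1,2) \<open>x \<notin> S\<close> C by (auto simp: collapse_def)
    moreover have "(collapse C x u, collapse C x v) \<in> contract C x E"
      using False that(3) by (auto simp: contract_def)
    ultimately show ?thesis by (rule f)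
  qed simp
  ultimately show ?thesis
    unfolding barrier_def using S card by auto
qed


subsection \<open>Alternating trees\<close>

lemma path_matchable:
  assumes "Relation.sym E"
  shows "distinct zs \<Longrightarrow> even (length zs) \<Longrightarrow> successively (\<lambda>u v. (u, v) \<in> E) zs \<Longrightarrow> matchable (set zs) E"
proof (induction zs rule: induct_list012)
  case 1
  then show ?case using pmatch_empty by (auto simp: matchable_def)
next
  case (3 x y zs)
  have "successively (\<lambda>u v. (u, v) \<in> E) zs" using 3(5) by (cases zs) auto
  then obtain M where M: "pmatch (set zs) E M" using 3 by (auto simp: matchable_def)
  have "pmatch {x, y} E {(x, y), (y, x)}"
    using 3(5) assms by (intro pmatch_pair) (auto dest: symD)
  from pmatch_union[OF this M] 3(3) have "pmatch ({x, y} \<union> set zs) E ({(x, y), (y, x)} \<union> M)" by auto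
  then show ?case by (auto simp: matchable_def)
qed simp

text \<open>Deleting \<open>c\<close> opens the odd cycle into a path with an even number of
  vertices, read from the successor of \<open>c\<close> around to its predecessor.\<close>

lemma cycle_critical:
  assumes "Relation.sym E" "distinct zs" "odd (length zs)" "successively (\<lambda>u v. (u, v) \<in> E) zs"
    and "(last zs, hd zs) \<in> E" "c \<in> set zs"
  shows "matchable (set zs - {c}) E"
proof -
  obtain ys ws where zs: "zs = ys @ c # ws" using assms(6) by (meson split_list)
  have "successively (\<lambda>u v. (u, v) \<in> E) (ws @ ys)"
  proof -
    have "successively (\<lambda>u v. (u, v) \<in> E) ys" "successively (\<lambda>u v. (u, v) \<in> E) (c # ws)"
      using assms(4) unfolding zs by (simp_all add: successively_append_iff del: successively.simps)
    moreover from this(2) have "successively (\<lambda>u v. (u, v) \<in> E) ws" by (cases ws) auto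
    moreover have "(last ws, hd ys) \<in> E" if "ws \<noteq> []" "ys \<noteq> []"
      using assms(5) that unfolding zs by simp
    ultimately show ?thesis by (auto simp: successively_append_iff)
  qed
  then have "matchable (set (ws @ ys)) E"
    using assms(1-3) unfolding zs by (intro path_matchable) auto
  moreover have "set (ws @ ys) = set zs - {c}" using assms(2) by (auto simp: zs)
  ultimately show ?thesis by simp
qed

definition support :: "('v \<times> 'v) set \<Rightarrow> ('v \<times> 'v) set \<Rightarrow> 'v set" where
  "support M M' = fst ` ((M - M') \<union> (M' - M))"

text \<open>The difference of the two matchings is a single alternating path from \<open>x\<close> to \<open>x'\<close>.\<close>

definition linked :: "('v \<times> 'v) set \<Rightarrow> 'v set \<Rightarrow> 'v \<times> ('v \<times> 'v) set \<Rightarrow> 'v \<times> ('v \<times> 'v) set \<Rightarrow> bool" where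
  "linked E R = (\<lambda>(x, M) (x', M'). \<exists>zs. zs \<noteq> [] \<and> hd zs = x \<and> last zs = x' \<and> distinct zs \<and> odd (length zs) \<and>
     successively (\<lambda>u v. (u, v) \<in> E) zs \<and> set zs \<subseteq> R \<and> set zs = insert x (support M M'))"

text \<open>An alternating tree consists of the even vertices, each with a matching that covers all vertices
  but this one and \<open>b\<close>, and of the odd vertices \<open>S\<close>.\<close>

definition tree_inv :: "'v set \<Rightarrow> ('v \<times> 'v) set \<Rightarrow> 'v \<Rightarrow> ('v \<times> ('v \<times> 'v) set) set \<Rightarrow> 'v set \<Rightarrow> bool" where
  "tree_inv V E b T S \<longleftrightarrow>
     T \<noteq> {} \<and> finite T \<and> inj_on fst T \<and> card S < card T \<and> b \<in> V \<and> b \<notin> fst ` T \<union> S \<and> fst ` T \<union> S \<subseteq> V \<and>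
     S \<inter> fst ` T = {} \<and>
     (\<forall>x M. (x, M) \<in> T \<longrightarrow> pmatch (V - {x, b}) E M) \<and>
     (\<forall>x M u v. (x, M) \<in> T \<longrightarrow> (u, v) \<in> M \<longrightarrow> (u \<in> fst ` T \<union> S) = (v \<in> fst ` T \<union> S)) \<and>
     (\<forall>t \<in> T. \<forall>t' \<in> T. linked E (fst ` T \<union> S) t t')"

lemma tree_invD:
  assumes "tree_inv V E b T S"
  shows "T \<noteq> {}" "finite T" "inj_on fst T" "card S < card T" "b \<in> V" "b \<notin> fst ` T \<union> S"
    "fst ` T \<union> S \<subseteq> V" "S \<inter> fst ` T = {}"
    "(x, M) \<in> T \<Longrightarrow> pmatch (V - {x, b}) E M" "(x, M) \<in> T \<Longrightarrow> x \<in> V"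
    "(x, M) \<in> T \<Longrightarrow> (u, v) \<in> M \<Longrightarrow> u \<in> fst ` T \<union> S \<longleftrightarrow> v \<in> fst ` T \<union> S"
    "t \<in> T \<Longrightarrow> t' \<in> T \<Longrightarrow> linked E (fst ` T \<union> S) t t'"
proof -
  note a = assms[unfolded tree_inv_def]
  show "T \<noteq> {}" "finite T" "inj_on fst T" "card S < card T" "b \<in> V" "b \<notin> fst ` T \<union> S"
    "S \<inter> fst ` T = {}" and sub: "fst ` T \<union> S \<subseteq> V"
    using a by simp_all
  note c = a[THEN conjunct2, THEN conjunct2, THEN conjunct2, THEN conjunct2, THEN conjunct2,
      THEN conjunct2, THEN conjunct2, THEN conjunct2]
  show "(x, M) \<in> T \<Longrightarrow> pmatch (V - {x, b}) E M"
    by (rule c[THEN conjunct1, rule_format])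
  show "(x, M) \<in> T \<Longrightarrow> (u, v) \<in> M \<Longrightarrow> u \<in> fst ` T \<union> S \<longleftrightarrow> v \<in> fst ` T \<union> S"
    by (rule c[THEN conjunct2, THEN conjunct1, rule_format])
  show "t \<in> T \<Longrightarrow> t' \<in> T \<Longrightarrow> linked E (fst ` T \<union> S) t t'"
    by (rule c[THEN conjunct2, THEN conjunct2, rule_format])
  show "(x, M) \<in> T \<Longrightarrow> x \<in> V" using sub image_eqI[of x fst "(x, M)" T] by auto
qed

text \<open>The path is reversed. The two hypotheses on the end points make the vertex set look the
  same from either end, although \<open>linked\<close> inserts only the first one.\<close>

lemma linked_sym:
  assumes E: "Relation.sym E" and l: "linked E R t t'"
    and x': "fst t' \<in> insert (fst t) (support (snd t) (snd t'))" "fst t \<in> insert (fst t') (support (snd t) (snd t'))"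
  shows "linked E R t' t"
proof -
  obtain x M x' M' where t: "t = (x, M)" "t' = (x', M')" by fastforce
  from l[unfolded t] obtain zs where zs: "zs \<noteq> []" "hd zs = x" "last zs = x'" "distinct zs" "odd (length zs)"
     "successively (\<lambda>u v. (u, v) \<in> E) zs" "set zs \<subseteq> R" "set zs = insert x (support M M')"
    unfolding linked_def by auto
  have "(\<lambda>u v. (v, u) \<in> E) = (\<lambda>u v. (u, v) \<in> E)" using E by (auto simp: fun_eq_iff dest: symD)
  then have "successively (\<lambda>u v. (u, v) \<in> E) (rev zs)" using zs(6) by (simp only: successively_rev)
  moreover have "insert x (support M M') = insert x' (support M' M)"
    using x' unfolding t support_def by (auto simp: Un_commute)
  ultimately show ?thesis
    unfolding t linked_def using zs by (auto simp: hd_rev last_rev intro!: exI[of _ "rev zs"])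
qed

lemma tree_inv_start:
  assumes "x \<in> V" "b \<in> V" "x \<noteq> b" "pmatch (V - {x, b}) E M"
  shows "tree_inv V E b {(x, M)} {}"
proof -
  have "linked E {x} (x, M) (x, M)"
    unfolding linked_def support_def by (auto intro!: exI[of _ "[x]"])
  moreover have "(u, v) \<in> M \<Longrightarrow> u \<noteq> x \<and> v \<noteq> x" for u v using pmatchD(3,4)[OF assms(4)] by blast
  ultimately show ?thesis
    unfolding tree_inv_def using assms by auto
qed

lemma tree_found:
  assumes g: "graph V E" and t: "tree_inv V E b T S" and "(x, M) \<in> T" "(x, b) \<in> E"
  shows "matchable V E"
proof -
  note M = tree_invD(9)[OF t assms(3)] and tree_invD(10)[OF t assms(3)] tree_invD(5)[OF t]
  from pmatch_union[OF M pmatch_pair[OF assms(4)]] graphD(3)[OF g assms(4)]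
  have "pmatch ((V - {x, b}) \<union> {x, b}) E (M \<union> {(x, b), (b, x)})" by blast
  moreover have "(V - {x, b}) \<union> {x, b} = V" using \<open>x \<in> V\<close> \<open>b \<in> V\<close> by blast
  ultimately show ?thesis by (auto simp: matchable_def)
qed

text \<open>Each even vertex forms a class of its own, which is odd, and there are more of them than
  vertices in \<open>S\<close>. All remaining vertices share the label \<open>b\<close>, which is no
  even vertex.\<close>

lemma tree_stuck:
  assumes g: "graph V E" and t: "tree_inv V E b T S"
    and stuck: "\<And>x y. x \<in> fst ` T \<Longrightarrow> (x, y) \<in> E \<Longrightarrow> y \<in> S"
  shows "barrier V E S (\<lambda>v. if v \<in> fst ` T then v else b)"
proof -
  let ?f = "\<lambda>v. if v \<in> fst ` T then v else b"
  have inv: "inj_on fst T" "card S < card T" "b \<notin> fst ` T" "fst ` T \<subseteq> V" "S \<subseteq> V" "S \<inter> fst ` T = {}"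
    using tree_invD(3-8)[OF t] by auto
  have fin: "finite V" by (rule graphD(1)[OF g])
  have "fst ` T \<subseteq> odd_classes V S ?f"
  proof
    fix x assume x: "x \<in> fst ` T"
    then have "{v \<in> V - S. ?f v = x} = {x}" using inv by auto
    then show "x \<in> odd_classes V S ?f" by (simp add: odd_classes_def)
  qed
  moreover have "finite (odd_classes V S ?f)"
    using odd_classes_subset fin by (meson finite_Diff finite_imageI finite_subset)
  ultimately have "card (fst ` T) \<le> card (odd_classes V S ?f)" by (rule card_mono[rotated])
  then have "card S < card (odd_classes V S ?f)" using card_image[OF inv(1)] inv(2) by simp
  moreover have "?f u = ?f v" if "u \<in> V - S" "v \<in> V - S" "(u, v) \<in> E" for u v
    using stuck[of u v] stuck[of v u] that graphD(3)[OF g that(3)] by auto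
  ultimately show ?thesis using inv(5) unfolding barrier_def by blast
qed

text \<open>Exchanging the edge \<open>yz\<close> of \<open>M\<close> for \<open>xy\<close> moves
  the exposed vertex from \<open>x\<close> to \<open>z\<close>; so \<open>z\<close> becomes even,
  with matching \<open>M'\<close>, and \<open>y\<close> becomes odd.\<close>

lemma tree_extend:
  assumes g: "graph V E" and t: "tree_inv V E b T S" and xM: "(x, M) \<in> T" and xy: "(x, y) \<in> E"
    and y: "y \<noteq> b" "y \<notin> fst ` T" "y \<notin> S" and yz: "(y, z) \<in> M"
  defines "M' \<equiv> {e \<in> M. fst e \<notin> {y, z}} \<union> {(x, y), (y, x)}"
  shows "tree_inv V E b (insert (z, M') T) (insert y S)" "z \<notin> fst ` T"
proof -
  let ?R = "fst ` T \<union> S"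
  let ?R' = "fst ` insert (z, M') T \<union> insert y S"
  note gd = graphD[OF g]
  note inv = tree_invD(1-8)[OF t] and pm = tree_invD(9)[OF t] and closed = tree_invD(11)[OF t]
    and link = tree_invD(12)[OF t]
  note M = pm[OF xM] and pM = pmatchD[OF pm[OF xM]]
  have "x \<in> fst ` T" using xM by force
  then have xV: "x \<in> V" "x \<noteq> b" "x \<in> ?R" using inv(6,7) by auto
  have yR: "y \<notin> ?R" using y by auto
  have zR: "z \<notin> ?R" using closed[OF xM yz] yR by auto
  have yV: "y \<in> V" "z \<in> V" "z \<noteq> b" "z \<noteq> x" "(y, z) \<in> E" "(z, y) \<in> E" "(z, y) \<in> M" "y \<noteq> x"
    using pM(1-4)[OF yz] gd(3) by auto
  have yz_ne: "y \<noteq> z" using yV(5) gd(4) by auto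
  show "z \<notin> fst ` T" using zR by auto
  \<comment> \<open>All matchings of the tree agree outside the tree, since their differences are
    paths inside it. Hence each of them contains the edge \<open>yz\<close>.\<close>
  have fixed: "(y, z) \<in> N" "(z, y) \<in> N" if uN: "(u, N) \<in> T" for u N
  proof -
    have "support M N \<subseteq> ?R" using link[OF xM uN] unfolding linked_def by auto
    then have "(y, z) \<notin> M - N" "(z, y) \<notin> M - N" using yR zR unfolding support_def by force+
    then show "(y, z) \<in> N" "(z, y) \<in> N" using yz yV by auto
  qed
  have M'_eq: "M' = (M - {(y, z), (z, y)}) \<union> {(x, y), (y, x)}"
    unfolding M'_def using yz yV(7) pmatch_unique[OF M] by auto
  have "pmatch (V - {x, b} - {y, z}) E {e \<in> M. fst e \<notin> {y, z}}"
    by (rule pmatch_restrict(2)[OF M]) (use yz yV(7) pmatch_unique[OF M] in blast)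
  from pmatch_union[OF this pmatch_pair[OF xy gd(3)[OF xy]]]
  have "pmatch ((V - {x, b} - {y, z}) \<union> {x, y}) E M'" unfolding M'_def by blast
  moreover have "(V - {x, b} - {y, z}) \<union> {x, y} = V - {z, b}" using xV yV y(1) yz_ne by auto
  ultimately have M': "pmatch (V - {z, b}) E M'" by simp
  have R': "?R' = ?R \<union> {y, z}" by auto
  have closed': "v \<in> ?R' \<longleftrightarrow> w \<in> ?R'" if uN: "(u, N) \<in> insert (z, M') T" and vw: "(v, w) \<in> N" for u N v w
  proof (cases "(u, N) \<in> T")
    case True
    have "v = y \<longleftrightarrow> w = z" "v = z \<longleftrightarrow> w = y"
      using fixed[OF True] vw pmatch_unique[OF pm[OF True]] pmatchD(1)[OF pm[OF True]] by blast+
    then show ?thesis unfolding R' using closed[OF True vw] by auto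
  next
    case False
    then have "(v, w) \<in> M'" using uN vw by auto
    then consider "(v, w) \<in> {(x, y), (y, x)}" | "(v, w) \<in> M" "v \<notin> {y, z}"
      unfolding M'_def by auto
    then show ?thesis
    proof cases
      case 1
      then show ?thesis unfolding R' using xV by auto
    next
      case 2
      then have "w \<notin> {y, z}" using yz yV(7) pmatch_unique[OF M] pM(1) by blast
      then show ?thesis unfolding R' using closed[OF xM 2(1)] 2(2) by auto
    qed
  qed
  have E: "Relation.sym E" using g by (simp add: graph_def)
  \<comment> \<open>Against any other matching \<open>N\<close> of the tree, the exchange prolongs
    the alternating path beyond \<open>x\<close> by \<open>y\<close> and \<open>z\<close>.\<close>
  have supp: "support M' N = insert x (support M N) \<union> {y, z}" if uN: "(u, N) \<in> T" for u N
  proof -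
    have "(x, y) \<notin> N" "(y, x) \<notin> N" "(x, y) \<notin> M" "(y, x) \<notin> M"
      using fixed[OF uN] fixed[OF xM] pmatch_unique[OF pm[OF uN]] pmatchD(1)[OF pm[OF uN]]
        pmatch_unique[OF M] pM(1) yV(4) by metis+
    then have "(M' - N) \<union> (N - M') = ((M - N) \<union> (N - M)) \<union> {(x, y), (y, x), (y, z), (z, y)}"
      unfolding M'_eq using fixed[OF uN] yz yV(7) yz_ne yV(4) by auto
    then show ?thesis unfolding support_def by (simp only: image_Un) auto
  qed
  have mono: "linked E ?R' t t'" if "linked E ?R t t'" for t t'
    using that unfolding linked_def R' by (auto 4 4)
  have new_old: "linked E ?R' (z, M') t'" if t': "t' \<in> T" for t'
  proof -
    obtain u N where u: "t' = (u, N)" by fastforce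
    from link[OF xM t'] obtain zs where zs: "zs \<noteq> []" "hd zs = x" "last zs = u" "distinct zs" "odd (length zs)"
      "successively (\<lambda>u v. (u, v) \<in> E) zs" "set zs \<subseteq> ?R" "set zs = insert x (support M N)"
      unfolding linked_def u by auto
    have "successively (\<lambda>u v. (u, v) \<in> E) (z # y # zs)"
      using zs(1,2,6) yV(6) gd(3)[OF xy] by (cases zs) auto
    moreover have "distinct (z # y # zs)" using zs(4,7) yR zR yz_ne by auto
    moreover have "set (z # y # zs) = insert z (support M' N)"
      using zs(8) supp[OF t'[unfolded u]] by auto
    moreover have "set (z # y # zs) \<subseteq> ?R'" using zs(7) by auto
    ultimately show ?thesis
      unfolding linked_def u using zs(1,3,5) by (auto intro!: exI[of _ "z # y # zs"])
  qed
  have old_new: "linked E ?R' t' (z, M')" if t': "t' \<in> T" for t'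
  proof (rule linked_sym[OF E new_old[OF t']])
    obtain u N where u: "t' = (u, N)" by fastforce
    have "u \<in> insert x (support M N)"
      using link[OF xM t'] unfolding linked_def u by auto
    then show "fst t' \<in> insert (fst (z, M')) (support (snd (z, M')) (snd t'))"
      using supp[OF t'[unfolded u]] by (auto simp: u)
    show "fst (z, M') \<in> insert (fst t') (support (snd (z, M')) (snd t'))"
      using supp[OF t'[unfolded u]] by (auto simp: u)
  qed
  have new_new: "linked E ?R' (z, M') (z, M')"
    unfolding linked_def support_def by (auto intro!: exI[of _ "[z]"])
  have "finite S" using inv(7) gd(1) finite_subset by blast
  then have "card (insert y S) < card (insert (z, M') T)"
    using inv(2,4) zR yR by (subst (1 2) card_insert_disjoint) force+
  moreover have "inj_on fst (insert (z, M') T)" using inv(3) zR by (auto simp: inj_on_def)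
  moreover have "b \<notin> ?R'" "?R' \<subseteq> V" "insert y S \<inter> fst ` insert (z, M') T = {}"
    using inv yV y yR zR yz_ne by auto
  moreover have "\<forall>t \<in> insert (z, M') T. \<forall>t' \<in> insert (z, M') T. linked E ?R' t t'"
    using new_new new_old old_new mono link by blast
  moreover have "\<forall>u N. (u, N) \<in> insert (z, M') T \<longrightarrow> pmatch (V - {u, b}) E N"
    using M' pm by blast
  moreover have "\<forall>u N v w. (u, N) \<in> insert (z, M') T \<longrightarrow> (v, w) \<in> N \<longrightarrow> (v \<in> ?R') = (w \<in> ?R')"
    by (intro allI impI) (rule closed')
  moreover have "insert (z, M') T \<noteq> {}" "finite (insert (z, M') T)" using inv(2) by simp_all
  ultimately show "tree_inv V E b (insert (z, M') T) (insert y S)"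
    unfolding tree_inv_def using inv(5) by (intro conjI) assumption+
qed

text \<open>The alternating path between two adjacent even vertices closes to an odd cycle whose
  vertices are the whole support \<open>C\<close>. No edge of \<open>M\<close> leaves
  \<open>C\<close>, so outside \<open>C\<close> the matching \<open>M\<close> covers everything but
  \<open>b\<close>, and a new tree can start at the contracted vertex.\<close>

lemma tree_contract:
  assumes g: "graph V E" and t: "tree_inv V E b T S" and xM: "(x, M) \<in> T" and xM': "(x', M') \<in> T"
    and xx': "(x, x') \<in> E"
  defines "C \<equiv> support M M'"
  shows "x \<in> C" "x' \<in> C" "C \<subseteq> V" "b \<notin> C"
    "matchable (V - (C - {x})) (contract C x E) \<Longrightarrow> matchable V E"
    "barrier (V - (C - {x})) (contract C x E) S' f \<Longrightarrow> barrier V E S' (\<lambda>v. f (collapse C x v))"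
    "tree_inv (V - (C - {x})) (contract C x E) b {(x, {e \<in> M. fst e \<notin> C})} {}"
proof -
  let ?R = "fst ` T \<union> S"
  let ?V = "V - (C - {x})"
  note gd = graphD[OF g]
  note inv = tree_invD(5-7)[OF t] and M = tree_invD(9)[OF t xM] and M' = tree_invD(9)[OF t xM']
  from tree_invD(12)[OF t xM xM'] obtain zs where zs: "zs \<noteq> []" "hd zs = x" "last zs = x'" "distinct zs" "odd (length zs)"
      "successively (\<lambda>u v. (u, v) \<in> E) zs" "set zs \<subseteq> ?R" "set zs = insert x C"
    unfolding linked_def C_def by auto
  have "x \<in> fst ` T" "x' \<in> fst ` T" using xM xM' by force+
  then have x: "x \<in> V" "x \<noteq> b" "x' \<in> V" "x' \<noteq> b" "x \<noteq> x'" using inv(2,3) gd(4) xx' by auto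
  then obtain y where "(x, y) \<in> M'" using pmatch_partner[OF M', of x] by auto
  moreover have "(x, y) \<notin> M" using pmatchD(3)[OF M] by auto
  ultimately show xC: "x \<in> C" unfolding C_def support_def by force
  then have C: "C = set zs" using zs(8) by auto
  show "x' \<in> C" using zs(1,3) C by auto
  show CV: "C \<subseteq> V" "b \<notin> C" using C zs(7) inv by blast+
  have odd: "odd (card C)" using zs(4,5) by (simp add: C distinct_card)
  have E: "Relation.sym E" using g by (simp add: graph_def)
  have crit: "matchable (C - {c}) E" if "c \<in> C" for c
    unfolding C by (rule cycle_critical[OF E zs(4,5,6)]) (use zs(2,3) gd(3)[OF xx'] that C in auto)
  show "matchable V E" if "matchable ?V (contract C x E)"
    by (rule contract_matchable[OF g CV(1) xC crit that])
  \<comment> \<open>An edge common to both matchings cannot touch a vertex of \<open>C\<close>: such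
    a vertex has an edge on which the matchings differ, and partners are unique.\<close>
  have closed: "v \<in> C" if uv: "(u, v) \<in> M" "u \<in> C" for u v
  proof -
    have "(u, v) \<notin> M'"
    proof
      assume uv': "(u, v) \<in> M'"
      obtain w where "(u, w) \<in> (M - M') \<union> (M' - M)" using uv(2) unfolding C_def support_def by force
      then show False using uv(1) uv' pmatch_unique[OF M] pmatch_unique[OF M'] by blast
    qed
    then have "(v, u) \<in> M - M'" using pmatchD(1)[OF M uv(1)] pmatchD(1)[OF M'] by blast
    then show ?thesis unfolding C_def support_def by force
  qed
  have closed': "v \<notin> C" if "(u, v) \<in> M" "u \<notin> C" for u v
    using closed pmatchD(1)[OF M that(1)] that(2) by blast
  have "pmatch (V - {x, b} - C) E {e \<in> M. fst e \<notin> C}"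
    by (rule pmatch_restrict(2)[OF M]) (rule closed)
  moreover have "{e \<in> M. fst e \<notin> C} \<subseteq> contract C x E"
  proof
    fix e assume e: "e \<in> {e \<in> M. fst e \<notin> C}"
    obtain u v where uv: "e = (u, v)" by fastforce
    have "u \<notin> C" "v \<notin> C" "(u, v) \<in> E" "u \<noteq> v"
      using e uv closed' pmatchD(2)[OF M, of u v] gd(4) by auto
    then show "e \<in> contract C x E"
      unfolding in_contract collapse_def uv by auto
  qed
  ultimately have "pmatch (V - {x, b} - C) (contract C x E) {e \<in> M. fst e \<notin> C}" by (rule pmatch_mono)
  moreover have "V - {x, b} - C = ?V - {x, b}" using xC by auto
  ultimately have pm: "pmatch (?V - {x, b}) (contract C x E) {e \<in> M. fst e \<notin> C}" by simp
  show "barrier V E S' (\<lambda>v. f (collapse C x v))" if "barrier ?V (contract C x E) S' f"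
    by (rule contract_barrier[OF g CV(1) xC odd inv(1) CV(2) pm that])
  show "tree_inv ?V (contract C x E) b {(x, {e \<in> M. fst e \<notin> C})} {}"
    by (rule tree_inv_start[OF _ _ x(2) pm]) (use x inv CV in auto)
qed


subsection \<open>The algorithm\<close>

type_synonym 'v edges = "('v \<times> 'v) list"

text \<open>The first component is the verdict, empty while the search runs. Then come the edges of
  the contracted graph, the even vertices with their matchings, and the odd vertices.\<close>

type_synonym 'v search = "bool list \<times> 'v edges \<times> ('v \<times> 'v edges) list \<times> 'v list"

definition support_list :: "'v edges \<Rightarrow> 'v edges \<Rightarrow> 'v list" where
  "support_list M M' = map fst (filter (\<lambda>e. e \<notin> set M') M @ filter (\<lambda>e. e \<notin> set M) M')"

definition contract_list :: "'v list \<Rightarrow> 'v \<Rightarrow> 'v edges \<Rightarrow> 'v edges" where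
  "contract_list C x E = filter (\<lambda>e. fst e \<noteq> snd e)
     (map (\<lambda>e. (if fst e \<in> set C then x else fst e, if snd e \<in> set C then x else snd e)) E)"

definition candidates :: "'v edges \<Rightarrow> ('v \<times> 'v edges) list \<Rightarrow> 'v list \<Rightarrow> (('v \<times> 'v edges) \<times> 'v) list" where
  "candidates E T S =
     concat (map (\<lambda>t. map (\<lambda>e. (t, snd e)) (filter (\<lambda>e. fst e = fst t \<and> snd e \<notin> set S) E)) T)"

text \<open>A candidate edge leads to \<open>b\<close> (success), to a vertex outside the tree
  (extension) or to an even vertex (contraction). The verdict for a \<open>y\<close> without partner
  in \<open>M\<close> only makes the function total.\<close>

definition grow :: "'v \<Rightarrow> 'v search \<Rightarrow> 'v search" where
  "grow b s =
     (let E = fst (snd s); T = fst (snd (snd s)); S = snd (snd (snd s)) in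
      if fst s \<noteq> [] then s else
      case candidates E T S of [] \<Rightarrow> ([False], E, T, S)
      | c # cs \<Rightarrow>
        (let x = fst (fst c); M = snd (fst c); y = snd c in
         if y = b then ([True], E, T, S) else
         case filter (\<lambda>t. fst t = y) T of
           [] \<Rightarrow> (case filter (\<lambda>e. fst e = y) M of
               [] \<Rightarrow> ([False], E, T, S)
             | e # es \<Rightarrow> ([], E,
                 (snd e, (x, y) # (y, x) # filter (\<lambda>f. fst f \<noteq> y \<and> fst f \<noteq> snd e) M) # T, y # S))
         | t # ts \<Rightarrow> (let C = support_list M (snd t) in
             ([], contract_list C x E, [(x, filter (\<lambda>e. fst e \<notin> set C) M)], []))))"

definition augmentable :: "nat \<Rightarrow> 'v edges \<Rightarrow> 'v edges \<Rightarrow> 'v \<Rightarrow> 'v \<Rightarrow> bool" where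
  "augmentable n E M a b \<longleftrightarrow> fst ((grow b ^^ n) ([], E, [(a, M)], [])) = [True]"

lemma set_support_list: "set (support_list M M') = support (set M) (set M')"
  by (auto simp: support_list_def support_def image_iff)

lemma set_contract_list: "set (contract_list C x E) = contract (set C) x (set E)"
proof (rule set_eqI)
  fix e :: "'a \<times> 'a"
  obtain a b where e: "e = (a, b)" by fastforce
  have "contract_list C x E = filter (\<lambda>e. fst e \<noteq> snd e)
      (map (\<lambda>e. (collapse (set C) x (fst e), collapse (set C) x (snd e))) E)"
    by (simp add: contract_list_def collapse_def)
  then have "(a, b) \<in> set (contract_list C x E) \<longleftrightarrow>
      (\<exists>f \<in> set E. a = collapse (set C) x (fst f) \<and> b = collapse (set C) x (snd f) \<and> a \<noteq> b)"
    by auto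
  then show "e \<in> set (contract_list C x E) \<longleftrightarrow> e \<in> contract (set C) x (set E)"
    by (simp add: e in_contract Bex_def)
qed

lemma in_candidates: "((x, M), y) \<in> set (candidates E T S) \<longleftrightarrow> (x, M) \<in> set T \<and> (x, y) \<in> set E \<and> y \<notin> set S"
  by (auto simp: candidates_def image_iff)

text \<open>Verdicts refer to the original graph \<open>(V0, E0)\<close>, to which both certificates
  of the contracted graph can be transferred. The last conjunct is the time budget: an extension
  gains an even vertex, and the weight \<open>card V0 + 2\<close> lets the vertices lost by a
  contraction pay for the discarded tree.\<close>

definition search_inv :: "'v set \<Rightarrow> ('v \<times> 'v) set \<Rightarrow> 'v \<Rightarrow> nat \<Rightarrow> 'v search \<Rightarrow> bool" where
  "search_inv V0 E0 b m = (\<lambda>(r, E, T, S).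
     r = [True] \<and> matchable V0 E0 \<or>
     r = [False] \<and> (\<exists>S f. barrier V0 E0 S f) \<or>
     r = [] \<and> (\<exists>V. graph V (set E) \<and> V \<subseteq> V0 \<and> tree_inv V (set E) b (apsnd set ` set T) (set S) \<and>
       (matchable V (set E) \<longrightarrow> matchable V0 E0) \<and>
       (\<forall>S f. barrier V (set E) S f \<longrightarrow> (\<exists>S f. barrier V0 E0 S f)) \<and>
       card V * (card V0 + 2) \<le> m + card (apsnd set ` set T)))"

lemma grow_inv:
  assumes fin: "finite V0" and inv: "search_inv V0 E0 b (Suc m) s"
  shows "search_inv V0 E0 b m (grow b s)"
proof -
  obtain r E T S where s: "s = (r, E, T, S)" by (cases s) auto
  show ?thesis
  proof (cases "r = []")
    case False
    then show ?thesis using inv by (auto simp: s grow_def search_inv_def)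
  next
    case r: True
    let ?T = "apsnd set ` set T"
    from inv have "\<exists>V. graph V (set E) \<and> V \<subseteq> V0 \<and> tree_inv V (set E) b ?T (set S) \<and>
       (matchable V (set E) \<longrightarrow> matchable V0 E0) \<and>
       (\<forall>S f. barrier V (set E) S f \<longrightarrow> (\<exists>S f. barrier V0 E0 S f)) \<and>
       card V * (card V0 + 2) \<le> Suc m + card ?T"
      by (simp only: s r search_inv_def prod.case list.distinct simp_thms)
    then obtain V where g: "graph V (set E)" and V: "V \<subseteq> V0"
      and t: "tree_inv V (set E) b ?T (set S)"
      and m: "matchable V (set E) \<Longrightarrow> matchable V0 E0"
      and bar: "\<And>S f. barrier V (set E) S f \<Longrightarrow> \<exists>S f. barrier V0 E0 S f"
      and \<mu>: "card V * (card V0 + 2) \<le> Suc m + card ?T"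
      by blast
    have fstT: "fst ` ?T = fst ` set T" by force
    have finV: "finite V" using V fin finite_subset by blast
    have cardT: "card ?T \<le> card V0"
    proof -
      have "card ?T = card (fst ` ?T)" using tree_invD(3)[OF t] by (simp add: card_image)
      also have "\<dots> \<le> card V0" using tree_invD(7)[OF t] V fin by (intro card_mono) auto
      finally show ?thesis .
    qed
    show ?thesis
    proof (cases "candidates E T S")
      case Nil
      have "y \<in> set S" if x: "x \<in> fst ` ?T" and xy: "(x, y) \<in> set E" for x y
      proof (rule ccontr)
        assume "y \<notin> set S"
        moreover obtain M where "(x, M) \<in> set T" using x fstT by auto
        ultimately have "((x, M), y) \<in> set (candidates E T S)" using xy by (simp add: in_candidates)
        then show False using Nil by simp
      qed
      from bar[OF tree_stuck[OF g t this]] Nil show ?thesis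
        by (auto simp: s r grow_def search_inv_def)
    next
      case (Cons c cs)
      obtain x M y where c: "c = ((x, M), y)" by (metis prod.exhaust)
      have "c \<in> set (candidates E T S)" using Cons by simp
      then have xM: "(x, M) \<in> set T" and xy: "(x, y) \<in> set E" and yS: "y \<notin> set S"
        by (simp_all add: c in_candidates)
      have xM': "(x, set M) \<in> ?T" using xM by force
      show ?thesis
      proof (cases "y = b")
        case True
        from m[OF tree_found[OF g t xM' xy[unfolded True]]] show ?thesis
          using Cons c True by (simp add: s r grow_def search_inv_def)
      next
        case yb: False
        show ?thesis
        proof (cases "filter (\<lambda>t. fst t = y) T")
          case Nil': Nil
          then have yT: "y \<notin> fst ` ?T" unfolding fstT by (auto simp: filter_empty_conv)
          \<comment> \<open>Only \<open>x\<close> and \<open>b\<close> are exposed by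
            \<open>M\<close>, so \<open>y\<close> has a partner and the default branch of
            \<open>grow\<close> is not reached.\<close>
          have "y \<in> V - {x, b}" using graphD(4,6)[OF g] xy yb by auto
          then obtain z where z: "(y, z) \<in> set M" using pmatch_partner[OF tree_invD(9)[OF t xM']] by blast
          then obtain e es where e: "filter (\<lambda>e. fst e = y) M = e # es"
            by (cases "filter (\<lambda>e. fst e = y) M") (auto simp: filter_empty_conv)
          then have "e \<in> set M" "fst e = y" by (auto dest: filter_eq_ConsD)
          then obtain z where ez: "e = (y, z)" "(y, z) \<in> set M" by (metis prod.collapse)
          let ?M' = "(x, y) # (y, x) # filter (\<lambda>f. fst f \<noteq> y \<and> fst f \<noteq> z) M"
          have M': "set ?M' = {f \<in> set M. fst f \<notin> {y, z}} \<union> {(x, y), (y, x)}" by auto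
          note ext = tree_extend[OF g t xM' xy yb yT yS ez(2), folded M']
          have T': "apsnd set ` set ((z, ?M') # T) = insert (z, set ?M') ?T" by simp
          have "(z, set ?M') \<notin> ?T" using ext(2) imageI[of "(z, set ?M')" ?T fst] unfolding fst_conv by blast
          then have "card (apsnd set ` set ((z, ?M') # T)) = Suc (card ?T)"
            unfolding T' using tree_invD(2)[OF t] by simp
          then have "card V * (card V0 + 2) \<le> m + card (apsnd set ` set ((z, ?M') # T))"
            using \<mu> by simp
          moreover have "tree_inv V (set E) b (apsnd set ` set ((z, ?M') # T)) (set (y # S))"
            unfolding T' list.set(2)[of y S] by (rule ext(1))
          ultimately have "search_inv V0 E0 b m ([], E, (z, ?M') # T, y # S)"
            unfolding search_inv_def prod.case using g V m bar by blast
          then show ?thesis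
            using Cons c yb Nil' e ez by (simp add: s r grow_def)
        next
          case (Cons t' ts)
          then have "t' \<in> set T" "fst t' = y" by (auto dest: filter_eq_ConsD)
          then obtain M2 where M2: "t' = (y, M2)" "(y, M2) \<in> set T" by (metis prod.collapse)
          then have yM2: "(y, set M2) \<in> ?T" by force
          let ?C = "support_list M M2"
          let ?V = "V - (set ?C - {x})"
          let ?E = "contract_list ?C x E"
          let ?M = "filter (\<lambda>e. fst e \<notin> set ?C) M"
          note con = tree_contract[OF g t xM' yM2 xy, folded set_support_list, folded set_contract_list]
          have "x \<noteq> y" using graphD(4)[OF g] xy by auto
          have "card ?V < card V"
            using con(2,3) \<open>x \<noteq> y\<close> finV by (intro psubset_card_mono) auto
          \<comment> \<open>At least one vertex disappears, as \<open>x\<close> and \<open>y\<close>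
            are distinct members of the cycle; its weight exceeds the size of the discarded tree by
            two or more.\<close>
          then have "Suc (card ?V) * (card V0 + 2) \<le> card V * (card V0 + 2)" by (intro mult_le_mono1) simp
          then have \<mu>': "card ?V * (card V0 + 2) \<le> m" using \<mu> cardT by simp
          have M': "apsnd set ` set [(x, ?M)] = {(x, {e \<in> set M. fst e \<notin> set ?C})}" by simp
          have "tree_inv ?V (set ?E) b (apsnd set ` set [(x, ?M)]) (set [])"
            unfolding M' list.set(1) by (rule con(7))
          moreover have "card ?V * (card V0 + 2) \<le> m + card (apsnd set ` set [(x, ?M)])"
            using \<mu>' by simp
          moreover have "graph ?V (set ?E)" by (rule graph_contract[OF g con(3,1), folded set_contract_list])
          moreover have "matchable ?V (set ?E) \<Longrightarrow> matchable V0 E0" by (rule m[OF con(5)])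
          moreover have "barrier ?V (set ?E) S' f \<Longrightarrow> \<exists>S f. barrier V0 E0 S f" for S' f by (rule bar[OF con(6)])
          moreover have "?V \<subseteq> V0" using V by auto
          ultimately have "search_inv V0 E0 b m ([], ?E, [(x, ?M)], [])"
            unfolding search_inv_def prod.case by blast
          then show ?thesis
            using \<open>candidates E T S = c # cs\<close> c yb Cons M2 by (simp add: s r grow_def Let_def)
        qed
      qed
    qed
  qed
qed

lemma grow_steps_inv:
  "finite V0 \<Longrightarrow> search_inv V0 E0 b (m + n) s \<Longrightarrow> search_inv V0 E0 b m ((grow b ^^ n) s)"
proof (induction n arbitrary: s)
  case (Suc n)
  have "search_inv V0 E0 b (m + n) (grow b s)"
    by (rule grow_inv) (use Suc.prems in simp_all)
  from Suc.IH[OF Suc.prems(1) this] show ?case by (simp add: funpow_swap1)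
qed simp

lemma augmentable_iff:
  assumes g: "graph V (set E)" and ab: "a \<in> V" "b \<in> V" "a \<noteq> b" and M: "pmatch (V - {a, b}) (set E) (set M)"
    and n: "card V * (card V + 2) \<le> n"
  shows "augmentable n E M a b \<longleftrightarrow> matchable V (set E)"
proof -
  have fin: "finite V" by (rule graphD(1)[OF g])
  have "tree_inv V (set E) b {(a, set M)} {}" by (rule tree_inv_start[OF ab M])
  then have "search_inv V (set E) b (0 + n) ([], E, [(a, M)], [])"
    unfolding search_inv_def using g n by auto
  from grow_steps_inv[OF fin this] have inv: "search_inv V (set E) b 0 ((grow b ^^ n) ([], E, [(a, M)], []))" .
  obtain r E' T S where s: "(grow b ^^ n) ([], E, [(a, M)], []) = (r, E', T, S)"
    by (metis prod.exhaust)
  \<comment> \<open>With the budget exhausted, the weight of the remaining vertices would be at most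
    the size of the tree, hence at most their number; but \<open>b\<close> remains.\<close>
  have "r \<noteq> []"
  proof
    assume r: "r = []"
    let ?T = "apsnd set ` set T"
    from inv r obtain V' where V': "V' \<subseteq> V" "tree_inv V' (set E') b ?T (set S)"
      "card V' * (card V + 2) \<le> card ?T"
      unfolding s search_inv_def by auto
    have fin': "finite V'" using V'(1) fin finite_subset by blast
    have "card ?T = card (fst ` ?T)" using tree_invD(3)[OF V'(2)] by (simp add: card_image)
    also have "\<dots> \<le> card V'" using tree_invD(7)[OF V'(2)] fin' by (intro card_mono) auto
    finally have "card V' * (card V + 2) \<le> card V' * 1" using V'(3) by simp
    moreover have "card V' > 0" using tree_invD(5)[OF V'(2)] fin' by (auto simp: card_gt_0_iff)
    ultimately show False by simp
  qed
  then show ?thesis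
    using inv barrier_not_matchable[OF g] unfolding s search_inv_def augmentable_def by auto
qed

section \<open>Extracting a matching from the decision procedure\<close>

definition shrink_step :: "nat \<Rightarrow> 'v edges \<Rightarrow> 'v \<Rightarrow> 'v \<Rightarrow> 'v \<times> 'v \<Rightarrow> 'v edges \<Rightarrow> 'v edges" where
  "shrink_step n M a b e E =
     (if e \<in> set M then E
      else (let E2 = filter (\<lambda>f. f \<noteq> e \<and> f \<noteq> (snd e, fst e)) E in
        if augmentable n E2 M a b then E2 else E))"

text \<open>Edges of \<open>M\<close> always survive, because \<open>M\<close> is the near-perfect
  matching from which every call of \<open>augmentable\<close> starts.\<close>

definition shrink :: "nat \<Rightarrow> 'v edges \<Rightarrow> 'v edges \<Rightarrow> 'v \<Rightarrow> 'v \<Rightarrow> 'v edges" where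
  "shrink n E M a b = fold (shrink_step n M a b) E E"

text \<open>\<open>F\<close> is the part of the new matching outside \<open>M\<close>; a vertex that
  \<open>F\<close> does not touch keeps its edge of \<open>M\<close>.\<close>

definition augment :: "nat \<Rightarrow> 'v edges \<Rightarrow> 'v edges \<Rightarrow> 'v \<Rightarrow> 'v \<Rightarrow> 'v edges" where
  "augment n E M a b = (let F = filter (\<lambda>e. e \<notin> set M) (shrink n E M a b) in
     F @ filter (\<lambda>e. fst e \<notin> set (map fst F)) M)"

lemma graph_remove_edge:
  assumes "graph V E"
  shows "graph V {f \<in> E. f \<noteq> e \<and> f \<noteq> (snd e, fst e)}"
  using assms unfolding graph_def irrefl_def by (auto intro!: symI dest: symD)

text \<open>Once no edge outside \<open>M\<close> is superfluous, the edges outside \<open>M\<close> are exactly those of a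
  perfect matching \<open>N\<close> outside \<open>M\<close>.\<close>

lemma augment_pmatch:
  assumes g: "graph V (set E)" and ab: "a \<in> V" "b \<in> V" "a \<noteq> b" and M: "pmatch (V - {a, b}) (set E) (set M)"
    and n: "card V * (card V + 2) \<le> n" and matchable: "matchable V (set E)"
  shows "pmatch V (set E) (set (augment n E M a b))"
proof -
  let ?del = "\<lambda>e E. {f \<in> E. f \<noteq> e \<and> f \<noteq> (snd e, fst e)}"
  define f where "f = shrink_step n M a b"
  define good where "good X \<longleftrightarrow> graph V (set X) \<and> matchable V (set X) \<and> set M \<subseteq> set X" for X
  have step: "good (f e X) \<and> set (f e X) \<subseteq> set X \<and>
      (e \<notin> set M \<longrightarrow> e \<in> set (f e X) \<longrightarrow> \<not> matchable V (?del e (set (f e X))))"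
    if "good X" for e X
  proof (cases "e \<in> set M")
    case False
    let ?X = "filter (\<lambda>f. f \<noteq> e \<and> f \<noteq> (snd e, fst e)) X"
    have X: "set ?X = ?del e (set X)" by auto
    have "(snd e, fst e) \<notin> set M" using False pmatchD(1)[OF M, of "snd e" "fst e"] by auto
    then have sub: "set M \<subseteq> set ?X" using that False by (auto simp: good_def)
    have g2: "graph V (set ?X)" unfolding X by (rule graph_remove_edge) (use that in \<open>simp add: good_def\<close>)
    have aug: "augmentable n ?X M a b \<longleftrightarrow> matchable V (set ?X)"
      by (rule augmentable_iff[OF g2 ab pmatch_mono[OF M sub] n])
    show ?thesis
    proof (cases "augmentable n ?X M a b")
      case True
      then have "f e X = ?X" using False by (simp add: f_def shrink_step_def Let_def)
      moreover have "good ?X" using True aug sub g2 by (simp add: good_def)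
      moreover have "e \<notin> set ?X" "set ?X \<subseteq> set X" by auto
      ultimately show ?thesis by simp
    next
      case no: False
      then have "f e X = X" using False by (simp add: f_def shrink_step_def Let_def)
      moreover have "\<not> matchable V (?del e (set X))" using no aug unfolding X by simp
      ultimately show ?thesis using that by simp
    qed
  next
    case True
    then have "f e X = X" by (simp add: f_def shrink_step_def)
    then show ?thesis using that True by simp
  qed
  have steps: "good (fold f es X) \<and> set (fold f es X) \<subseteq> set X \<and>
      (\<forall>e \<in> set es. e \<notin> set M \<longrightarrow> e \<in> set (fold f es X) \<longrightarrow> \<not> matchable V (?del e (set (fold f es X))))"
    if "good X" for es X
    using that
  proof (induction es arbitrary: X)
    case (Cons e es)
    note s = step[OF Cons.prems, of e]
    define Y where "Y = fold f es (f e X)"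
    have IH: "good Y" "set Y \<subseteq> set (f e X)"
      "\<And>e. e \<in> set es \<Longrightarrow> e \<notin> set M \<Longrightarrow> e \<in> set Y \<Longrightarrow> \<not> matchable V (?del e (set Y))"
      using Cons.IH[of "f e X"] s unfolding Y_def by blast+
    have "\<not> matchable V (?del e (set Y))" if e: "e \<notin> set M" "e \<in> set Y"
    proof
      assume m: "matchable V (?del e (set Y))"
      \<comment> \<open>An edge found indispensable remains so while further edges disappear, so a
        single pass over the edges suffices.\<close>
      have "?del e (set Y) \<subseteq> ?del e (set (f e X))" using IH(2) by auto
      with m have "matchable V (?del e (set (f e X)))" by (rule matchable_mono)
      then show False using s e IH(2) by blast
    qed
    moreover have "fold f (e # es) X = Y" by (simp add: Y_def)
    ultimately show ?case using IH s by auto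
  qed simp
  define E' where "E' = shrink n E M a b"
  have "good E" using M g matchable by (simp add: pmatch_def good_def)
  from steps[OF this, of E]
  have E': "graph V (set E')" "matchable V (set E')" "set M \<subseteq> set E'" "set E' \<subseteq> set E"
    and minimal: "\<And>e. e \<in> set E' \<Longrightarrow> e \<notin> set M \<Longrightarrow> \<not> matchable V (?del e (set E'))"
    unfolding E'_def shrink_def f_def[symmetric] good_def by blast+
  obtain N where N: "pmatch V (set E') N" using E'(2) by (auto simp: matchable_def)
  have F: "set E' - set M = N - set M"
  proof
    show "N - set M \<subseteq> set E' - set M" using N by (auto simp: pmatch_def)
    show "set E' - set M \<subseteq> N - set M"
    proof
      fix e assume e: "e \<in> set E' - set M"
      have "e \<in> N"
      proof (rule ccontr)
        assume "e \<notin> N"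
        then have "(snd e, fst e) \<notin> N" using pmatchD(1)[OF N, of "snd e" "fst e"] by auto
        then have "N \<subseteq> ?del e (set E')" using \<open>e \<notin> N\<close> N by (auto simp: pmatch_def)
        from pmatch_mono[OF N this] minimal e show False by (auto simp: matchable_def)
      qed
      then show "e \<in> N - set M" using e by simp
    qed
  qed
  have "set (augment n E M a b) = (set E' - set M) \<union> {e \<in> set M. fst e \<notin> fst ` (set E' - set M)}"
    unfolding augment_def E'_def[symmetric] Let_def set_append set_map set_filter set_diff_eq ..
  also have "\<dots> = N"
    unfolding F
  proof
    show "(N - set M) \<union> {e \<in> set M. fst e \<notin> fst ` (N - set M)} \<subseteq> N"
    proof safe
      fix u v assume uv: "(u, v) \<in> set M" "fst (u, v) \<notin> fst ` (N - set M)"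
      have "u \<in> V" using pmatchD(3)[OF M uv(1)] by simp
      then obtain w where w: "(u, w) \<in> N" using pmatch_partner[OF N] by blast
      then have "(u, w) \<in> set M" using uv(2) by (metis DiffI image_eqI fst_conv)
      then have "w = v" using pmatch_unique[OF M _ uv(1)] by blast
      then show "(u, v) \<in> N" using w by simp
    qed
    show "N \<subseteq> (N - set M) \<union> {e \<in> set M. fst e \<notin> fst ` (N - set M)}"
    proof
      fix e assume e: "e \<in> N"
      obtain u v where uv: "e = (u, v)" by fastforce
      have "u \<notin> fst ` (N - set M)" if "(u, v) \<in> set M"
        using pmatch_unique[OF N] e that unfolding uv by force
      then show "e \<in> (N - set M) \<union> {e \<in> set M. fst e \<notin> fst ` (N - set M)}" using e uv by auto
    qed
  qed
  finally have "set (augment n E M a b) = N" .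
  then show ?thesis using pmatch_mono[OF N, of "set E"] N E'(4) by (auto simp: pmatch_def)
qed

text \<open>The edges of an artificial perfect matching \<open>D\<close> are removed one after the other.\<close>

definition remove_dummy :: "nat \<Rightarrow> 'v edges \<Rightarrow> 'v \<times> 'v \<Rightarrow> bool \<times> 'v edges \<times> 'v edges \<Rightarrow> bool \<times> 'v edges \<times> 'v edges" where
  "remove_dummy n E d s =
     (if \<not> fst s \<or> d \<in> set E then s
      else (let d' = (snd d, fst d);
                E2 = filter (\<lambda>f. f \<noteq> d \<and> f \<noteq> d') (fst (snd s));
                M = snd (snd s) in
        if d \<notin> set M then (True, E2, M)
        else (let M2 = filter (\<lambda>f. f \<noteq> d \<and> f \<noteq> d') M in
          if augmentable n E2 M2 (fst d) (snd d) then (True, E2, augment n E2 M2 (fst d) (snd d))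
          else (False, E2, M))))"

definition decide_matchable :: "nat \<Rightarrow> 'v edges \<Rightarrow> 'v edges \<Rightarrow> bool" where
  "decide_matchable n D E =
     (let D' = map (\<lambda>d. (snd d, fst d)) D in fst (fold (remove_dummy n E) D (True, E @ D @ D', D @ D')))"

text \<open>When an artificial edge of the current matching is removed, exactly its two ends become
  exposed, which is the situation that \<open>augmentable\<close> decides. A negative verdict
  already refutes the smaller edge set \<open>E\<close>.\<close>

lemma remove_dummy_correct:
  fixes V :: "'v set"
  assumes g: "graph V (set E)" and n: "card V * (card V + 2) \<le> n"
  shows "graph V (set E') \<Longrightarrow> set E \<subseteq> set E' \<Longrightarrow> pmatch V (set E') (set M) \<Longrightarrow>
    set E' \<subseteq> set E \<union> set D \<union> (set D)\<inverse> \<Longrightarrow>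
    fst (fold (remove_dummy n E) D (True, E', M)) \<longleftrightarrow> matchable V (set E)"
proof (induction D arbitrary: E' M)
  case Nil
  then have "set E' = set E" by auto
  then show ?case using Nil by (auto simp: matchable_def)
next
  case (Cons d D)
  obtain a b where d: "d = (a, b)" by fastforce
  have Esym: "(a, b) \<in> set E \<longleftrightarrow> (b, a) \<in> set E" using graphD(3)[OF g] by blast
  show ?case
  proof (cases "d \<in> set E")
    case True
    then have "remove_dummy n E d (True, E', M) = (True, E', M)" by (simp add: remove_dummy_def)
    moreover have "set E' \<subseteq> set E \<union> set D \<union> (set D)\<inverse>"
      using Cons.prems(4) True Esym d by auto
    ultimately show ?thesis using Cons.IH[of E' M] Cons.prems by simp
  next
    case False
    let ?E2 = "filter (\<lambda>f. f \<noteq> d \<and> f \<noteq> (b, a)) E'"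
    let ?M2 = "filter (\<lambda>f. f \<noteq> d \<and> f \<noteq> (b, a)) M"
    have E2: "graph V (set ?E2)" "set E \<subseteq> set ?E2" "set ?E2 \<subseteq> set E \<union> set D \<union> (set D)\<inverse>"
      using graph_remove_edge[OF Cons.prems(1), of d] Cons.prems(2,4) False Esym d by auto
    have M: "pmatch V (set E') (set M)" by (rule Cons.prems(3))
    show ?thesis
    proof (cases "d \<in> set M")
      case dM: False
      then have "(b, a) \<notin> set M" using pmatchD(1)[OF M] d by blast
      then have "set M \<subseteq> set ?E2" using M dM by (auto simp: pmatch_def)
      from pmatch_mono[OF M this] have "pmatch V (set ?E2) (set M)" .
      from Cons.IH[OF E2(1,2) this E2(3)] show ?thesis
        using False dM d by (simp add: remove_dummy_def Let_def)
    next
      case True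
      then have abM: "(a, b) \<in> set M" by (simp add: d)
      have ab: "a \<in> V" "b \<in> V" "a \<noteq> b" using pmatchD(2,3,4)[OF M abM] graphD(4)[OF Cons.prems(1)] by auto
      have "pmatch (V - {a, b}) (set E') (set ?M2)"
        using pmatch_remove[OF M abM] by (simp add: d set_diff_eq conj_commute insert_commute) 
      then have M2: "pmatch (V - {a, b}) (set ?E2) (set ?M2)"
        by (rule pmatch_mono) (use M in \<open>auto simp: pmatch_def\<close>)
      have aug: "augmentable n ?E2 ?M2 a b \<longleftrightarrow> matchable V (set ?E2)"
        by (rule augmentable_iff[OF E2(1) ab M2 n])
      show ?thesis
      proof (cases "augmentable n ?E2 ?M2 a b")
        case yes: True
        have "pmatch V (set ?E2) (set (augment n ?E2 ?M2 a b))"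
          by (rule augment_pmatch[OF E2(1) ab M2 n]) (use aug yes in simp)
        from Cons.IH[OF E2(1,2) this E2(3)] show ?thesis
          using False True yes d by (simp add: remove_dummy_def Let_def)
      next
        case no: False
        have stay: "fold (remove_dummy n E) D (False, s) = (False, s)" for s
          by (induction D) (auto simp: remove_dummy_def)
        have "\<not> matchable V (set E)" using no aug matchable_mono[OF _ E2(2)] by blast
        moreover have "remove_dummy n E d (True, E', M) = (False, ?E2, M)"
          using False True no d by (simp add: remove_dummy_def Let_def)
        ultimately show ?thesis using stay by simp
      qed
    qed
  qed
qed

lemma pmatch_dummy:
  assumes "distinct (map fst D @ map snd D)"
  shows "pmatch (fst ` set D \<union> snd ` set D) (set D \<union> (set D)\<inverse>) (set D \<union> (set D)\<inverse>)"
proof (rule pmatchI)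
  have d: "distinct (map fst D)" "distinct (map snd D)" "fst ` set D \<inter> snd ` set D = {}" using assms by auto
  have inj: "inj_on fst (set D)" "inj_on snd (set D)" using d by (auto simp: distinct_map)
  fix x y z assume a: "(x, y) \<in> set D \<union> (set D)\<inverse>" "(x, z) \<in> set D \<union> (set D)\<inverse>"
  then consider "(x, y) \<in> set D" "(x, z) \<in> set D" | "(y, x) \<in> set D" "(z, x) \<in> set D"
    | "x \<in> fst ` set D \<inter> snd ` set D" by force
  then show "y = z"
  proof cases
    case 1
    then show ?thesis using inj_onD[OF inj(1), of "(x, y)" "(x, z)"] by simp
  next
    case 2
    then show ?thesis using inj_onD[OF inj(2), of "(y, x)" "(z, x)"] by simp
  qed (use d(3) in simp)
qed force+

theorem decide_matchable_iff:
  assumes g: "graph V (set E)" and D: "distinct (map fst D @ map snd D)" "V = fst ` set D \<union> snd ` set D"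
    and n: "card V * (card V + 2) \<le> n"
  shows "decide_matchable n D E \<longleftrightarrow> matchable V (set E)"
proof -
  let ?D' = "map (\<lambda>d. (snd d, fst d)) D"
  have D': "set ?D' = (set D)\<inverse>" by force
  have dd: "pmatch V (set D \<union> (set D)\<inverse>) (set D \<union> (set D)\<inverse>)"
    using pmatch_dummy[OF D(1)] D(2) by simp
  have "irrefl (set D)" using D(1) unfolding irrefl_def by force
  then have "graph V (set (E @ D @ ?D'))"
    using g dd unfolding graph_def set_append D' irrefl_def pmatch_def
    by (auto simp: sym_Un intro!: sym_Un)
  moreover have "pmatch V (set (E @ D @ ?D')) (set (D @ ?D'))"
    unfolding set_append D' by (rule pmatch_mono[OF dd]) blast
  ultimately show ?thesis
    unfolding decide_matchable_def Let_def
    by (intro remove_dummy_correct[OF g n]) (simp_all only: set_append D', blast+)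
qed


subsection \<open>Running time of the matching algorithm\<close>

lemma FP_candidates [FP_intros]:
  assumes "FP E" "FP T" "FP S" shows "FP (\<lambda>x. candidates (E x) (T x) (S x))"
  by (rule FP_comp3[where g = candidates, OF _ assms]) (unfold candidates_def, intro FP_intros)

lemma FP_support_list [FP_intros]:
  assumes "FP M" "FP N" shows "FP (\<lambda>x. support_list (M x) (N x))"
  by (rule FP_comp2[where g = support_list, OF _ assms]) (unfold support_list_def, intro FP_intros)

lemma FP_contract_list [FP_intros]:
  assumes "FP C" "FP v" "FP E" shows "FP (\<lambda>x. contract_list (C x) (v x) (E x))"
  by (rule FP_comp3[where g = contract_list, OF _ assms]) (unfold contract_list_def, intro FP_intros)

lemma FP_grow:
  assumes "FP b" "FP s" shows "FP (\<lambda>x. grow (b x) (s x))"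
  by (rule FP_comp2[where g = grow, OF _ assms]) (unfold grow_def, intro FP_intros)

definition sized_edges :: "nat \<Rightarrow> nat \<Rightarrow> ('v :: data) edges \<Rightarrow> bool" where
  "sized_edges K L E \<longleftrightarrow> length E \<le> L \<and> (\<forall>e \<in> set E. csize (fst e) \<le> K \<and> csize (snd e) \<le> K)"

text \<open>These bounds hold for arbitrary lists, with or without \<open>search_inv\<close>.
  Contraction only renames ends and drops edges, so \<open>K\<close> persists; \<open>L\<close>
  grows by 2 per step, since an extended matching receives both directions of a new edge.\<close>

definition sized :: "nat \<Rightarrow> nat \<Rightarrow> ('v :: data) search \<Rightarrow> bool" where
  "sized K L = (\<lambda>(r, E, T, S). length r \<le> 1 \<and> sized_edges K K E \<and>
     length T \<le> L \<and> (\<forall>t \<in> set T. csize (fst t) \<le> K \<and> sized_edges K L (snd t)) \<and>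
     length S \<le> L \<and> (\<forall>y \<in> set S. csize y \<le> K))"

lemma sized_mono: "sized K L s \<Longrightarrow> L \<le> L' \<Longrightarrow> sized K L' s"
  by (cases s) (auto simp: sized_def sized_edges_def intro: le_trans)

lemma sized_edges_filter: "sized_edges K L E \<Longrightarrow> sized_edges K L (filter P E)"
  by (auto simp: sized_edges_def intro: le_trans[OF length_filter_le])

lemma sized_grow:
  assumes "sized K L s" "1 \<le> L"
  shows "sized K (L + 2) (grow b s)"
proof -
  obtain r E T S where s: "s = (r, E, T, S)" by (cases s) auto
  have E: "sized_edges K K E" and T: "length T \<le> L" "\<And>t. t \<in> set T \<Longrightarrow> csize (fst t) \<le> K \<and> sized_edges K L (snd t)"
    and S: "length S \<le> L" "\<And>y. y \<in> set S \<Longrightarrow> csize y \<le> K"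
    using assms(1) by (auto simp: s sized_def)
  have up: "sized_edges K L M \<Longrightarrow> sized_edges K (L + 2) M" for M :: "'a edges"
    by (auto simp: sized_edges_def)
  have same: "sized K (L + 2) (r', E, T, S)" if "length r' \<le> 1" for r'
    using that E T S up by (auto simp: sized_def)
  show ?thesis
  proof (cases "r = [] \<and> candidates E T S \<noteq> []")
    case False
    then show ?thesis using sized_mono[OF assms(1), of "L + 2"] same[of "[False]"]
      by (auto simp: s grow_def Let_def)
  next
    case True
    then obtain x M y cs where c: "candidates E T S = ((x, M), y) # cs"
      by (metis neq_Nil_conv prod.exhaust)
    then have "((x, M), y) \<in> set (candidates E T S)" by simp
    then have xM: "(x, M) \<in> set T" and xy: "(x, y) \<in> set E" by (simp_all add: in_candidates)
    have x: "csize x \<le> K" and M: "sized_edges K L M" using T(2)[OF xM] by auto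
    have y: "csize y \<le> K" using E xy by (auto simp: sized_edges_def)
    show ?thesis
    proof (cases "y = b")
      case True
      then show ?thesis using c \<open>r = [] \<and> _\<close> same[of "[True]"] by (simp add: s grow_def Let_def)
    next
      case yb: False
      show ?thesis
      proof (cases "filter (\<lambda>t. fst t = y) T")
        case Nil
        show ?thesis
        proof (cases "filter (\<lambda>e. fst e = y) M")
          case Nil
          then show ?thesis
            using c \<open>r = [] \<and> _\<close> yb \<open>filter (\<lambda>t. fst t = y) T = []\<close> same[of "[False]"]
            by (simp add: s grow_def Let_def)
        next
          case (Cons e es)
          then have "e \<in> set M" by (auto dest: filter_eq_ConsD)
          then have z: "csize (snd e) \<le> K" using M by (auto simp: sized_edges_def)
          let ?M = "(x, y) # (y, x) # filter (\<lambda>f. fst f \<noteq> y \<and> fst f \<noteq> snd e) M"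
          have "sized_edges K (L + 2) ?M"
            using x y sized_edges_filter[OF M] by (auto simp: sized_edges_def)
          then have "sized K (L + 2) ([], E, (snd e, ?M) # T, y # S)"
            using E T S up y z by (auto simp: sized_def)
          then show ?thesis
            using c \<open>r = [] \<and> _\<close> yb Nil Cons by (simp add: s grow_def Let_def)
        qed
      next
        case (Cons t ts)
        let ?C = "support_list M (snd t)"
        have "sized_edges K K (contract_list ?C x E)"
          using E x unfolding sized_edges_def contract_list_def
          by (auto intro: le_trans[OF length_filter_le])
        moreover have "sized_edges K (L + 2) (filter (\<lambda>e. fst e \<notin> set ?C) M)"
          by (rule up[OF sized_edges_filter[OF M]])
        ultimately have "sized K (L + 2) ([], contract_list ?C x E, [(x, filter (\<lambda>e. fst e \<notin> set ?C) M)], [])"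
          using x assms(2) by (auto simp: sized_def)
        then show ?thesis
          using c \<open>r = [] \<and> _\<close> yb Cons by (simp add: s grow_def Let_def)
      qed
    qed
  qed
qed

lemma csize_list_bound:
  assumes "\<And>x. x \<in> set xs \<Longrightarrow> csize x \<le> B" "length xs \<le> L"
  shows "csize xs \<le> L * (B + 1) + 1"
proof -
  have "csize xs \<le> length xs * (B + 1) + 1" by (rule csize_list_le[OF assms(1)])
  also have "\<dots> \<le> L * (B + 1) + 1" by (intro add_mono mult_mono assms(2)) auto
  finally show ?thesis .
qed

lemma csize_sized_edges: "sized_edges K L E \<Longrightarrow> csize E \<le> L * (K + K + 1 + 1) + 1"
proof (rule csize_list_bound)
  fix e assume "sized_edges K L E" "e \<in> set E"
  then show "csize e \<le> K + K + 1" by (cases e) (auto simp: sized_edges_def intro: add_mono)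
qed (simp add: sized_edges_def)

lemma csize_sized:
  assumes "sized K L s"
  shows "csize s \<le> (1 * (3 + 1) + 1) + ((K * (K + K + 1 + 1) + 1) +
     ((L * (K + (L * (K + K + 1 + 1) + 1) + 1 + 1) + 1) + (L * (K + 1) + 1) + 1) + 1) + 1"
proof -
  obtain r E T S where s: "s = (r, E, T, S)" by (cases s) auto
  have a: "length r \<le> 1" "sized_edges K K E" "length T \<le> L" "length S \<le> L"
    "\<And>y. y \<in> set S \<Longrightarrow> csize y \<le> K" "\<And>t. t \<in> set T \<Longrightarrow> csize (fst t) \<le> K \<and> sized_edges K L (snd t)"
    using assms by (auto simp: s sized_def)
  have r: "csize r \<le> 1 * (3 + 1) + 1" by (rule csize_list_bound[OF csize_bool a(1)])
  have S: "csize S \<le> L * (K + 1) + 1" by (rule csize_list_bound[OF a(5,4)])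
  have T: "csize T \<le> L * (K + (L * (K + K + 1 + 1) + 1) + 1 + 1) + 1"
  proof (rule csize_list_bound[OF _ a(3)])
    fix t assume "t \<in> set T"
    from a(6)[OF this] show "csize t \<le> K + (L * (K + K + 1 + 1) + 1) + 1"
      using csize_sized_edges[of K L "snd t"] by (cases t) simp
  qed
  show ?thesis unfolding s csize_simps(3)
    by (intro add_mono r S T csize_sized_edges[OF a(2)] le_refl)
qed

lemma sized_edges_csize: "csize E \<le> K \<Longrightarrow> sized_edges K (csize E) E" for E :: "('v :: data) edges"
  unfolding sized_edges_def
proof (intro conjI ballI)
  show "length E \<le> csize E" using length_le_csize[of E] by simp
  fix e assume "csize E \<le> K" "e \<in> set E"
  then show "csize (fst e) \<le> K" "csize (snd e) \<le> K" using csize_member[of e E] by (cases e; simp)+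
qed

lemma FP_augmentable [FP_intros]:
  fixes E M :: "'a :: data \<Rightarrow> ('v :: data) edges"
  assumes "FP n" "FP E" "FP M" "FP a" "FP b"
  shows "FP (\<lambda>x. augmentable (n x) (E x) (M x) (a x) (b x))"
proof -
  let ?K = "\<lambda>x. csize (E x) + csize (M x) + csize (a x)"
  let ?L = "\<lambda>x. csize (M x) + 1 + 2 * csize (n x)"
  let ?B = "\<lambda>x. (1 * (3 + 1) + 1) + ((?K x * (?K x + ?K x + 1 + 1) + 1) +
     ((?L x * (?K x + (?L x * (?K x + ?K x + 1 + 1) + 1) + 1 + 1) + 1) + (?L x * (?K x + 1) + 1) + 1) + 1) + 1"
  have "FP (\<lambda>x. (grow (b x) ^^ n x) ([], E x, [(a x, M x)], []))"
  proof (rule FP_funpow[where B = ?B])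
    fix x j assume j: "j \<le> n x"
    have "sized_edges (?K x) (csize (M x) + 1) (M x)"
      using sized_edges_csize[of "M x" "?K x"] by (auto simp: sized_edges_def)
    moreover have "sized_edges (?K x) (?K x) (E x)"
      using sized_edges_csize[of "E x" "?K x"] by (auto simp: sized_edges_def)
    ultimately have start: "sized (?K x) (csize (M x) + 1) ([], E x, [(a x, M x)], [])"
      by (simp add: sized_def)
    have "sized (?K x) (csize (M x) + 1 + 2 * j) ((grow (b x) ^^ j) ([], E x, [(a x, M x)], []))" for j
    proof (induction j)
      case (Suc j)
      from sized_grow[OF this, of "b x"] show ?case by simp
    qed (use start in simp)
    then have "sized (?K x) (?L x) ((grow (b x) ^^ j) ([], E x, [(a x, M x)], []))"
      by (rule sized_mono) (use j in simp)
    then show "csize ((grow (b x) ^^ j) ([], E x, [(a x, M x)], [])) \<le> ?B x" by (rule csize_sized)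
  next
    show "FP (\<lambda>z. grow (b (fst z)) (snd z))"
      by (intro FP_grow FP_comp[OF assms(5)] FP_intros)
    show "poly_bounded ?B" by (intro poly_bounded_intros FP_csize assms)
  qed (intro FP_intros assms)+
  then show ?thesis unfolding augmentable_def by (intro FP_intros)
qed

lemma csize_filter: "csize (filter P xs) \<le> csize xs"
  by (induction xs) auto

lemma csize_shrink_step: "csize (shrink_step n M a b e E) \<le> csize E"
  by (auto simp: shrink_step_def Let_def csize_filter)

lemma csize_fold_shrink: "csize (fold (shrink_step n M a b) es E) \<le> csize E"
proof (induction es arbitrary: E)
  case (Cons e es)
  from order_trans[OF Cons[of "shrink_step n M a b e E"] csize_shrink_step] show ?case by simp
qed simp

lemma FP_shrink [FP_intros]:
  fixes E M :: "'a :: data \<Rightarrow> ('v :: data) edges"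
  assumes "FP n" "FP E" "FP M" "FP a" "FP b"
  shows "FP (\<lambda>x. shrink (n x) (E x) (M x) (a x) (b x))"
  unfolding shrink_def
proof (rule FP_fold_bounded[where B = E])
  note a = FP_comp[OF assms(1)] FP_comp[OF assms(3)] FP_comp[OF assms(4)] FP_comp[OF assms(5)]
  show "FP (\<lambda>z. shrink_step (n (fst z)) (M (fst z)) (a (fst z)) (b (fst z)) (fst (snd z)) (snd (snd z)))"
    unfolding shrink_step_def by (intro FP_intros a)
qed (use assms csize_fold_shrink in auto)

lemma FP_augment [FP_intros]:
  fixes E M :: "'a :: data \<Rightarrow> ('v :: data) edges"
  assumes "FP n" "FP E" "FP M" "FP a" "FP b"
  shows "FP (\<lambda>x. augment (n x) (E x) (M x) (a x) (b x))"
proof -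
  have "FP (\<lambda>z. augment (fst z) (fst (snd z)) (fst (snd (snd z))) (fst (snd (snd (snd z)))) (snd (snd (snd (snd z)))) :: 'v edges)"
    unfolding augment_def by (intro FP_intros)
  from FP_comp[OF this FP_Pair[OF assms(1) FP_Pair[OF assms(2) FP_Pair[OF assms(3) FP_Pair[OF assms(4,5)]]]]]
  show ?thesis by simp
qed

text \<open>The edge list never grows in \<open>decide_matchable\<close>, so with an additive bound
  the size of the matching increases linearly with the number of rounds instead of
  multiplying.\<close>

lemma csize_augment: "csize (augment n E M a b) \<le> csize E + csize M"
proof -
  have "csize (filter P (shrink n E M a b)) \<le> csize E" for P
    using order_trans[OF csize_filter csize_fold_shrink] unfolding shrink_def .
  moreover have "csize (filter P M) \<le> csize M" for P by (rule csize_filter)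
  moreover have "csize (xs @ ys) \<le> csize xs + csize ys" for xs ys :: "('a \<times> 'a) list"
    using csize_append[of xs ys] by simp
  ultimately show ?thesis unfolding augment_def Let_def by (meson add_mono order_trans)
qed

lemma FP_decide_matchable [FP_intros]:
  fixes D E :: "'a :: data \<Rightarrow> ('v :: data) edges"
  assumes "FP n" "FP D" "FP E"
  shows "FP (\<lambda>x. decide_matchable (n x) (D x) (E x))"
proof -
  note a = FP_comp[OF assms(1)] FP_comp[OF assms(3)]
  let ?E = "\<lambda>x. E x @ D x @ map (\<lambda>d. (snd d, fst d)) (D x)"
  let ?M = "\<lambda>x. D x @ map (\<lambda>d. (snd d, fst d)) (D x)"
  let ?B = "\<lambda>x. 3 + (csize (?E x) + (csize (?M x) + csize (D x) * csize (?E x)) + 1) + 1"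
  have E: "FP ?E" and M: "FP ?M" by (intro FP_intros assms)+
  have "FP (\<lambda>x. fold (remove_dummy (n x) (E x)) (D x) (True, ?E x, ?M x))"
  proof (rule FP_fold[where B = ?B])
    show "FP (\<lambda>z. remove_dummy (n (fst z)) (E (fst z)) (fst (snd z)) (snd (snd z)))"
      unfolding remove_dummy_def by (intro FP_intros a)
    show "poly_bounded ?B" by (intro poly_bounded_intros FP_csize assms E M)
    fix x ys zs assume D: "D x = ys @ zs"
    have step: "csize (fst (snd (remove_dummy m F d s))) \<le> csize (fst (snd s)) \<and>
        csize (snd (snd (remove_dummy m F d s))) \<le> csize (fst (snd s)) + csize (snd (snd s))"
      for m F d and s :: "bool \<times> 'v edges \<times> 'v edges"
      using order_trans[OF csize_augment add_mono[OF csize_filter csize_filter]]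
      by (auto simp: remove_dummy_def Let_def csize_filter)
    have "csize (fst (snd (fold (remove_dummy (n x) (E x)) ys s))) \<le> csize (fst (snd s)) \<and>
        csize (snd (snd (fold (remove_dummy (n x) (E x)) ys s))) \<le> length ys * csize (fst (snd s)) + csize (snd (snd s))"
      for s
    proof (induction ys arbitrary: s)
      case (Cons d ys)
      let ?s = "remove_dummy (n x) (E x) d s"
      have "length ys * csize (fst (snd ?s)) \<le> length ys * csize (fst (snd s))"
        using step by (intro mult_le_mono2) blast
      moreover have "length (d # ys) * csize (fst (snd s)) = csize (fst (snd s)) + length ys * csize (fst (snd s))"
        by simp
      ultimately show ?case
        using Cons[of ?s] step[of "n x" "E x" d s] unfolding fold_simps by linarith
    qed simp
    from this[of "(True, ?E x, ?M x)"] obtain ok F N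
      where s: "fold (remove_dummy (n x) (E x)) ys (True, ?E x, ?M x) = (ok, F, N)"
        and F: "csize F \<le> csize (?E x)" and N: "csize N \<le> length ys * csize (?E x) + csize (?M x)"
      by (cases "fold (remove_dummy (n x) (E x)) ys (True, ?E x, ?M x)") auto
    have "length ys * csize (?E x) \<le> csize (D x) * csize (?E x)"
      using length_le_csize[of "D x"] D by (intro mult_le_mono1) simp
    then show "csize (fold (remove_dummy (n x) (E x)) ys (True, ?E x, ?M x)) \<le> ?B x"
      unfolding s csize_simps(3) using F N csize_bool[of ok] by linarith
  qed (intro FP_intros assms)+
  then show ?thesis unfolding decide_matchable_def Let_def by (rule FP_fst)
qed


section \<open>Conformant manipulation\<close>

definition degree :: "('c \<times> 'c) list \<Rightarrow> 'c \<Rightarrow> nat" where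
  "degree es d = length (filter (\<lambda>e. fst e = d \<or> snd e = d) es)"

definition copies :: "'c set \<Rightarrow> ('c \<Rightarrow> nat) \<Rightarrow> ('c \<times> nat) set" where
  "copies A cap = {(c, i). c \<in> A \<and> i < cap c}"

text \<open>An edge becomes all pairs of copies of its ends, so that it can be used repeatedly with
  different copies.\<close>

definition copy_edges :: "('c \<times> 'c) set \<Rightarrow> ('c \<Rightarrow> nat) \<Rightarrow> (('c \<times> nat) \<times> ('c \<times> nat)) set" where
  "copy_edges Ed cap = {((a, i), (b, j)). i < cap a \<and> j < cap b \<and> ((a, b) \<in> Ed \<or> (b, a) \<in> Ed)}"

lemma finite_copies: "finite A \<Longrightarrow> finite (copies A cap)"
proof -
  assume "finite A"
  moreover have "copies A cap = Sigma A (\<lambda>c. {..<cap c})" by (auto simp: copies_def)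
  ultimately show ?thesis by simp
qed

text \<open>Each edge of the list takes the last copy of both its ends; lowering the two capacities
  by one keeps these copies free of the matching built from the rest.\<close>

lemma edges_to_matching:
  assumes "finite A"
  shows "set es \<subseteq> Ed \<Longrightarrow> Ed \<subseteq> A \<times> A \<Longrightarrow> irrefl Ed \<Longrightarrow> (\<And>d. d \<in> A \<Longrightarrow> degree es d \<le> cap d) \<Longrightarrow>
    \<exists>Q \<subseteq> copies A cap. card Q = 2 * length es \<and> matchable Q (copy_edges Ed cap)"
proof (induction es arbitrary: cap)
  case Nil
  then show ?case using pmatch_empty by (intro exI[of _ "{}"]) (auto simp: matchable_def)
next
  case (Cons e es)
  obtain a b where e: "e = (a, b)" by fastforce
  have ab: "(a, b) \<in> Ed" "a \<in> A" "b \<in> A" "a \<noteq> b" using Cons.prems(1-3) e by (auto simp: irrefl_def)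
  define cap' where "cap' = cap(a := cap a - 1, b := cap b - 1)"
  have pos: "cap a > 0" "cap b > 0"
    using Cons.prems(4)[OF ab(2)] Cons.prems(4)[OF ab(3)] by (auto simp: degree_def e)
  have "degree es d \<le> cap' d" if "d \<in> A" for d
    using Cons.prems(4)[OF that] by (auto simp: cap'_def degree_def e split: if_splits)
  from Cons.IH[of cap', OF _ Cons.prems(2,3) this] Cons.prems(1) obtain Q where
    Q: "Q \<subseteq> copies A cap'" "card Q = 2 * length es" "matchable Q (copy_edges Ed cap')" by auto
  have "copy_edges Ed cap' \<subseteq> copy_edges Ed cap"
    by (auto simp: copy_edges_def cap'_def split: if_splits)
  from matchable_mono[OF Q(3) this] obtain M where M: "pmatch Q (copy_edges Ed cap) M"
    by (auto simp: matchable_def)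
  let ?u = "(a, cap a - 1)" and ?v = "(b, cap b - 1)"
  have "(?u, ?v) \<in> copy_edges Ed cap" "(?v, ?u) \<in> copy_edges Ed cap"
    using pos ab by (auto simp: copy_edges_def)
  from pmatch_pair[OF this] have pair: "pmatch {?u, ?v} (copy_edges Ed cap) {(?u, ?v), (?v, ?u)}" .
  have new: "?u \<notin> Q" "?v \<notin> Q" "?u \<noteq> ?v" using Q(1) ab(4) by (auto simp: copies_def cap'_def)
  from pmatch_union[OF pair M] new have "matchable ({?u, ?v} \<union> Q) (copy_edges Ed cap)"
    by (auto simp: matchable_def)
  moreover have "{?u, ?v} \<union> Q \<subseteq> copies A cap"
    using Q(1) pos ab by (auto simp: copies_def cap'_def split: if_splits)
  moreover have "finite Q" using Q(1) finite_copies[OF assms] finite_subset by blast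
  then have "card ({?u, ?v} \<union> Q) = 2 * length (e # es)" using new Q(2) by simp
  ultimately show ?case by blast
qed

lemma matching_to_edges:
  "finite Q \<Longrightarrow> pmatch Q (copy_edges Ed cap) M \<Longrightarrow> irrefl Ed \<Longrightarrow>
    \<exists>es. 2 * length es = card Q \<and> set es \<subseteq> Ed \<and> (\<forall>d. degree es d \<le> card {q \<in> Q. fst q = d})"
proof (induction "card Q" arbitrary: Q M rule: less_induct)
  case less
  show ?case
  proof (cases "Q = {}")
    case True
    then show ?thesis by (intro exI[of _ "[]"]) (auto simp: degree_def)
  next
    case False
    then obtain u v where uv: "(u, v) \<in> M" "u \<in> Q" using pmatch_partner[OF less.prems(2)] by blast
    obtain a i b j where ab: "u = (a, i)" "v = (b, j)" by fastforce
    have uvE: "(u, v) \<in> copy_edges Ed cap" and vQ: "v \<in> Q" using pmatchD[OF less.prems(2)] uv by blast+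
    then have Ed: "(a, b) \<in> Ed \<or> (b, a) \<in> Ed" by (auto simp: copy_edges_def ab)
    then have "a \<noteq> b" using less.prems(3) by (auto simp: irrefl_def)
    let ?Q = "Q - {u, v}"
    have "{u, v} \<subseteq> Q" "card {u, v} = 2" using uv vQ ab \<open>a \<noteq> b\<close> by auto
    then have c: "card Q = card ?Q + 2"
      using card_Diff_subset[of "{u, v}" Q] card_mono[of Q "{u, v}"] less.prems(1) by simp
    have "\<exists>es. 2 * length es = card ?Q \<and> set es \<subseteq> Ed \<and> (\<forall>d. degree es d \<le> card {q \<in> ?Q. fst q = d})"
      by (rule less.hyps[OF _ _ pmatch_remove[OF less.prems(2) uv(1)] less.prems(3)]) (use c less.prems(1) in auto)
    then obtain es where es: "2 * length es = card ?Q" "set es \<subseteq> Ed"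
      "\<And>d. degree es d \<le> card {q \<in> ?Q. fst q = d}" by blast
    obtain e where e: "e \<in> Ed" "e = (a, b) \<or> e = (b, a)" using Ed by blast
    have "degree (e # es) d \<le> card {q \<in> Q. fst q = d}" for d
    proof -
      have fin: "finite {q \<in> Q. fst q = d}" using less.prems(1) by simp
      have split: "{q \<in> Q. fst q = d} = {q \<in> ?Q. fst q = d} \<union> {q \<in> {u, v}. fst q = d}"
        using uv vQ by auto
      have "card {q \<in> Q. fst q = d} = card {q \<in> ?Q. fst q = d} + card {q \<in> {u, v}. fst q = d}"
        unfolding split by (rule card_Un_disjoint) (use less.prems(1) in auto)
      moreover have "card {q \<in> {u, v}. fst q = d} \<ge> 1" if "d = a \<or> d = b"
        using that ab by (auto simp: card_gt_0_iff Suc_le_eq)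
      ultimately show ?thesis using es(3)[of d] e(2) by (auto simp: degree_def)
    qed
    then show ?thesis using es e c by (intro exI[of _ "e # es"]) auto
  qed
qed

lemma pmatch_bij:
  assumes "bij_betw g A B" "A \<inter> B = {}" "\<And>x. x \<in> A \<Longrightarrow> (x, g x) \<in> E \<and> (g x, x) \<in> E"
  shows "pmatch (A \<union> B) E ({(x, g x) | x. x \<in> A} \<union> {(g x, x) | x. x \<in> A})"
proof (rule pmatchI)
  fix x assume "x \<in> A \<union> B"
  then show "\<exists>y. (x, y) \<in> {(x, g x) | x. x \<in> A} \<union> {(g x, x) | x. x \<in> A}"
    using assms(1) by (auto simp: bij_betw_def)
next
  have gB: "g x \<in> B" if "x \<in> A" for x using assms(1) that by (auto simp: bij_betw_def)
  fix x y z
  assume "(x, y) \<in> {(x, g x) | x. x \<in> A} \<union> {(g x, x) | x. x \<in> A}"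
    "(x, z) \<in> {(x, g x) | x. x \<in> A} \<union> {(g x, x) | x. x \<in> A}"
  then show "y = z" using assms(1,2) gB by (auto simp: bij_betw_def inj_on_def)
qed (use assms in \<open>auto simp: bij_betw_def\<close>)

text \<open>The vertices in \<open>U\<close> absorb the copies that are not matched among themselves.\<close>

lemma b_matching_iff:
  fixes A :: "'c set"
  assumes A: "finite A" and Ed: "Ed \<subseteq> A \<times> A" "irrefl Ed"
    and U: "finite U" "U \<inter> copies A cap = {}" "card U = card (copies A cap) - 2 * w"
    and w: "2 * w \<le> card (copies A cap)"
  defines "G \<equiv> copy_edges Ed cap \<union> (copies A cap \<times> U) \<union> (U \<times> copies A cap)"
  shows "matchable (copies A cap \<union> U) G \<longleftrightarrow>
    (\<exists>es. length es = w \<and> set es \<subseteq> Ed \<and> (\<forall>d \<in> A. degree es d \<le> cap d))"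
proof
  let ?R = "copies A cap"
  have fin: "finite ?R" by (rule finite_copies[OF A])
  have RE: "copy_edges Ed cap \<subseteq> ?R \<times> ?R" using Ed(1) by (auto simp: copy_edges_def copies_def)
  {
    assume "\<exists>es. length es = w \<and> set es \<subseteq> Ed \<and> (\<forall>d \<in> A. degree es d \<le> cap d)"
    then obtain Q where Q: "Q \<subseteq> ?R" "card Q = 2 * w" "matchable Q (copy_edges Ed cap)"
      using edges_to_matching[OF A _ Ed] by metis
    then obtain M where M: "pmatch Q (copy_edges Ed cap) M" by (auto simp: matchable_def)
    have "pmatch Q G M" by (rule pmatch_mono[OF M]) (use M in \<open>auto simp: pmatch_def G_def\<close>)
    \<comment> \<open>There are exactly as many absorbing vertices as unmatched copies, and every
      copy is adjacent to all of them, so any bijection will do.\<close>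
    moreover have "card (?R - Q) = card U" using Q fin U(3) by (simp add: card_Diff_subset finite_subset)
    then obtain g where g: "bij_betw g (?R - Q) U" using U(1) fin finite_same_card_bij by blast
    then have "(x, g x) \<in> G \<and> (g x, x) \<in> G" if "x \<in> ?R - Q" for x
      using that by (auto simp: G_def bij_betw_def)
    from pmatch_bij[OF g _ this] U(2) have "matchable ((?R - Q) \<union> U) G" by (auto simp: matchable_def)
    then obtain N where "pmatch ((?R - Q) \<union> U) G N" by (auto simp: matchable_def)
    ultimately have "pmatch (Q \<union> ((?R - Q) \<union> U)) G (M \<union> N)"
      by (rule pmatch_union) (use Q(1) U(2) in auto)
    moreover have "Q \<union> ((?R - Q) \<union> U) = ?R \<union> U" using Q(1) by auto
    ultimately show "matchable (?R \<union> U) G" by (auto simp: matchable_def)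
  }
  assume "matchable (?R \<union> U) G"
  then obtain M where M: "pmatch (?R \<union> U) G M" by (auto simp: matchable_def)
  define Q where "Q = {r \<in> ?R. \<exists>s \<in> ?R. (r, s) \<in> M}"
  have N: "pmatch Q (copy_edges Ed cap) {e \<in> M. fst e \<in> ?R \<and> snd e \<in> ?R}"
  proof (rule pmatchI)
    fix x y assume "(x, y) \<in> {e \<in> M. fst e \<in> ?R \<and> snd e \<in> ?R}"
    then show "(x, y) \<in> copy_edges Ed cap \<and> x \<in> Q \<and> (y, x) \<in> {e \<in> M. fst e \<in> ?R \<and> snd e \<in> ?R}"
      using pmatchD(1,2)[OF M, of x y] U(2) by (auto simp: Q_def G_def)
  qed (use pmatch_unique[OF M] in \<open>auto simp: Q_def\<close>)
  \<comment> \<open>Vertices of \<open>U\<close> are adjacent only to copies, so the matching maps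
    \<open>U\<close> onto the copies not matched among themselves; this fixes the size of
    \<open>Q\<close>.\<close>
  have "bij_betw (\<lambda>u. THE r. (u, r) \<in> M) U (?R - Q)"
  proof -
    have the: "(u, r) \<in> M \<Longrightarrow> (THE r. (u, r) \<in> M) = r" for u r
      using pmatch_unique[OF M] by blast
    have UR: "r \<in> ?R - Q" if "u \<in> U" "(u, r) \<in> M" for u r
    proof -
      have "(u, r) \<in> G" using pmatchD(2)[OF M that(2)] .
      then have "r \<in> ?R" using that(1) U(2) RE by (auto simp: G_def)
      moreover have "r \<notin> Q"
      proof
        assume "r \<in> Q"
        then obtain s where "s \<in> ?R" "(r, s) \<in> M" unfolding Q_def by blast
        then have "s = u" using pmatch_unique[OF M] pmatchD(1)[OF M that(2)] by blast
        then show False using \<open>s \<in> ?R\<close> that(1) U(2) by blast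
      qed
      ultimately show ?thesis by simp
    qed
    show ?thesis
    proof (rule bij_betwI')
      fix u u' assume "u \<in> U" "u' \<in> U"
      then obtain r r' where "(u, r) \<in> M" "(u', r') \<in> M" using pmatch_partner[OF M] by blast
      then show "((THE r. (u, r) \<in> M) = (THE r. (u', r) \<in> M)) = (u = u')"
        using the pmatchD(1)[OF M] pmatch_unique[OF M] by metis
    next
      fix u assume "u \<in> U"
      moreover from this obtain r where "(u, r) \<in> M" using pmatch_partner[OF M] by blast
      ultimately show "(THE r. (u, r) \<in> M) \<in> ?R - Q" using the UR by metis
    next
      fix r assume r: "r \<in> ?R - Q"
      then obtain u where u: "(r, u) \<in> M" "u \<in> ?R \<union> U" using pmatch_partner[OF M] pmatchD(4)[OF M] by blast
      then have "u \<in> U" using r by (auto simp: Q_def)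
      then show "\<exists>u \<in> U. r = (THE r. (u, r) \<in> M)" using the[OF pmatchD(1)[OF M u(1)]] by auto
    qed
  qed
  then have "card (?R - Q) = card U" by (metis bij_betw_same_card)
  moreover have QR: "Q \<subseteq> ?R" by (auto simp: Q_def)
  then have "card (?R - Q) = card ?R - card Q" "card Q \<le> card ?R"
    using fin by (auto simp: card_Diff_subset finite_subset card_mono)
  ultimately have "card Q = 2 * w" using U(3) w by simp
  moreover have "finite Q" using QR fin finite_subset by blast
  ultimately obtain es where es: "length es = w" "set es \<subseteq> Ed" "\<And>d. degree es d \<le> card {q \<in> Q. fst q = d}"
    using matching_to_edges[OF _ N Ed(2)] by auto
  have "card {q \<in> Q. fst q = d} \<le> cap d" for d
  proof -
    have "{q \<in> Q. fst q = d} \<subseteq> Pair d ` {..<cap d}" using QR by (auto simp: copies_def)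
    from surj_card_le[OF _ this] show ?thesis by simp
  qed
  then show "\<exists>es. length es = w \<and> set es \<subseteq> Ed \<and> (\<forall>d \<in> A. degree es d \<le> cap d)"
    using es order_trans by blast
qed

section \<open>Votes approving \<open>p\<close> as edges\<close>

definition p_votes :: "name vote list \<Rightarrow> name \<Rightarrow> name vote list" where
  "p_votes V p = filter (\<lambda>v. p \<in> set (take 3 v)) V"

definition edge3 :: "name \<Rightarrow> name vote \<Rightarrow> name \<times> name" where
  "edge3 p v = (let l = filter (\<lambda>c. c \<noteq> p) (take 3 v) in (hd l, hd (tl l)))"

text \<open>The points that rival \<open>c\<close> may still gain when all \<open>w\<close>
  manipulators approve \<open>p\<close>. Truncated subtraction hides a rival that is already out of
  reach; \<open>check_manipulation\<close> tests this separately.\<close>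

definition cap3 :: "name vote list \<Rightarrow> name \<Rightarrow> nat \<Rightarrow> name \<Rightarrow> nat" where
  "cap3 V p w c = score3 V p + w - score3 V c"

definition copy_list :: "name list \<Rightarrow> name vote list \<Rightarrow> name \<Rightarrow> nat \<Rightarrow> (name \<times> nat) list" where
  "copy_list C V p w = concat (map (\<lambda>c. map (\<lambda>i. (c, i)) [0..<cap3 V p w c]) (filter (\<lambda>c. c \<noteq> p) C))"

text \<open>\<open>copy_list\<close> contains no copy of \<open>p\<close>, so pairs with first
  component \<open>p\<close> are fresh vertices.\<close>

definition spare_list :: "name list \<Rightarrow> name vote list \<Rightarrow> name \<Rightarrow> nat \<Rightarrow> (name \<times> nat) list" where
  "spare_list C V p w = map (\<lambda>i. (p, i)) [0..<length (copy_list C V p w) - 2 * w]"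

definition manipulation_graph :: "name list \<Rightarrow> name vote list \<Rightarrow> name \<Rightarrow> nat \<Rightarrow> (name \<times> nat) edges" where
  "manipulation_graph C V p w =
     concat (map (\<lambda>e. concat (map (\<lambda>i. concat (map (\<lambda>j.
         [((fst e, i), (snd e, j)), ((snd e, j), (fst e, i))])
       [0..<cap3 V p w (snd e)])) [0..<cap3 V p w (fst e)])) (map (edge3 p) (p_votes V p))) @
     concat (map (\<lambda>r. concat (map (\<lambda>u. [(r, u), (u, r)]) (spare_list C V p w))) (copy_list C V p w))"

text \<open>The cases \<open>w = 0\<close>, no vote for \<open>p\<close>, and at most two candidates
  (where everyone is always approved) lie outside the edge picture. For \<open>r\<close> copies
  there are \<open>2 * (r - w)\<close> vertices in all; the artificial matching pairs the first
  half, of length \<open>h = r - w\<close>, with the second.\<close>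

definition check_manipulation :: "name list \<Rightarrow> name vote list \<Rightarrow> name \<Rightarrow> nat \<Rightarrow> bool" where
  "check_manipulation C V p w \<longleftrightarrow>
     (if w = 0 then wins3 C V p
      else p_votes V p \<noteq> [] \<and> (length C \<le> 2 \<or>
        (\<forall>c \<in> set C. score3 V c \<le> score3 V p + w) \<and> 2 * w \<le> length (copy_list C V p w) \<and>
        (let vs = copy_list C V p w @ spare_list C V p w; h = length (copy_list C V p w) - w in
           decide_matchable (length vs * (length vs + 2)) (zip (take h vs) (drop h vs))
             (manipulation_graph C V p w))))"

lemma FP_p_votes [FP_intros]: "FP V \<Longrightarrow> FP p \<Longrightarrow> FP (\<lambda>x. p_votes (V x) (p x))"
  by (rule FP_comp2[where g = p_votes]) (unfold p_votes_def, intro FP_intros)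

lemma FP_edge3 [FP_intros]: "FP p \<Longrightarrow> FP v \<Longrightarrow> FP (\<lambda>x. edge3 (p x) (v x))"
  by (rule FP_comp2[where g = edge3]) (unfold edge3_def, intro FP_intros)

lemma FP_cap3 [FP_intros]: "FP V \<Longrightarrow> FP p \<Longrightarrow> FP w \<Longrightarrow> FP c \<Longrightarrow> FP (\<lambda>x. cap3 (V x) (p x) (w x) (c x))"
  by (rule FP_comp4[where g = cap3]) (unfold cap3_def, intro FP_intros)

lemma FP_copy_list [FP_intros]:
  "FP C \<Longrightarrow> FP V \<Longrightarrow> FP p \<Longrightarrow> FP w \<Longrightarrow> FP (\<lambda>x. copy_list (C x) (V x) (p x) (w x))"
  by (rule FP_comp4[where g = copy_list]) (unfold copy_list_def, intro FP_intros)

lemma FP_spare_list [FP_intros]: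
  "FP C \<Longrightarrow> FP V \<Longrightarrow> FP p \<Longrightarrow> FP w \<Longrightarrow> FP (\<lambda>x. spare_list (C x) (V x) (p x) (w x))"
  by (rule FP_comp4[where g = spare_list]) (unfold spare_list_def, intro FP_intros)

lemma FP_manipulation_graph [FP_intros]:
  "FP C \<Longrightarrow> FP V \<Longrightarrow> FP p \<Longrightarrow> FP w \<Longrightarrow> FP (\<lambda>x. manipulation_graph (C x) (V x) (p x) (w x))"
  by (rule FP_comp4[where g = manipulation_graph]) (unfold manipulation_graph_def, intro FP_intros)

lemma FP_check_manipulation [FP_intros]:
  "FP C \<Longrightarrow> FP V \<Longrightarrow> FP p \<Longrightarrow> FP w \<Longrightarrow> FP (\<lambda>x. check_manipulation (C x) (V x) (p x) (w x))"
  by (rule FP_comp4[where g = check_manipulation]) (unfold check_manipulation_def, intro FP_intros)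

lemma score3_append: "score3 (V @ W) d = score3 V d + score3 W d"
  by (simp add: score3_def)

lemma edge3_cases:
  assumes "distinct v" "3 \<le> length v" "p \<in> set (take 3 v)"
  obtains a b where "edge3 p v = (a, b)" "a \<noteq> b" "a \<noteq> p" "b \<noteq> p" "set (take 3 v) = {p, a, b}"
proof -
  obtain x y z r where v: "v = x # y # z # r"
    using assms(2) by (metis Suc_le_length_iff numeral_3_eq_3)
  have t: "take 3 v = [x, y, z]" by (simp add: v numeral_3_eq_3)
  have d: "x \<noteq> y" "x \<noteq> z" "y \<noteq> z" using assms(1) v by auto
  consider "p = x" | "p = y" | "p = z" using assms(3) t by auto
  then show ?thesis
  proof cases
    case 1
    show ?thesis by (rule that[of y z]) (use 1 d t in \<open>auto simp: edge3_def\<close>)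
  next
    case 2
    show ?thesis by (rule that[of x z]) (use 2 d t in \<open>auto simp: edge3_def\<close>)
  next
    case 3
    show ?thesis by (rule that[of x y]) (use 3 d t in \<open>auto simp: edge3_def\<close>)
  qed
qed

section \<open>Correctness of the manipulation test\<close>

context
  fixes C :: "name list" and V :: "name vote list" and p :: name and w :: nat
  assumes C: "distinct C" "p \<in> set C" and V: "valid_votes C V"
begin

lemma vote:
  assumes "v \<in> set V" shows "distinct v" "set v = set C" "length v = length C"
proof -
  show v: "distinct v" "set v = set C" using V assms by (auto simp: valid_votes_def)
  show "length v = length C" using v C(1) by (metis distinct_card)
qed

definition winning :: "name vote list \<Rightarrow> bool" where
  "winning A \<longleftrightarrow> length A = w \<and> set A \<subseteq> set V \<and> wins3 C (V @ A) p"

text \<open>With \<open>w > 0\<close> some vote is cast, and its top candidate scores while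
  \<open>p\<close> stays at zero.\<close>

lemma winning_no_p_votes:
  assumes "winning A" "w > 0" shows "p_votes V p \<noteq> []"
proof
  assume "p_votes V p = []"
  then have no: "p \<notin> set (take 3 v)" if "v \<in> set V" for v
    using that by (auto simp: p_votes_def filter_empty_conv)
  have A: "set (V @ A) \<subseteq> set V" "A \<noteq> []" using assms by (auto simp: winning_def)
  then obtain v where v: "v \<in> set A" by (cases A) auto
  with A(1) have v: "v \<in> set A" "v \<in> set V" by auto
  have "v \<noteq> []" using vote(2)[OF v(2)] C(2) by auto
  then have "hd v \<in> set v" "hd v \<in> set (take 3 v)" by (cases v; simp)+
  then have c: "hd v \<in> set C" "hd v \<in> set (take 3 v)" using vote(2)[OF v(2)] by blast+
  have "filter (\<lambda>v. p \<in> set (take 3 v)) (V @ A) = []"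
    using no A(1) by (auto simp: filter_empty_conv)
  then have "score3 (V @ A) p = 0" unfolding score3_def by (simp only: list.size)
  moreover have "v \<in> set (filter (\<lambda>v. hd v' \<in> set (take 3 v)) (V @ A))" if "v' = v" for v'
    using that c(2) v(1) by simp
  then have "score3 (V @ A) (hd v) > 0"
    unfolding score3_def by (metis length_pos_if_in_set)
  ultimately show False using assms(1) c(1) unfolding winning_def wins3_def by (metis not_le)
qed

text \<open>Replacing a vote without \<open>p\<close> by one with \<open>p\<close> gives
  \<open>p\<close> a point and any rival at most one, so no rival gains on \<open>p\<close>.\<close>

lemma winning_p_votes:
  assumes "winning A" "p_votes V p \<noteq> []"
  shows "\<exists>A'. winning A' \<and> set A' \<subseteq> set (p_votes V p)"
proof -
  obtain v0 where v0: "v0 \<in> set (p_votes V p)" using assms(2) by (meson hd_in_set)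
  define f where "f v = (if p \<in> set (take 3 v) then v else v0)" for v
  have le: "score3 (map f A) d + score3 A p \<le> score3 (map f A) p + score3 A d" for A d
    using v0 by (induction A) (auto simp: score3_def f_def p_votes_def)
  have "wins3 C (V @ map f A) p"
    unfolding wins3_def score3_append
  proof
    fix d assume "d \<in> set C"
    then have "score3 V d + score3 A d \<le> score3 V p + score3 A p"
      using assms(1) by (simp add: winning_def wins3_def score3_append)
    then show "score3 V d + score3 (map f A) d \<le> score3 V p + score3 (map f A) p"
      using le[of A d] by linarith
  qed
  moreover have "set (map f A) \<subseteq> set (p_votes V p)"
    using assms(1) v0 by (auto simp: winning_def f_def p_votes_def)
  moreover have "set (p_votes V p) \<subseteq> set V" by (auto simp: p_votes_def)
  ultimately show ?thesis
    using assms(1) by (intro exI[of _ "map f A"]) (auto simp: winning_def)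
qed

lemma winning_few_candidates:
  assumes "length C \<le> 2" "p_votes V p \<noteq> []" shows "\<exists>A. winning A"
proof -
  obtain v0 where v0: "v0 \<in> set V" using assms(2) by (auto simp: p_votes_def filter_empty_conv)
  have all: "score3 W d = length W" if "set W \<subseteq> set V" "d \<in> set C" for W d
  proof -
    have "d \<in> set (take 3 v)" if "v \<in> set W" for v
      using vote[of v] that \<open>set W \<subseteq> set V\<close> \<open>d \<in> set C\<close> assms(1) by (simp add: subset_iff)
    then show ?thesis by (simp add: score3_def)
  qed
  have "set (V @ replicate w v0) \<subseteq> set V" using v0 by auto
  then have "wins3 C (V @ replicate w v0) p" using all C(2) by (simp add: wins3_def)
  then show ?thesis using v0 by (intro exI[of _ "replicate w v0"]) (auto simp: winning_def)
qed

lemma degree_edge3: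
  assumes "3 \<le> length C" "set A \<subseteq> set (p_votes V p)" "d \<noteq> p"
  shows "degree (map (edge3 p) A) d = score3 A d"
proof -
  have "fst (edge3 p v) = d \<or> snd (edge3 p v) = d \<longleftrightarrow> d \<in> set (take 3 v)" if "v \<in> set A" for v
  proof -
    have "v \<in> set V" "p \<in> set (take 3 v)" using that assms(2) by (auto simp: p_votes_def)
    then obtain a b where "edge3 p v = (a, b)" "set (take 3 v) = {p, a, b}"
      using edge3_cases[of v p] vote[of v] assms(1) by metis
    then show ?thesis using assms(3) by auto
  qed
  then show ?thesis by (simp add: degree_def score3_def filter_map comp_def cong: filter_cong)
qed

text \<open>When all manipulators approve \<open>p\<close>, its final score no longer depends on
  their votes. Every rival then has a fixed capacity, and each vote loads the two ends of its
  edge.\<close>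

lemma winning_iff_edges:
  assumes "3 \<le> length C" "p_votes V p \<noteq> []"
  shows "(\<exists>A. winning A) \<longleftrightarrow> (\<forall>c \<in> set C. score3 V c \<le> score3 V p + w) \<and>
    (\<exists>es. length es = w \<and> set es \<subseteq> edge3 p ` set (p_votes V p) \<and>
      (\<forall>d \<in> set C - {p}. degree es d \<le> cap3 V p w d))"
proof -
  have pA: "score3 A p = length A" if "set A \<subseteq> set (p_votes V p)" for A
    using that by (induction A) (auto simp: score3_def p_votes_def)
  have key: "winning A \<longleftrightarrow> (\<forall>c \<in> set C. score3 V c \<le> score3 V p + w) \<and>
      (\<forall>d \<in> set C - {p}. degree (map (edge3 p) A) d \<le> cap3 V p w d)"
    if A: "set A \<subseteq> set (p_votes V p)" "length A = w" for A
  proof -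
    have "set A \<subseteq> set V" using A(1) by (auto simp: p_votes_def)
    then have "winning A \<longleftrightarrow> (\<forall>d \<in> set C. score3 V d + score3 A d \<le> score3 V p + w)"
      using A(2) by (simp add: winning_def wins3_def score3_append pA[OF A(1)])
    also have "\<dots> \<longleftrightarrow> (\<forall>d \<in> set C. score3 V d \<le> score3 V p + w \<and> (d \<noteq> p \<longrightarrow> score3 A d \<le> cap3 V p w d))"
    proof (rule ball_cong[OF refl])
      fix d assume "d \<in> set C"
      show "score3 V d + score3 A d \<le> score3 V p + w \<longleftrightarrow>
          score3 V d \<le> score3 V p + w \<and> (d \<noteq> p \<longrightarrow> score3 A d \<le> cap3 V p w d)"
        using pA[OF A(1)] A(2) by (cases "d = p") (auto simp: cap3_def)
    qed
    also have "\<dots> \<longleftrightarrow> (\<forall>c \<in> set C. score3 V c \<le> score3 V p + w) \<and>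
      (\<forall>d \<in> set C - {p}. degree (map (edge3 p) A) d \<le> cap3 V p w d)"
      using degree_edge3[OF assms(1) A(1)] by auto
    finally show ?thesis .
  qed
  show ?thesis
  proof
    assume "\<exists>A. winning A"
    then obtain A where A: "winning A" "set A \<subseteq> set (p_votes V p)" using winning_p_votes assms(2) by blast
    then have "length A = w" by (simp add: winning_def)
    with key[OF A(2) this] A show "(\<forall>c \<in> set C. score3 V c \<le> score3 V p + w) \<and>
      (\<exists>es. length es = w \<and> set es \<subseteq> edge3 p ` set (p_votes V p) \<and>
        (\<forall>d \<in> set C - {p}. degree es d \<le> cap3 V p w d))"
      by (intro conjI exI[of _ "map (edge3 p) A"]) auto
  next
    assume *: "(\<forall>c \<in> set C. score3 V c \<le> score3 V p + w) \<and>
      (\<exists>es. length es = w \<and> set es \<subseteq> edge3 p ` set (p_votes V p) \<and>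
        (\<forall>d \<in> set C - {p}. degree es d \<le> cap3 V p w d))"
    then obtain es where es: "length es = w" "set es \<subseteq> edge3 p ` set (p_votes V p)"
        "\<forall>d \<in> set C - {p}. degree es d \<le> cap3 V p w d" by blast
    have "\<exists>A. set A \<subseteq> set (p_votes V p) \<and> map (edge3 p) A = es"
      using es(2)
    proof (induction es)
      case (Cons e es)
      then obtain A v where "set A \<subseteq> set (p_votes V p)" "map (edge3 p) A = es"
        "v \<in> set (p_votes V p)" "e = edge3 p v" by auto
      then show ?case by (intro exI[of _ "v # A"]) auto
    qed simp
    then obtain A where A: "set A \<subseteq> set (p_votes V p)" "map (edge3 p) A = es" by blast
    then have "length A = w" using es(1) by (metis length_map)
    with key[OF A(1) this] * es(3) A(2) show "\<exists>A. winning A" by blast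
  qed
qed

lemma distinct_copy_list: "distinct (copy_list C V p w)"
proof -
  have "distinct (concat (map (\<lambda>c. map (\<lambda>i. (c, i)) [0..<f c]) cs))" if "distinct cs" for f :: "name \<Rightarrow> nat" and cs
    using that by (induction cs) (auto simp: distinct_map inj_on_def)
  then show ?thesis using C(1) by (simp add: copy_list_def)
qed

lemma set_copy_list: "set (copy_list C V p w) = copies (set C - {p}) (cap3 V p w)"
  by (auto simp: copy_list_def copies_def)

lemma set_manipulation_graph:
  "set (manipulation_graph C V p w) =
     copy_edges (edge3 p ` set (p_votes V p)) (cap3 V p w) \<union>
     (copies (set C - {p}) (cap3 V p w) \<times> set (spare_list C V p w)) \<union>
     (set (spare_list C V p w) \<times> copies (set C - {p}) (cap3 V p w))"
proof -
  have 1: "set (concat (map (\<lambda>e. concat (map (\<lambda>i. concat (map (\<lambda>j.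
         [((fst e, i), (snd e, j)), ((snd e, j), (fst e, i))])
       [0..<f (snd e)])) [0..<f (fst e)])) es)) = copy_edges (set es) f" for f :: "name \<Rightarrow> nat" and es
  proof (rule set_eqI)
    fix x
    have "x \<in> set (concat (map (\<lambda>e. concat (map (\<lambda>i. concat (map (\<lambda>j.
         [((fst e, i), (snd e, j)), ((snd e, j), (fst e, i))])
       [0..<f (snd e)])) [0..<f (fst e)])) es)) \<longleftrightarrow>
      (\<exists>e \<in> set es. \<exists>i < f (fst e). \<exists>j < f (snd e).
        x = ((fst e, i), (snd e, j)) \<or> x = ((snd e, j), (fst e, i)))"
      by (simp add: Bex_def)
    also have "\<dots> \<longleftrightarrow> x \<in> copy_edges (set es) f"
      unfolding copy_edges_def Bex_def split_paired_Ex fst_conv snd_conv by blast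
    finally show "x \<in> set (concat (map (\<lambda>e. concat (map (\<lambda>i. concat (map (\<lambda>j.
         [((fst e, i), (snd e, j)), ((snd e, j), (fst e, i))])
       [0..<f (snd e)])) [0..<f (fst e)])) es)) \<longleftrightarrow> x \<in> copy_edges (set es) f" .
  qed
  have 2: "set (concat (map (\<lambda>r. concat (map (\<lambda>u. [(r, u), (u, r)]) us)) rs)) = set rs \<times> set us \<union> set us \<times> set rs"
    for rs us :: "(name \<times> nat) list" by auto
  show ?thesis
    unfolding manipulation_graph_def set_append 1 2 set_copy_list by (simp only: set_map Un_assoc)
qed

lemma check_manipulation_iff: "check_manipulation C V p w \<longleftrightarrow> (\<exists>A. winning A)"
proof (cases "w = 0 \<or> p_votes V p = [] \<or> length C \<le> 2")
  case True
  show ?thesis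
  proof (cases "w = 0")
    case True
    have "winning A \<longleftrightarrow> A = [] \<and> wins3 C V p" for A
      unfolding winning_def using True by auto
    then show ?thesis using True by (simp add: check_manipulation_def)
  next
    case False
    then show ?thesis
      using True winning_no_p_votes winning_few_candidates by (auto simp: check_manipulation_def)
  qed
next
  case False
  let ?R = "copy_list C V p w" and ?U = "spare_list C V p w"
  let ?cap = "cap3 V p w" and ?A = "set C - {p}" and ?Ed = "edge3 p ` set (p_votes V p)"
  let ?vs = "?R @ ?U" and ?h = "length ?R - w"
  let ?D = "zip (take ?h ?vs) (drop ?h ?vs)" and ?G = "manipulation_graph C V p w"
  have Ed: "?Ed \<subseteq> ?A \<times> ?A" "irrefl ?Ed"
  proof -
    have "\<exists>a b. edge3 p v = (a, b) \<and> a \<in> ?A \<and> b \<in> ?A \<and> a \<noteq> b" if "v \<in> set (p_votes V p)" for v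
    proof -
      have v: "v \<in> set V" "p \<in> set (take 3 v)" using that by (auto simp: p_votes_def)
      obtain a b where ab: "edge3 p v = (a, b)" "a \<noteq> b" "a \<noteq> p" "b \<noteq> p" "set (take 3 v) = {p, a, b}"
        using edge3_cases[of v p] vote[OF v(1)] v(2) False by (metis (no_types) not_less_eq_eq numeral_3_eq_3 numeral_2_eq_2)
      have "set (take 3 v) \<subseteq> set C" using set_take_subset vote(2)[OF v(1)] by metis
      then show ?thesis using ab by auto
    qed
    then show "?Ed \<subseteq> ?A \<times> ?A" "irrefl ?Ed" unfolding irrefl_def by (fastforce, metis imageE prod.inject)
  qed
  have U: "distinct ?U" "length ?U = length ?R - 2 * w" "set ?U \<inter> copies ?A ?cap = {}"
    by (auto simp: spare_list_def distinct_map inj_on_def copies_def)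
  have cardR: "card (copies ?A ?cap) = length ?R"
    using distinct_card[OF distinct_copy_list] by (simp add: set_copy_list)
  have distinct_vs: "distinct ?vs" using distinct_copy_list U(1,3) by (auto simp: set_copy_list)
  have eq: "decide_matchable (length ?vs * (length ?vs + 2)) ?D ?G \<longleftrightarrow>
      (\<exists>es. length es = w \<and> set es \<subseteq> ?Ed \<and> (\<forall>d \<in> ?A. degree es d \<le> ?cap d))"
    if w: "2 * w \<le> length ?R"
  proof -
    have len: "length (take ?h ?vs) = length (drop ?h ?vs)" using w U(2) by simp
    have fs: "map fst ?D = take ?h ?vs" "map snd ?D = drop ?h ?vs" using len by simp_all
    have g: "graph (set ?vs) (set ?G)"
      unfolding graph_def set_manipulation_graph
    proof (intro conjI)
      show "copy_edges ?Ed ?cap \<union> copies ?A ?cap \<times> set ?U \<union> set ?U \<times> copies ?A ?cap \<subseteq> set ?vs \<times> set ?vs"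
        using Ed(1) by (auto simp: set_copy_list copy_edges_def copies_def)
      show "Relation.sym (copy_edges ?Ed ?cap \<union> copies ?A ?cap \<times> set ?U \<union> set ?U \<times> copies ?A ?cap)"
        by (rule symI) (auto simp: copy_edges_def)
      show "irrefl (copy_edges ?Ed ?cap \<union> copies ?A ?cap \<times> set ?U \<union> set ?U \<times> copies ?A ?cap)"
        using U(3) Ed(2) unfolding irrefl_def by (auto simp: copy_edges_def)
    qed simp
    have "decide_matchable (length ?vs * (length ?vs + 2)) ?D ?G \<longleftrightarrow> matchable (set ?vs) (set ?G)"
    proof (rule decide_matchable_iff[OF g])
      show "distinct (map fst ?D @ map snd ?D)" unfolding fs using distinct_vs by (simp only: append_take_drop_id)
      have "fst ` set ?D \<union> snd ` set ?D = set (map fst ?D @ map snd ?D)" by simp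
      then show "set ?vs = fst ` set ?D \<union> snd ` set ?D" unfolding fs by (simp only: append_take_drop_id)
      show "card (set ?vs) * (card (set ?vs) + 2) \<le> length ?vs * (length ?vs + 2)"
        using distinct_card[OF distinct_vs] by simp
    qed
    also have "set ?vs = copies ?A ?cap \<union> set ?U" by (simp add: set_copy_list)
    also have "matchable (copies ?A ?cap \<union> set ?U) (set ?G) \<longleftrightarrow>
        (\<exists>es. length es = w \<and> set es \<subseteq> ?Ed \<and> (\<forall>d \<in> ?A. degree es d \<le> ?cap d))"
      unfolding set_manipulation_graph
      by (rule b_matching_iff[OF _ Ed]) (use U w cardR distinct_card[OF U(1)] in auto)
    finally show ?thesis .
  qed
  \<comment> \<open>The number of absorbing vertices uses truncated subtraction, so the equivalence
    \<open>eq\<close> assumes enough copies; \<open>w\<close> edges always occupy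
    \<open>2 * w\<close> of them.\<close>
  have "2 * w \<le> length ?R"
    if es: "length es = w" "set es \<subseteq> ?Ed" "\<forall>d \<in> ?A. degree es d \<le> ?cap d" for es
  proof -
    obtain Q where "Q \<subseteq> copies ?A ?cap" "card Q = 2 * length es"
      using edges_to_matching[OF _ es(2) Ed] es(3) by (metis finite_Diff finite_set)
    then show ?thesis using card_mono[OF finite_copies[of ?A ?cap]] es(1) cardR by (metis finite_Diff finite_set)
  qed
  with eq have "2 * w \<le> length ?R \<and> decide_matchable (length ?vs * (length ?vs + 2)) ?D ?G \<longleftrightarrow>
      (\<exists>es. length es = w \<and> set es \<subseteq> ?Ed \<and> (\<forall>d \<in> ?A. degree es d \<le> ?cap d))" by blast
  then show ?thesis
    using False winning_iff_edges by (simp add: check_manipulation_def Let_def)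
qed

lemma check_manipulation_correct:
  "check_manipulation C V p w \<longleftrightarrow>
     can_win_by_conformant_manipulation (approval_winners 3) (set C) (mset V) w p"
proof -
  have "winning A \<longleftrightarrow> length A = w \<and> set A \<subseteq> set_mset (mset V) \<and> p \<in> approval_winners 3 (set C) (mset V + mset A)" for A
    using wins3_iff[OF C(2), of "V @ A"] by (simp add: winning_def)
  then show ?thesis unfolding check_manipulation_iff can_win_by_conformant_manipulation_def by blast
qed

end

text \<open>What follows the name of \<open>p\<close> consists of one bit per manipulator and an end
  bit, hence the length minus one. Re-encoding rejects every other form of input.\<close>

definition check_conformant :: "bool list \<Rightarrow> bool" where
  "check_conformant x \<longleftrightarrow>
     (case dec_vote x of (C, x1) \<Rightarrow>
      case dec_votes x1 of (V, x2) \<Rightarrow>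
      case dec_word x2 of (p, x3) \<Rightarrow>
        x = enc_election C V @ enc_word p @ replicate (length x3 - 1) True @ [False] \<and>
        distinct C \<and> valid_votes C V \<and> p \<in> set C \<and> check_manipulation C V p (length x3 - 1))"

lemma FP_check_conformant: "FP check_conformant"
  unfolding check_conformant_def by (intro FP_intros FP_dec)

lemma check_conformant_iff: "x \<in> conformant_manipulation (approval_winners 3) \<longleftrightarrow> check_conformant x"
proof
  assume "x \<in> conformant_manipulation (approval_winners 3)"
  then obtain C V w p where x: "x = enc_election C V @ enc_word p @ replicate w True @ [False]"
    and valid: "distinct C" "set V \<subseteq> permutations_of_set (set C)" "p \<in> set C"
    and win: "can_win_by_conformant_manipulation (approval_winners 3) (set C) (mset V) w p"
    unfolding conformant_manipulation_def by blast
  from valid(2) have V: "valid_votes C V" by (simp add: valid_votes_iff)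
  show "check_conformant x"
    using check_manipulation_correct[OF valid(1,3) V, of w] win V valid
    by (simp add: x check_conformant_def enc_election_def)
next
  assume "check_conformant x"
  then obtain C V p w where x: "x = enc_election C V @ enc_word p @ replicate w True @ [False]"
    and v: "distinct C" "valid_votes C V" "p \<in> set C" and c: "check_manipulation C V p w"
    unfolding check_conformant_def by (auto split: prod.splits)
  from c have "can_win_by_conformant_manipulation (approval_winners 3) (set C) (mset V) w p"
    by (simp add: check_manipulation_correct[OF v(1,3,2)])
  then show "x \<in> conformant_manipulation (approval_winners 3)"
    unfolding conformant_manipulation_def mem_Collect_eq x
    using v unfolding valid_votes_iff by blast
qed

theorem conformant_in_P: "conformant_manipulation (approval_winners 3) \<in> class_P"
  by (rule FP_in_class_P) (simp add: check_conformant_iff FP_check_conformant)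


section \<open>Satisfiability is NP-hard\<close>

type_synonym var = "nat \<times> nat \<times> nat \<times> nat \<times> nat"
type_synonym clause = "(bool \<times> var) list"

definition satisfies :: "(var \<Rightarrow> bool) \<Rightarrow> clause list \<Rightarrow> bool" where
  "satisfies \<alpha> F \<longleftrightarrow> (\<forall>c \<in> set F. \<exists>l \<in> set c. \<alpha> (snd l) = fst l)"

definition satisfiable :: "clause list \<Rightarrow> bool" where
  "satisfiable F \<longleftrightarrow> (\<exists>\<alpha>. satisfies \<alpha> F)"

text \<open>The variables say: the state at time \<open>t\<close> is \<open>q\<close>; the head of tape \<open>j\<close> is at cell \<open>i\<close>; cell \<open>i\<close>
  of tape \<open>j\<close> contains \<open>s\<close>; the head of tape \<open>j\<close> reads \<open>s\<close>; the certificate has length \<open>l\<close>; its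
  \<open>i\<close>-th bit is set.\<close>

definition vS :: "nat \<Rightarrow> nat \<Rightarrow> var" where "vS t q = (0, t, q, 0, 0)"
definition vH :: "nat \<Rightarrow> nat \<Rightarrow> nat \<Rightarrow> var" where "vH t j i = (1, t, j, i, 0)"
definition vX :: "nat \<Rightarrow> nat \<Rightarrow> nat \<Rightarrow> nat \<Rightarrow> var" where "vX t j i s = (2, t, j, i, s)"
definition vR :: "nat \<Rightarrow> nat \<Rightarrow> nat \<Rightarrow> var" where "vR t j s = (3, t, j, s, 0)"
definition vL :: "nat \<Rightarrow> var" where "vL l = (4, l, 0, 0, 0)"
definition vY :: "nat \<Rightarrow> var" where "vY i = (5, i, 0, 0, 0)"

definition horn :: "var list \<Rightarrow> var \<Rightarrow> clause" where
  "horn vs v = map (\<lambda>u. (False, u)) vs @ [(True, v)]"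

lemma satisfies_append [simp]: "satisfies \<alpha> (F @ G) \<longleftrightarrow> satisfies \<alpha> F \<and> satisfies \<alpha> G"
  by (auto simp: satisfies_def)

lemma satisfies_Nil [simp]: "satisfies \<alpha> []"
  by (simp add: satisfies_def)

lemma satisfies_Cons: "satisfies \<alpha> (c # F) \<longleftrightarrow> (\<exists>l \<in> set c. \<alpha> (snd l) = fst l) \<and> satisfies \<alpha> F"
  by (auto simp: satisfies_def)

lemma satisfies_concat [simp]: "satisfies \<alpha> (concat Fs) \<longleftrightarrow> (\<forall>F \<in> set Fs. satisfies \<alpha> F)"
  by (auto simp: satisfies_def)

lemma satisfies_map: "satisfies \<alpha> (map f xs) \<longleftrightarrow> (\<forall>x \<in> set xs. \<exists>l \<in> set (f x). \<alpha> (snd l) = fst l)"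
  by (auto simp: satisfies_def)

lemma satisfied_horn [simp]: "(\<exists>l \<in> set (horn vs v). \<alpha> (snd l) = fst l) \<longleftrightarrow> ((\<forall>u \<in> set vs. \<alpha> u) \<longrightarrow> \<alpha> v)"
  by (auto simp: horn_def)

lemmas satisfies_simps = satisfies_Cons satisfies_map


subsection \<open>Runs of Turing machines\<close>

text \<open>Halting states are given explicit idle transitions, so the clauses treat all times
  alike.\<close>

definition delta :: "tm \<Rightarrow> nat \<Rightarrow> nat list \<Rightarrow> nat \<times> (nat \<times> int) list" where
  "delta M q xs = (if q \<in> {accept_state M, reject_state M} then (q, stay xs) else trans M q xs)"

definition state_at :: "tm \<Rightarrow> bool list \<Rightarrow> nat \<Rightarrow> nat" where
  "state_at M z t = fst (run M z t)"

definition cell_at :: "tm \<Rightarrow> bool list \<Rightarrow> nat \<Rightarrow> nat \<Rightarrow> int \<Rightarrow> nat" where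
  "cell_at M z t j = fst (snd (run M z t) ! j)"

definition head_at :: "tm \<Rightarrow> bool list \<Rightarrow> nat \<Rightarrow> nat \<Rightarrow> int" where
  "head_at M z t j = snd (snd (run M z t) ! j)"

definition read_at :: "tm \<Rightarrow> bool list \<Rightarrow> nat \<Rightarrow> nat list" where
  "read_at M z t = map (\<lambda>j. cell_at M z t j (head_at M z t j)) [0..<num_tapes M]"

lemma step_delta:
  "step M (q, ts) = (case delta M q (map (\<lambda>(t, h). t h) ts) of
     (q', acts) \<Rightarrow> (q', map2 (\<lambda>(t, h) (s, d). (t(h := s), h + d)) ts acts))"
  using map2_stay[of ts] by (simp add: step_def delta_def)

lemma run_Suc: "run M z (Suc t) = step M (run M z t)"
  by (simp add: run_def)

context
  fixes M :: tm and z :: "bool list"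
  assumes M: "wf_tm M"
begin

lemma wf_delta:
  assumes "q \<in> states M" "length xs = num_tapes M" "set xs \<subseteq> symbols M"
  shows "fst (delta M q xs) \<in> states M" "length (snd (delta M q xs)) = num_tapes M"
    "set (snd (delta M q xs)) \<subseteq> symbols M \<times> {-1, 0, 1}"
proof -
  have "fst (delta M q xs) \<in> states M \<and> length (snd (delta M q xs)) = num_tapes M \<and>
    set (snd (delta M q xs)) \<subseteq> symbols M \<times> {-1, 0, 1}"
  proof (cases "q \<in> {accept_state M, reject_state M}")
    case True
    then show ?thesis using assms by (auto simp: delta_def)
  next
    case False
    then show ?thesis using M assms unfolding wf_tm_def delta_def by simp
  qed
  then show "fst (delta M q xs) \<in> states M" "length (snd (delta M q xs)) = num_tapes M"
    "set (snd (delta M q xs)) \<subseteq> symbols M \<times> {-1, 0, 1}" by blast+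
qed

lemma run_0:
  "state_at M z 0 = start_state M"
  "j < num_tapes M \<Longrightarrow> head_at M z 0 j = 0"
  "cell_at M z 0 0 = fst (input_tape z)"
  "0 < j \<Longrightarrow> j < num_tapes M \<Longrightarrow> cell_at M z 0 j = (\<lambda>_. 0)"
proof -
  have 0: "run M z 0 = init_config M z" by (simp add: run_def)
  show "state_at M z 0 = start_state M" by (simp add: state_at_def 0 init_config_def)
  show "j < num_tapes M \<Longrightarrow> head_at M z 0 j = 0"
    by (cases j) (auto simp: head_at_def 0 init_config_def input_tape_def)
  show "cell_at M z 0 0 = fst (input_tape z)" by (simp add: cell_at_def 0 init_config_def)
  show "0 < j \<Longrightarrow> j < num_tapes M \<Longrightarrow> cell_at M z 0 j = (\<lambda>_. 0)"
    by (cases j) (auto simp: cell_at_def 0 init_config_def input_tape_def fun_eq_iff)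
qed

text \<open>A head moves at most one cell per step; this is what confines the run to a window linear
  in its duration.\<close>

lemma run_inv:
  "state_at M z t \<in> states M \<and> length (snd (run M z t)) = num_tapes M \<and>
     (\<forall>j < num_tapes M. \<bar>head_at M z t j\<bar> \<le> int t \<and> (\<forall>u. cell_at M z t j u \<in> symbols M)) \<and>
     state_at M z (Suc t) = fst (delta M (state_at M z t) (read_at M z t)) \<and>
     (\<forall>j < num_tapes M.
       cell_at M z (Suc t) j = (cell_at M z t j)(head_at M z t j := fst (snd (delta M (state_at M z t) (read_at M z t)) ! j)) \<and>
       head_at M z (Suc t) j = head_at M z t j + snd (snd (delta M (state_at M z t) (read_at M z t)) ! j))"
proof -
  let ?k = "num_tapes M"
  have step: "state_at M z (Suc t) = fst (delta M (state_at M z t) (read_at M z t)) \<and>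
      length (snd (run M z (Suc t))) = ?k \<and>
      (\<forall>j < ?k. cell_at M z (Suc t) j = (cell_at M z t j)(head_at M z t j := fst (snd (delta M (state_at M z t) (read_at M z t)) ! j)) \<and>
       head_at M z (Suc t) j = head_at M z t j + snd (snd (delta M (state_at M z t) (read_at M z t)) ! j))"
    if q: "state_at M z t \<in> states M" and len: "length (snd (run M z t)) = ?k"
      and sy: "\<forall>j < ?k. \<forall>u. cell_at M z t j u \<in> symbols M" for t
  proof -
    obtain q ts where r: "run M z t = (q, ts)" by fastforce
    have read: "map (\<lambda>(t, h). t h) ts = read_at M z t"
      using len by (intro nth_equalityI) (auto simp: read_at_def cell_at_def head_at_def r split: prod.splits)
    have "set (read_at M z t) \<subseteq> symbols M" "length (read_at M z t) = ?k" using sy by (auto simp: read_at_def)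
    from wf_delta(2)[OF q this(2,1)] obtain q' acts where d: "delta M q (read_at M z t) = (q', acts)" "length acts = ?k"
      by (cases "delta M q (read_at M z t)") (auto simp: state_at_def r)
    have s: "run M z (Suc t) = (q', map2 (\<lambda>(t, h) (s, d). (t(h := s), h + d)) ts acts)"
      unfolding run_Suc r step_delta read d(1) by simp
    show ?thesis
      using len d by (auto simp: state_at_def cell_at_def head_at_def s r split: prod.splits)
  qed
  have inv: "state_at M z t \<in> states M \<and> length (snd (run M z t)) = ?k \<and>
     (\<forall>j < ?k. \<bar>head_at M z t j\<bar> \<le> int t \<and> (\<forall>u. cell_at M z t j u \<in> symbols M))"
  proof (induction t)
    case 0
    have "cell_at M z 0 j u \<in> symbols M" if "j < ?k" for j u
      using run_0(3) run_0(4)[of j] that M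
      by (cases "j = 0") (auto simp: input_tape_def sym_def wf_tm_def)
    moreover have "start_state M \<in> states M" "?k \<ge> 1" using M by (auto simp: wf_tm_def)
    ultimately show ?case
      using run_0 by (simp add: run_def init_config_def)
  next
    case (Suc t)
    let ?d = "delta M (state_at M z t) (read_at M z t)"
    have sy: "set (read_at M z t) \<subseteq> symbols M" "length (read_at M z t) = ?k"
      using Suc by (auto simp: read_at_def)
    have q: "state_at M z t \<in> states M" using Suc by blast
    note wd = wf_delta[OF q sy(2,1)]
    have act: "fst (snd ?d ! j) \<in> symbols M \<and> \<bar>snd (snd ?d ! j)\<bar> \<le> 1" if "j < ?k" for j
    proof -
      have "snd ?d ! j \<in> set (snd ?d)" using wd(2) that by (intro nth_mem) simp
      then have "snd ?d ! j \<in> symbols M \<times> {-1, 0, 1}" by (rule subsetD[OF wd(3)])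
      then show ?thesis by (cases "snd ?d ! j") auto
    qed
    have "\<forall>j < ?k. \<forall>u. cell_at M z t j u \<in> symbols M" using Suc by blast
    note st = step[OF q _ this]
    show ?case
    proof (intro conjI allI impI)
      show "state_at M z (Suc t) \<in> states M" "length (snd (run M z (Suc t))) = ?k"
        using st Suc wd(1) by simp_all
      fix j assume j: "j < ?k"
      have "\<bar>head_at M z t j\<bar> \<le> int t" "head_at M z (Suc t) j = head_at M z t j + snd (snd ?d ! j)"
        using st Suc j by blast+
      then show "\<bar>head_at M z (Suc t) j\<bar> \<le> int (Suc t)" using act[OF j] by linarith
      fix u
      have "cell_at M z (Suc t) j = (cell_at M z t j)(head_at M z t j := fst (snd ?d ! j))"
        using st Suc j by blast
      then show "cell_at M z (Suc t) j u \<in> symbols M" using act[OF j] Suc j by simp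
    qed
  qed
  then show ?thesis using step[of t] by blast
qed

end

lemma run_halted:
  assumes "fst (run M z n) \<in> {accept_state M, reject_state M}"
  shows "run M z (n + m) = run M z n"
proof (induction m)
  case (Suc m)
  then show ?case using assms by (cases "run M z n") (auto simp: run_Suc step_def)
qed simp


subsection \<open>The formula of a computation\<close>

definition state_list :: "tm \<Rightarrow> nat list" where
  "state_list M = sorted_list_of_set (states M)"

definition symbol_list :: "tm \<Rightarrow> nat list" where
  "symbol_list M = sorted_list_of_set (symbols M)"

text \<open>The table depends on \<open>M\<close> alone and is thus a constant for the reduction.
  Movements are shifted by one to become natural numbers.\<close>

definition table :: "tm \<Rightarrow> (nat \<times> nat list \<times> nat \<times> (nat \<times> nat) list) list" where
  "table M = concat (map (\<lambda>q. map (\<lambda>xs.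
       (q, xs, fst (delta M q xs), map (\<lambda>(s, d). (s, nat (d + 1))) (snd (delta M q xs))))
     (List.n_lists (num_tapes M) (symbol_list M))) (state_list M))"

text \<open>Cell \<open>i\<close> of a window stands for position \<open>i - o\<close> of the tape, where \<open>o = T + 1\<close> and \<open>T\<close> bounds
  the time. The clauses are Horn clauses apart from the guess of the certificate.\<close>

definition start_clauses :: "tm \<Rightarrow> nat \<Rightarrow> bool list \<Rightarrow> clause list" where
  "start_clauses M T e =
     [[(True, vS 0 (start_state M))]] @
     map (\<lambda>j. [(True, vH 0 j (T + 1))]) [0..<num_tapes M] @
     concat (map (\<lambda>j. map (\<lambda>i. [(True, vX 0 j i 0)]) [0..<2 * T + 3]) [1..<num_tapes M]) @
     map (\<lambda>i. [(True, vX 0 0 i 0)]) [0..<T + 1] @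
     map (\<lambda>a. [(True, vX 0 0 (T + 1 + fst a) (if snd a then 2 else 1))]) (zip [0..<length e] e)"

text \<open>As in \<open>enc_word\<close>, symbol 2 at an even offset from \<open>b\<close>
  announces another bit, and odd offsets hold the guessed bits. Several \<open>vL l\<close> may be
  true at once; soundness works with any one of them.\<close>

definition certificate_clauses :: "nat \<Rightarrow> nat \<Rightarrow> nat \<Rightarrow> clause list" where
  "certificate_clauses P b W =
     [map (\<lambda>l. (True, vL l)) [0..<Suc P]] @
     concat (map (\<lambda>l.
       concat (map (\<lambda>i.
         [horn [vL l] (vX 0 0 (b + 2 * i) 2),
          horn [vL l, vY i] (vX 0 0 (b + 2 * i + 1) 2),
          [(False, vL l), (True, vY i), (True, vX 0 0 (b + 2 * i + 1) 1)]]) [0..<l]) @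
       [horn [vL l] (vX 0 0 (b + 2 * l) 1)] @
       map (\<lambda>i. horn [vL l] (vX 0 0 i 0)) [b + 2 * l + 1..<W]) [0..<Suc P])"

text \<open>The variables \<open>vR\<close> separate the tapes: a transition refers to the symbols
  read and not to every tuple of head positions.\<close>

definition read_clauses :: "tm \<Rightarrow> nat \<Rightarrow> nat \<Rightarrow> clause list" where
  "read_clauses M W t =
     concat (map (\<lambda>j. concat (map (\<lambda>i. map (\<lambda>s.
       horn [vH t j i, vX t j i s] (vR t j s)) (symbol_list M)) [0..<W])) [0..<num_tapes M])"

definition inertia_clauses :: "tm \<Rightarrow> nat \<Rightarrow> nat \<Rightarrow> clause list" where
  "inertia_clauses M W t =
     concat (map (\<lambda>j. concat (map (\<lambda>i. concat (map (\<lambda>i'.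
       if i = i' then [] else map (\<lambda>s. horn [vH t j i', vX t j i s] (vX (Suc t) j i s)) (symbol_list M))
     [0..<W])) [0..<W])) [0..<num_tapes M])"

definition transition_clauses :: "tm \<Rightarrow> nat \<Rightarrow> nat \<Rightarrow> clause list" where
  "transition_clauses M W t =
     concat (map (\<lambda>e.
       let q = fst e; xs = fst (snd e); q' = fst (snd (snd e)); acts = snd (snd (snd e));
           ps = vS t q # map (\<lambda>a. vR t (fst a) (snd a)) (zip [0..<num_tapes M] xs) in
       horn ps (vS (Suc t) q') #
       concat (map (\<lambda>a. concat (map (\<lambda>i.
         [horn (vH t (fst a) i # ps) (vH (Suc t) (fst a) (i + snd (snd a) - 1)),
          horn (vH t (fst a) i # ps) (vX (Suc t) (fst a) i (fst (snd a)))]) [0..<W]))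
         (zip [0..<num_tapes M] acts))) (table M))"

definition final_clauses :: "tm \<Rightarrow> nat \<Rightarrow> clause list" where
  "final_clauses M T = map (\<lambda>q. [(False, vS T q)]) (filter (\<lambda>q. q \<noteq> accept_state M) (state_list M))"

definition formula :: "tm \<Rightarrow> nat \<Rightarrow> nat \<Rightarrow> bool list \<Rightarrow> clause list" where
  "formula M P T x =
     start_clauses M T (enc_word x) @
     certificate_clauses P (T + 1 + length (enc_word x)) (2 * T + 3) @
     concat (map (\<lambda>t. read_clauses M (2 * T + 3) t @ inertia_clauses M (2 * T + 3) t @
       transition_clauses M (2 * T + 3) t) [0..<T]) @
     final_clauses M T"

lemma FP_horn [FP_intros]: "FP a \<Longrightarrow> FP b \<Longrightarrow> FP (\<lambda>x. horn (a x) (b x))"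
  by (rule FP_comp2[where g = horn]) (unfold horn_def, intro FP_intros)

lemma FP_formula [FP_intros]:
  assumes "FP P" "FP T" "FP f"
  shows "FP (\<lambda>x. formula M (P x) (T x) (f x))"
  by (rule FP_comp3[where g = "formula M", OF _ assms])
    (unfold formula_def start_clauses_def certificate_clauses_def read_clauses_def inertia_clauses_def
      transition_clauses_def final_clauses_def vS_def vH_def vX_def vR_def vL_def vY_def, intro FP_intros)

lemma table_complete:
  assumes M: "wf_tm M" and "q \<in> states M" "length xs = num_tapes M" "set xs \<subseteq> symbols M"
  shows "(q, xs, fst (delta M q xs), map (\<lambda>(s, d). (s, nat (d + 1))) (snd (delta M q xs))) \<in> set (table M)"
proof -
  have "set (state_list M) = states M" "set (symbol_list M) = symbols M"
    using M by (auto simp: state_list_def symbol_list_def wf_tm_def)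
  then have "q \<in> set (state_list M)" "xs \<in> set (List.n_lists (num_tapes M) (symbol_list M))"
    using assms by (auto simp: set_n_lists)
  then show ?thesis unfolding table_def by auto
qed

lemma table_sound:
  assumes "(q, xs, q', acts) \<in> set (table M)"
  shows "q' = fst (delta M q xs)" "acts = map (\<lambda>(s, d). (s, nat (d + 1))) (snd (delta M q xs))" "length xs = num_tapes M"
  using assms unfolding table_def by (auto simp: set_n_lists)

lemma enc_word_append: "enc_word (b # w) = True # b # enc_word w"
  by (simp add: enc_word_def enc_list_def)

lemma enc_word_Nil: "enc_word [] = [False]"
  by (simp add: enc_word_def enc_list_def)

lemma length_enc_word: "length (enc_word w) = 2 * length w + 1"
  by (induction w) (auto simp: enc_word_append enc_word_Nil)

lemma nth_enc_word:
  "i < length w \<Longrightarrow> enc_word w ! (2 * i) = True" "i < length w \<Longrightarrow> enc_word w ! (2 * i + 1) = w ! i"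
  "enc_word w ! (2 * length w) = False"
proof -
  have "(i < length w \<longrightarrow> enc_word w ! (2 * i) = True \<and> enc_word w ! (2 * i + 1) = w ! i) \<and> enc_word w ! (2 * length w) = False"
    by (induction w arbitrary: i) (auto simp: enc_word_append enc_word_Nil nth_Cons split: nat.splits)
  then show "i < length w \<Longrightarrow> enc_word w ! (2 * i) = True" "i < length w \<Longrightarrow> enc_word w ! (2 * i + 1) = w ! i"
  "enc_word w ! (2 * length w) = False" by blast+
qed

lemma set_zip_upt: "set (zip [0..<n] xs) = (\<lambda>i. (i, xs ! i)) ` {i. i < n \<and> i < length xs}"
  by (force simp: set_zip image_iff)

lemma satisfies_start:
  "satisfies \<alpha> (start_clauses M T e) \<longleftrightarrow>
     \<alpha> (vS 0 (start_state M)) \<and> (\<forall>j < num_tapes M. \<alpha> (vH 0 j (T + 1))) \<and>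
     (\<forall>j. 1 \<le> j \<and> j < num_tapes M \<longrightarrow> (\<forall>i < 2 * T + 3. \<alpha> (vX 0 j i 0))) \<and>
     (\<forall>i < T + 1. \<alpha> (vX 0 0 i 0)) \<and>
     (\<forall>i < length e. \<alpha> (vX 0 0 (T + 1 + i) (if e ! i then 2 else 1)))"
  unfolding start_clauses_def by (auto simp: satisfies_simps set_zip_upt simp del: upt_Suc)

lemma satisfies_certificate:
  "satisfies \<alpha> (certificate_clauses P b W) \<longleftrightarrow>
     (\<exists>l \<le> P. \<alpha> (vL l)) \<and>
     (\<forall>l \<le> P. \<alpha> (vL l) \<longrightarrow>
       (\<forall>i < l. \<alpha> (vX 0 0 (b + 2 * i) 2) \<and> \<alpha> (vX 0 0 (b + 2 * i + 1) (if \<alpha> (vY i) then 2 else 1))) \<and>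
       \<alpha> (vX 0 0 (b + 2 * l) 1) \<and> (\<forall>i. b + 2 * l + 1 \<le> i \<and> i < W \<longrightarrow> \<alpha> (vX 0 0 i 0)))"
proof -
  have le: "l \<in> set [0..<Suc P] \<longleftrightarrow> l \<le> P" for l by auto
  have 1: "satisfies \<alpha> [map (\<lambda>l. (True, vL l)) [0..<Suc P]] \<longleftrightarrow> (\<exists>l \<le> P. \<alpha> (vL l))"
    by (auto simp: satisfies_simps less_Suc_eq_le simp del: upt_Suc)
  have 2: "satisfies \<alpha> (concat (map (\<lambda>i.
         [horn [vL l] (vX 0 0 (b + 2 * i) 2),
          horn [vL l, vY i] (vX 0 0 (b + 2 * i + 1) 2),
          [(False, vL l), (True, vY i), (True, vX 0 0 (b + 2 * i + 1) 1)]]) [0..<l]) @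
       [horn [vL l] (vX 0 0 (b + 2 * l) 1)] @
       map (\<lambda>i. horn [vL l] (vX 0 0 i 0)) [b + 2 * l + 1..<W]) \<longleftrightarrow>
     (\<alpha> (vL l) \<longrightarrow>
       (\<forall>i < l. \<alpha> (vX 0 0 (b + 2 * i) 2) \<and> \<alpha> (vX 0 0 (b + 2 * i + 1) (if \<alpha> (vY i) then 2 else 1))) \<and>
       \<alpha> (vX 0 0 (b + 2 * l) 1) \<and> (\<forall>i. b + 2 * l + 1 \<le> i \<and> i < W \<longrightarrow> \<alpha> (vX 0 0 i 0)))" for l
    by (cases "\<alpha> (vL l)") (auto simp: satisfies_simps)
  show ?thesis
    unfolding certificate_clauses_def satisfies_append[of _ "[_]"] satisfies_concat set_map ball_simps 1 2
    using le by blast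
qed

lemma set_symbol_list: "wf_tm M \<Longrightarrow> set (symbol_list M) = symbols M"
  by (simp add: symbol_list_def wf_tm_def)

lemma satisfies_read:
  "wf_tm M \<Longrightarrow> satisfies \<alpha> (read_clauses M W t) \<longleftrightarrow>
     (\<forall>j < num_tapes M. \<forall>i < W. \<forall>s \<in> symbols M. \<alpha> (vH t j i) \<and> \<alpha> (vX t j i s) \<longrightarrow> \<alpha> (vR t j s))"
  unfolding read_clauses_def by (auto simp: satisfies_simps set_symbol_list)

lemma satisfies_inertia:
  "wf_tm M \<Longrightarrow> satisfies \<alpha> (inertia_clauses M W t) \<longleftrightarrow>
     (\<forall>j < num_tapes M. \<forall>i < W. \<forall>i' < W. i \<noteq> i' \<longrightarrow>
       (\<forall>s \<in> symbols M. \<alpha> (vH t j i') \<and> \<alpha> (vX t j i s) \<longrightarrow> \<alpha> (vX (Suc t) j i s)))"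
  unfolding inertia_clauses_def by (auto simp: satisfies_simps set_symbol_list split: if_splits)

lemma satisfies_transition:
  "satisfies \<alpha> (transition_clauses M W t) \<longleftrightarrow>
     (\<forall>(q, xs, q', acts) \<in> set (table M).
       \<alpha> (vS t q) \<and> (\<forall>j < num_tapes M. \<alpha> (vR t j (xs ! j))) \<longrightarrow>
       \<alpha> (vS (Suc t) q') \<and>
       (\<forall>a \<in> set (zip [0..<num_tapes M] acts). \<forall>i < W. \<alpha> (vH t (fst a) i) \<longrightarrow>
         \<alpha> (vH (Suc t) (fst a) (i + snd (snd a) - 1)) \<and> \<alpha> (vX (Suc t) (fst a) i (fst (snd a)))))"
proof -
  have 1: "(\<forall>a \<in> set (zip [0..<num_tapes M] xs). \<alpha> (vR t (fst a) (snd a))) \<longleftrightarrow>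
      (\<forall>j < num_tapes M. \<alpha> (vR t j (xs ! j)))" if "(q, xs, r) \<in> set (table M)" for q xs r
    using table_sound(3)[of q xs "fst r" "snd r" M] that by (auto simp: set_zip_upt)
  have 2: "satisfies \<alpha> (let q = fst e; xs = fst (snd e); q' = fst (snd (snd e)); acts = snd (snd (snd e));
           ps = vS t q # map (\<lambda>a. vR t (fst a) (snd a)) (zip [0..<num_tapes M] xs) in
       horn ps (vS (Suc t) q') #
       concat (map (\<lambda>a. concat (map (\<lambda>i.
         [horn (vH t (fst a) i # ps) (vH (Suc t) (fst a) (i + snd (snd a) - 1)),
          horn (vH t (fst a) i # ps) (vX (Suc t) (fst a) i (fst (snd a)))]) [0..<W]))
         (zip [0..<num_tapes M] acts))) \<longleftrightarrow>
     (case e of (q, xs, q', acts) \<Rightarrow> \<alpha> (vS t q) \<and> (\<forall>j < num_tapes M. \<alpha> (vR t j (xs ! j))) \<longrightarrow>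
       \<alpha> (vS (Suc t) q') \<and>
       (\<forall>a \<in> set (zip [0..<num_tapes M] acts). \<forall>i < W. \<alpha> (vH t (fst a) i) \<longrightarrow>
         \<alpha> (vH (Suc t) (fst a) (i + snd (snd a) - 1)) \<and> \<alpha> (vX (Suc t) (fst a) i (fst (snd a)))))"
    if e: "e \<in> set (table M)" for e
  proof -
    obtain q xs q' acts where e': "e = (q, xs, q', acts)" by (metis prod.exhaust)
    define ps where "ps = vS t q # map (\<lambda>a. vR t (fst a) (snd a)) (zip [0..<num_tapes M] xs)"
    define Q where "Q \<longleftrightarrow> \<alpha> (vS t q) \<and> (\<forall>j < num_tapes M. \<alpha> (vR t j (xs ! j)))"
    have ps: "(\<forall>u \<in> set ps. \<alpha> u) \<longleftrightarrow> Q"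
      unfolding Q_def 1[OF e[unfolded e'], symmetric] by (simp add: ps_def)
    show ?thesis
      unfolding e' Let_def fst_conv snd_conv prod.case ps_def[symmetric] Q_def[symmetric]
        satisfies_Cons satisfied_horn ps satisfies_concat set_map ball_simps
      by (cases Q) (auto simp: ps)
  qed
  show ?thesis
    unfolding transition_clauses_def satisfies_concat set_map ball_simps using 2 by (rule ball_cong[OF refl])
qed

lemma satisfies_final:
  "wf_tm M \<Longrightarrow> satisfies \<alpha> (final_clauses M T) \<longleftrightarrow>
     (\<forall>q \<in> states M. q \<noteq> accept_state M \<longrightarrow> \<not> \<alpha> (vS T q))"
  unfolding final_clauses_def by (auto simp: satisfies_simps state_list_def wf_tm_def)

lemma satisfies_formula:
  "satisfies \<alpha> (formula M P T x) \<longleftrightarrow>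
     satisfies \<alpha> (start_clauses M T (enc_word x)) \<and>
     satisfies \<alpha> (certificate_clauses P (T + 1 + length (enc_word x)) (2 * T + 3)) \<and>
     (\<forall>t < T. satisfies \<alpha> (read_clauses M (2 * T + 3) t) \<and> satisfies \<alpha> (inertia_clauses M (2 * T + 3) t) \<and>
       satisfies \<alpha> (transition_clauses M (2 * T + 3) t)) \<and>
     satisfies \<alpha> (final_clauses M T)"
  unfolding formula_def by (auto simp del: upt_Suc)

text \<open>The regions of the initial window, in the form in which \<open>start_clauses\<close> and
  \<open>certificate_clauses\<close> prescribe them.\<close>

lemma input_cell:
  fixes x y and T :: nat
  defines "e \<equiv> enc_word x" and "l \<equiv> length y"
  defines "c \<equiv> (\<lambda>i :: nat. fst (input_tape (enc_word x @ enc_word y)) (int i - (int T + 1)))"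
  shows "i < T + 1 \<Longrightarrow> c i = 0" "m < length e \<Longrightarrow> c (T + 1 + m) = sym (e ! m)"
    "m < l \<Longrightarrow> c (T + 1 + length e + 2 * m) = 2" "m < l \<Longrightarrow> c (T + 1 + length e + 2 * m + 1) = sym (y ! m)"
    "c (T + 1 + length e + 2 * l) = 1" "T + 1 + length e + 2 * l + 1 \<le> i \<Longrightarrow> c i = 0"
proof -
  have c: "c (T + 1 + m) = (if m < length e + (2 * l + 1) then sym ((e @ enc_word y) ! m) else 0)" for m
    by (simp add: c_def input_tape_def e_def l_def length_enc_word)
  have sh: "(e @ enc_word y) ! (length e + m) = enc_word y ! m" for m by simp
  show "i < T + 1 \<Longrightarrow> c i = 0" by (simp add: c_def input_tape_def)
  show "m < length e \<Longrightarrow> c (T + 1 + m) = sym (e ! m)" using c[of m] by (simp add: nth_append)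
  show "m < l \<Longrightarrow> c (T + 1 + length e + 2 * m) = 2"
    using c[of "length e + 2 * m"] nth_enc_word(1)[of m y] by (simp add: l_def add.assoc)
  show "m < l \<Longrightarrow> c (T + 1 + length e + 2 * m + 1) = sym (y ! m)"
    using c[of "length e + (2 * m + 1)"] nth_enc_word(2)[of m y] by (simp add: l_def add.assoc nth_append)
  show "c (T + 1 + length e + 2 * l) = 1"
    using c[of "length e + 2 * l"] nth_enc_word(3)[of y] by (simp add: l_def add.assoc)
  show "T + 1 + length e + 2 * l + 1 \<le> i \<Longrightarrow> c i = 0"
    using c[of "i - (T + 1)"] by simp
qed

text \<open>The clauses derive every fact of the actual run, while an assignment may make further
  variables true. Only \<open>final_clauses\<close> forbid anything: the actual state at time
  \<open>T\<close> is derived as true, so it must be the accepting one.\<close>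

lemma formula_sound:
  assumes M: "wf_tm M" and sat: "satisfies \<alpha> (formula M P T x)"
  shows "\<exists>y. length y \<le> P \<and> state_at M (enc_word x @ enc_word y) T = accept_state M"
proof -
  let ?k = "num_tapes M" and ?W = "2 * T + 3" and ?e = "enc_word x"
  let ?b = "T + 1 + length ?e"
  note sat = sat[unfolded satisfies_formula]
  note start = conjunct1[OF sat, unfolded satisfies_start]
    and certificate = conjunct1[OF conjunct2[OF sat], unfolded satisfies_certificate]
    and final = conjunct2[OF conjunct2[OF conjunct2[OF sat]], unfolded satisfies_final[OF M]]
  have steps: "satisfies \<alpha> (read_clauses M ?W t)" "satisfies \<alpha> (inertia_clauses M ?W t)"
    "satisfies \<alpha> (transition_clauses M ?W t)" if "t < T" for t
    using conjunct1[OF conjunct2[OF conjunct2[OF sat]]] that by simp_all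
  note read = steps(1)[unfolded satisfies_read[OF M], rule_format]
    and inertia = steps(2)[unfolded satisfies_inertia[OF M], rule_format]
  from conjunct1[OF certificate] obtain l where l: "l \<le> P" "\<alpha> (vL l)" by blast
  define y where "y = map (\<lambda>i. \<alpha> (vY i)) [0..<l]"
  define z where "z = ?e @ enc_word y"
  have ly: "length y = l" by (simp add: y_def)
  define H where "H t j = nat (head_at M z t j + (int T + 1))" for t j
  define X where "X t j i = cell_at M z t j (int i - (int T + 1))" for t j i
  note inv = run_inv[OF M, of z]
  have cert: "(\<forall>i < l. \<alpha> (vX 0 0 (?b + 2 * i) 2) \<and> \<alpha> (vX 0 0 (?b + 2 * i + 1) (if \<alpha> (vY i) then 2 else 1))) \<and>
       \<alpha> (vX 0 0 (?b + 2 * l) 1) \<and> (\<forall>i. ?b + 2 * l + 1 \<le> i \<and> i < ?W \<longrightarrow> \<alpha> (vX 0 0 i 0))"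
    using conjunct2[OF certificate] l by simp
  have X0: "\<alpha> (vX 0 0 i (X 0 0 i))" if i: "i < ?W" for i
  proof -
    have X: "X 0 0 i = fst (input_tape (?e @ enc_word y)) (int i - (int T + 1))"
      using run_0(3)[OF M, of z] by (simp add: X_def z_def)
    consider "i < T + 1" | m where "i = T + 1 + m" "m < length ?e" | m where "i = ?b + 2 * m" "m < l"
      | m where "i = ?b + 2 * m + 1" "m < l" | "i = ?b + 2 * l" | "?b + 2 * l + 1 \<le> i"
    proof -
      have "(\<exists>m. i = T + 1 + m \<and> m < length ?e)" if "T + 1 \<le> i" "i < ?b"
        using that by (intro exI[of _ "i - (T + 1)"]) auto
      moreover have "(\<exists>m < l. i = ?b + 2 * m \<or> i = ?b + 2 * m + 1)" if "?b \<le> i" "i < ?b + 2 * l"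
        using that by (intro exI[of _ "(i - ?b) div 2"]) auto
      ultimately show ?thesis using that by (metis not_less Suc_eq_plus1 less_Suc_eq_le le_antisym)
    qed
    then show ?thesis
    proof cases
      case 1
      then show ?thesis using start input_cell(1)[where x = x and y = y and T = T and i = i] X by simp
    next
      case (2 m)
      then have "\<alpha> (vX 0 0 (T + 1 + m) (if ?e ! m then 2 else 1))" using start by simp
      moreover have "X 0 0 i = (if ?e ! m then 2 else 1)" using input_cell(2)[where x = x and y = y and T = T and m = m] X 2 by (simp add: sym_def)
      ultimately show ?thesis using 2 by simp
    next
      case (3 m)
      then show ?thesis using cert input_cell(3)[where x = x and y = y and T = T and m = m] X ly by auto
    next
      case (4 m)
      have "y ! m = \<alpha> (vY m)" using 4 by (simp add: y_def)
      then show ?thesis using cert input_cell(4)[where x = x and y = y and T = T and m = m] X ly 4 by (auto simp: sym_def)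
    next
      case 5
      then show ?thesis using cert input_cell(5)[where x = x and y = y and T = T] X ly by auto
    next
      case 6
      then show ?thesis using cert input_cell(6)[where x = x and y = y and T = T and i = i] X ly i by auto
    qed
  qed
  have main: "\<alpha> (vS t (state_at M z t)) \<and> (\<forall>j < ?k. \<alpha> (vH t j (H t j)) \<and> (\<forall>i < ?W. \<alpha> (vX t j i (X t j i))))"
    if "t \<le> T" for t
    using that
  proof (induction t)
    case 0
    have "H 0 j = T + 1" if "j < ?k" for j using run_0(2)[OF M that, of z] by (simp add: H_def)
    moreover have "\<alpha> (vX 0 j i (X 0 j i))" if "j < ?k" "i < ?W" for j i
    proof (cases "j = 0")
      case False
      then have "X 0 j i = 0" using run_0(4)[OF M, of j z] that by (simp add: X_def)
      then show ?thesis using start that False by simp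
    qed (use X0 that in simp)
    ultimately show ?case using start run_0(1)[OF M, of z] by simp
  next
    case (Suc t)
    then have t: "t < T" and S: "\<alpha> (vS t (state_at M z t))" and Hs: "\<And>j. j < ?k \<Longrightarrow> \<alpha> (vH t j (H t j))"
      and Xs: "\<And>j i. j < ?k \<Longrightarrow> i < ?W \<Longrightarrow> \<alpha> (vX t j i (X t j i))" by auto
    \<comment> \<open>The lower bound 1 makes the truncated subtraction in
      \<open>H t j + nat (dd + 1) - 1\<close> exact when the head moves left.\<close>
    have head: "head_at M z t j = int (H t j) - (int T + 1)" "1 \<le> H t j" "H t j < ?W" if "j < ?k" for j
      using inv[of t] that t unfolding H_def by (auto simp: abs_le_iff)
    have R: "\<alpha> (vR t j (read_at M z t ! j))" if j: "j < ?k" for j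
    proof -
      have "read_at M z t ! j = X t j (H t j)" using head[OF j] j by (simp add: read_at_def X_def)
      moreover have "X t j (H t j) \<in> symbols M" using inv[of t] j by (simp add: X_def)
      ultimately show ?thesis
        using read[OF t j head(3)[OF j], of "X t j (H t j)"] Hs[OF j] Xs[OF j head(3)[OF j]] by simp
    qed
    obtain q' acts where d: "delta M (state_at M z t) (read_at M z t) = (q', acts)" by fastforce
    have rd: "length (read_at M z t) = ?k" "set (read_at M z t) \<subseteq> symbols M"
      using inv[of t] by (auto simp: read_at_def)
    have st: "state_at M z t \<in> states M" using inv[of t] by blast
    have acts: "length acts = ?k" using wf_delta(2)[OF M st rd] d by simp
    let ?acts = "map (\<lambda>(s, d). (s, nat (d + 1))) acts"
    have "(state_at M z t, read_at M z t, q', ?acts) \<in> set (table M)"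
      using table_complete[OF M st rd] d by simp
    moreover note steps(3)[OF t]
    ultimately have tr: "\<alpha> (vS (Suc t) q') \<and>
       (\<forall>a \<in> set (zip [0..<?k] ?acts). \<forall>i < ?W. \<alpha> (vH t (fst a) i) \<longrightarrow>
         \<alpha> (vH (Suc t) (fst a) (i + snd (snd a) - 1)) \<and> \<alpha> (vX (Suc t) (fst a) i (fst (snd a))))"
      unfolding satisfies_transition using S R by fastforce
    have "state_at M z (Suc t) = q'" using inv[of t] d by simp
    moreover have "\<alpha> (vH (Suc t) j (H (Suc t) j)) \<and> (\<forall>i < ?W. \<alpha> (vX (Suc t) j i (X (Suc t) j i)))"
      if j: "j < ?k" for j
    proof -
      obtain s dd where a: "acts ! j = (s, dd)" by fastforce
      have "dd \<in> {-1, 0, 1}"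
      proof -
        have "acts ! j \<in> set acts" using j acts by simp
        then show ?thesis using wf_delta(3)[OF M st rd] d a by auto
      qed
      have "(j, (s, nat (dd + 1))) \<in> set (zip [0..<?k] ?acts)"
        using j acts a by (auto simp: set_zip intro!: exI[of _ j])
      then have new: "\<alpha> (vH (Suc t) j (H t j + nat (dd + 1) - 1))" "\<alpha> (vX (Suc t) j (H t j) s)"
        using tr Hs[OF j] head(3)[OF j] by force+
      have hd': "head_at M z (Suc t) j = head_at M z t j + dd"
        and cl': "cell_at M z (Suc t) j = (cell_at M z t j)(head_at M z t j := s)"
        using inv[of t] j d a by auto
      have "H (Suc t) j = H t j + nat (dd + 1) - 1"
        using head(1,2)[OF j] \<open>dd \<in> _\<close> unfolding H_def[of "Suc t"] hd' by auto
      moreover have "\<alpha> (vX (Suc t) j i (X (Suc t) j i))" if i: "i < ?W" for i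
      proof (cases "i = H t j")
        case True
        then have "X (Suc t) j i = s" using head(1)[OF j] by (simp add: X_def cl')
        then show ?thesis using new(2) True by simp
      next
        case False
        then have "X (Suc t) j i = X t j i" using head(1)[OF j] by (auto simp: X_def cl')
        moreover have "X t j i \<in> symbols M" using inv[of t] j by (simp add: X_def)
        ultimately show ?thesis using inertia[OF t j i head(3)[OF j] False] Hs[OF j] Xs[OF j i] by simp
      qed
      ultimately show ?thesis using new(1) by simp
    qed
    ultimately show ?case using tr by blast
  qed
  have "state_at M z T = accept_state M"
    using main[of T] final inv[of T] by blast
  then show ?thesis using l ly by (auto simp: z_def)
qed

lemma formula_complete:
  assumes M: "wf_tm M" and y: "length y \<le> P" and acc: "state_at M (enc_word x @ enc_word y) T = accept_state M"
  shows "satisfiable (formula M P T x)"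
proof -
  let ?k = "num_tapes M" and ?W = "2 * T + 3" and ?e = "enc_word x"
  let ?b = "T + 1 + length ?e"
  define z where "z = ?e @ enc_word y"
  define \<alpha> :: "var \<Rightarrow> bool" where "\<alpha> = (\<lambda>(kind, a, b, c, d).
     if kind = 0 then b = state_at M z a
     else if kind = 1 then int c = head_at M z a b + (int T + 1)
     else if kind = 2 then d = cell_at M z a b (int c - (int T + 1))
     else if kind = 3 then c = cell_at M z a b (head_at M z a b)
     else if kind = 4 then a = length y
     else a < length y \<and> y ! a)"
  have \<alpha>: "\<alpha> (vS t q) \<longleftrightarrow> q = state_at M z t"
    "\<alpha> (vH t j i) \<longleftrightarrow> int i = head_at M z t j + (int T + 1)"
    "\<alpha> (vX t j i s) \<longleftrightarrow> s = cell_at M z t j (int i - (int T + 1))"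
    "\<alpha> (vR t j s) \<longleftrightarrow> s = cell_at M z t j (head_at M z t j)"
    "\<alpha> (vL l) \<longleftrightarrow> l = length y" "\<alpha> (vY i) \<longleftrightarrow> i < length y \<and> y ! i" for t q j i s l
    by (simp_all add: \<alpha>_def vS_def vH_def vX_def vR_def vL_def vY_def)
  note inv = run_inv[OF M, of z] and init = run_0[OF M]
  have c0: "cell_at M z 0 0 = fst (input_tape (?e @ enc_word y))" using init by (simp add: z_def)
  have "satisfies \<alpha> (start_clauses M T ?e)"
    unfolding satisfies_start \<alpha>
    using init c0 input_cell(1,2)[where x = x and y = y and T = T] by (auto simp: sym_def)
  moreover have "satisfies \<alpha> (certificate_clauses P ?b ?W)"
    unfolding satisfies_certificate \<alpha> c0
    using y input_cell(3,4)[where x = x and y = y and T = T] input_cell(5)[where x = x and y = y and T = T] input_cell(6)[where x = x and y = y and T = T]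
    by (auto simp: sym_def)
  moreover have "satisfies \<alpha> (read_clauses M ?W t)" for t
    unfolding satisfies_read[OF M] \<alpha> by auto
  moreover have "satisfies \<alpha> (inertia_clauses M ?W t)" for t
    unfolding satisfies_inertia[OF M] \<alpha> using inv[of t] by auto
  moreover have "satisfies \<alpha> (transition_clauses M ?W t)" if t: "t < T" for t
    unfolding satisfies_transition \<alpha>
  proof (clarify, intro conjI ballI allI impI)
    fix q xs q' acts
    assume e: "(state_at M z t, xs, q', acts) \<in> set (table M)"
      and xs: "\<forall>j < ?k. xs ! j = cell_at M z t j (head_at M z t j)"
    have "xs = read_at M z t"
      using table_sound(3)[OF e] xs by (intro nth_equalityI) (auto simp: read_at_def)
    then have d: "q' = fst (delta M (state_at M z t) (read_at M z t))"
      "acts = map (\<lambda>(s, d). (s, nat (d + 1))) (snd (delta M (state_at M z t) (read_at M z t)))"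
      using table_sound(1,2)[OF e] by simp_all
    show "q' = state_at M z (Suc t)" using d(1) inv[of t] by simp
    fix a i assume a: "a \<in> set (zip [0..<?k] acts)" and i: "i < ?W" "int i = head_at M z t (fst a) + (int T + 1)"
    obtain j where j: "j < ?k" "j < length acts" "a = (j, acts ! j)" using a by (auto simp: set_zip)
    obtain s dd where sd: "snd (delta M (state_at M z t) (read_at M z t)) ! j = (s, dd)" by fastforce
    have acts: "acts ! j = (s, nat (dd + 1))" using d(2) sd j(2) by simp
    have rd: "length (read_at M z t) = ?k" "set (read_at M z t) \<subseteq> symbols M" and st: "state_at M z t \<in> states M"
      using inv[of t] by (auto simp: read_at_def)
    have "(s, dd) \<in> set (snd (delta M (state_at M z t) (read_at M z t)))"
      using j(1) wf_delta(2)[OF M st rd] sd by (metis nth_mem)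
    then have "dd \<in> {-1, 0, 1}" using wf_delta(3)[OF M st rd] by auto
    \<comment> \<open>This keeps the window index of the head positive, so that decrementing it as a
      natural number is exact.\<close>
    moreover have "head_at M z t j \<ge> - int t" using inv[of t] j(1) by (auto simp: abs_le_iff)
    moreover have h': "head_at M z (Suc t) j = head_at M z t j + dd"
      and cl': "cell_at M z (Suc t) j = (cell_at M z t j)(head_at M z t j := s)"
      using inv[of t] j sd by auto
    ultimately show "int (i + snd (snd a) - 1) = head_at M z (Suc t) (fst a) + (int T + 1)"
      using i(2) t by (auto simp: j(3) acts h')
    show "fst (snd a) = cell_at M z (Suc t) (fst a) (int i - (int T + 1))"
      using i(2) by (simp add: j(3) acts cl')
  qed
  moreover have "satisfies \<alpha> (final_clauses M T)"
    unfolding satisfies_final[OF M] \<alpha> using acc by (auto simp: z_def)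
  ultimately show ?thesis unfolding satisfiable_def satisfies_formula by blast
qed

theorem SAT_hard:
  assumes "A \<in> class_NP"
  shows "\<exists>f :: bool list \<Rightarrow> clause list. FP f \<and> (\<forall>x. x \<in> A \<longleftrightarrow> satisfiable (f x))"
proof -
  from assms obtain R p where R: "R \<in> class_P"
    and A: "\<And>x. x \<in> A \<longleftrightarrow> (\<exists>y. length y \<le> poly p (length x) \<and> enc_word x @ enc_word y \<in> R)"
    unfolding class_NP_def by blast
  from R obtain M q where M: "wf_tm M" and dec: "decides_in_time M R (poly q)"
    unfolding class_P_def by blast
  let ?P = "\<lambda>x :: bool list. poly p (length x)"
  \<comment> \<open>The encoded pair has \<open>2 * length x + 1\<close> plus at most
    \<open>2 * ?P x + 1\<close> bits. This gives one time for all certificates; as a halted run is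
    stationary, its state at that time is the verdict.\<close>
  let ?T = "\<lambda>x :: bool list. poly q (2 * length x + 2 * ?P x + 2)"
  have T: "state_at M (enc_word x @ enc_word y) (?T x) = accept_state M \<longleftrightarrow> enc_word x @ enc_word y \<in> R"
    if "length y \<le> ?P x" for x y
  proof -
    let ?z = "enc_word x @ enc_word y"
    obtain n where n: "n \<le> poly q (length ?z)"
      "fst (run M ?z n) = (if ?z \<in> R then accept_state M else reject_state M)"
      using dec unfolding decides_in_time_def by blast
    have "poly q (length ?z) \<le> ?T x"
      by (rule poly_nat_mono) (use that in \<open>simp add: length_enc_word\<close>)
    then obtain m where "?T x = n + m" using n(1) le_Suc_ex order_trans by blast
    then have "run M ?z (?T x) = run M ?z n" using run_halted[of M ?z n m] n(2) by auto
    moreover have "accept_state M \<noteq> reject_state M" using M by (simp add: wf_tm_def)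
    ultimately show ?thesis using n(2) by (simp add: state_at_def)
  qed
  have "FP (\<lambda>x :: bool list. formula M (?P x) (?T x) x)"
    by (intro FP_intros)
  moreover have "x \<in> A \<longleftrightarrow> satisfiable (formula M (?P x) (?T x) x)" for x
    using formula_sound[OF M] formula_complete[OF M] T unfolding A satisfiable_def by metis
  ultimately show ?thesis by blast
qed


section \<open>Exact control by adding voters is NP-hard\<close>

definition dedup :: "'a list \<Rightarrow> 'a list" where
  "dedup xs = fold (\<lambda>x acc. if x \<in> set acc then acc else x # acc) xs []"

lemma dedup_props: "distinct (dedup xs)" "set (dedup xs) = set xs"
proof -
  have "distinct acc \<Longrightarrow> distinct (fold (\<lambda>x acc. if x \<in> set acc then acc else x # acc) xs acc) \<and>
      set (fold (\<lambda>x acc. if x \<in> set acc then acc else x # acc) xs acc) = set xs \<union> set acc" for acc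
    by (induction xs arbitrary: acc) auto
  from this[of "[]"] show "distinct (dedup xs)" "set (dedup xs) = set xs" by (simp_all add: dedup_def)
qed

lemma FP_dedup [FP_intros]:
  assumes "FP l" shows "FP (\<lambda>x. dedup (l x))"
  unfolding dedup_def
proof (rule FP_fold_bounded[where B = l])
  have le: "csize (fold (\<lambda>x acc. if x \<in> set acc then acc else x # acc) ys acc) + 1 \<le> csize ys + csize acc" for ys acc :: "'b list"
  proof (induction ys arbitrary: acc)
    case (Cons a ys)
    show ?case using Cons.IH[of acc] Cons.IH[of "a # acc"] csize_pos[of a] by (cases "a \<in> set acc") simp_all
  qed simp
  fix x ys zs assume "l x = ys @ zs"
  then show "csize (fold (\<lambda>x acc. if x \<in> set acc then acc else x # acc) ys []) \<le> csize (l x)"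
    using le[of ys "[]"] csize_append[of ys zs] csize_pos[of zs] by simp
qed (intro FP_intros assms)+

type_synonym element = "nat \<times> var \<times> nat"

abbreviation v0 :: var where "v0 \<equiv> (0, 0, 0, 0, 0)"

text \<open>Candidate names must be words. A self-delimiting list of unary numbers is injective, and
  of polynomial length because the numbers are unary data anyway.\<close>

definition element_name :: "element \<Rightarrow> name" where
  "element_name e = enc_vote (map (\<lambda>n. replicate n True)
     (case e of (kind, (a, b, c, d, f), j) \<Rightarrow> [kind, a, b, c, d, f, j]))"

text \<open>Element 2 of a variable and a clause index lies in exactly two triples, for the two truth
  values. Elements 1 link these choices cyclically for all clause indices; elements 3 and 4 remain
  free if the variable is true and false, respectively.\<close>

definition true_triple :: "nat \<Rightarrow> var \<Rightarrow> nat \<Rightarrow> element list" where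
  "true_triple N v j = [(2, v, j), (1, v, if Suc j = N then 0 else Suc j), (4, v, j)]"

definition false_triple :: "var \<Rightarrow> nat \<Rightarrow> element list" where
  "false_triple v j = [(2, v, j), (1, v, j), (3, v, j)]"

text \<open>The third element is the one that remains free exactly when the literal is true. Element
  5 stands for the clause; element 6 only fills the triple up.\<close>

definition literal_triple :: "nat \<Rightarrow> bool \<times> var \<Rightarrow> element list" where
  "literal_triple j l = [(5, v0, j), (6, v0, j), (if fst l then 3 else 4, snd l, j)]"

definition variables :: "clause list \<Rightarrow> var list" where
  "variables F = dedup (map snd (concat F))"

definition triples :: "clause list \<Rightarrow> element list list" where
  "triples F =
     concat (map (\<lambda>v. concat (map (\<lambda>j. [true_triple (length F) v j, false_triple v j]) [0..<length F])) (variables F)) @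
     concat (map (\<lambda>a. map (\<lambda>l. literal_triple (fst a) l) (snd a)) (zip [0..<length F] F))"

abbreviation specials :: "element list" where
  "specials \<equiv> [(0, v0, 0), (0, v0, 1), (0, v0, 2)]"

definition elements :: "clause list \<Rightarrow> element list" where
  "elements F = specials @
     concat (map (\<lambda>v. concat (map (\<lambda>j. [(1, v, j), (2, v, j), (3, v, j), (4, v, j)]) [0..<length F])) (variables F)) @
     concat (map (\<lambda>j. [(5, v0, j), (6, v0, j)]) [0..<length F])"

text \<open>The number of elements of kinds 2 and 5. Every triple contains exactly one of these, so
  a packing of this exact size decides every position of every wheel and serves every
  clause.\<close>

definition target :: "clause list \<Rightarrow> nat" where
  "target F = length (variables F) * length F + length F"

definition triple_vote :: "element list \<Rightarrow> element list \<Rightarrow> name vote" where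
  "triple_vote es tr = map element_name (tr @ filter (\<lambda>e. e \<notin> set tr) es)"

definition control_instance :: "clause list \<Rightarrow> bool list" where
  "control_instance F =
     enc_election (map element_name (elements F)) [triple_vote (elements F) specials] @
     enc_list enc_vote (map (triple_vote (elements F)) (triples F)) @
     enc_word (binary (target F)) @ enc_word (element_name (0, v0, 0))"

lemma FP_element_name [FP_intros]: "FP f \<Longrightarrow> FP (\<lambda>x. element_name (f x))"
  by (rule FP_comp[of element_name]) (unfold element_name_def, intro FP_intros)

lemma FP_triple_vote [FP_intros]: "FP f \<Longrightarrow> FP g \<Longrightarrow> FP (\<lambda>x. triple_vote (f x) (g x))"
  by (rule FP_comp2[of triple_vote]) (unfold triple_vote_def, intro FP_intros)

lemma FP_variables [FP_intros]: "FP f \<Longrightarrow> FP (\<lambda>x. variables (f x))"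
  by (rule FP_comp[of variables]) (unfold variables_def, intro FP_intros)

lemma FP_elements [FP_intros]: "FP f \<Longrightarrow> FP (\<lambda>x. elements (f x))"
  by (rule FP_comp[of elements]) (unfold elements_def, intro FP_intros)

lemma FP_triples [FP_intros]: "FP f \<Longrightarrow> FP (\<lambda>x. triples (f x))"
  by (rule FP_comp[of triples])
    (unfold triples_def true_triple_def false_triple_def literal_triple_def, intro FP_intros)

lemma FP_control_instance: "FP f \<Longrightarrow> FP (\<lambda>x. control_instance (f x))"
  by (rule FP_comp[of control_instance]) (unfold control_instance_def target_def, intro FP_intros)

lemma element_name_inject [simp]: "element_name d = element_name e \<longleftrightarrow> d = e"
proof
  assume eq: "element_name d = element_name e"
  have inject: "v = w" if "enc_vote v = enc_vote w" for v w
    using that dec_vote_enc(2)[of v "[]"] dec_vote_enc(2)[of w "[]"] by simp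
  have replicate: "replicate m True = replicate n True \<longleftrightarrow> m = n" for m n
    by (metis length_replicate)
  obtain k a1 a2 a3 a4 a5 j where d: "d = (k, (a1, a2, a3, a4, a5), j)" by (metis surj_pair)
  obtain k' b1 b2 b3 b4 b5 j' where e: "e = (k', (b1, b2, b3, b4, b5), j')" by (metis surj_pair)
  show "d = e" using inject[OF eq[unfolded element_name_def]] by (simp add: d e replicate)
qed simp


subsection \<open>Packings and satisfying assignments\<close>

definition packing :: "clause list \<Rightarrow> element list list \<Rightarrow> bool" where
  "packing F W \<longleftrightarrow> set W \<subseteq> set (triples F) \<and> length W = target F \<and>
     (\<forall>e. length (filter (\<lambda>tr. e \<in> set tr) W) \<le> 1)"

lemma in_triples:
  "tr \<in> set (triples F) \<longleftrightarrow>
     (\<exists>v \<in> set (variables F). \<exists>j < length F. tr = true_triple (length F) v j \<or> tr = false_triple v j) \<or>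
     (\<exists>j < length F. \<exists>l \<in> set (F ! j). tr = literal_triple j l)"
proof -
  have "tr \<in> set (triples F) \<longleftrightarrow>
     (\<exists>v \<in> set (variables F). \<exists>j \<in> {..<length F}. tr \<in> {true_triple (length F) v j, false_triple v j}) \<or>
     (\<exists>a \<in> set (zip [0..<length F] F). \<exists>l \<in> set (snd a). tr = literal_triple (fst a) l)"
    unfolding triples_def by (simp add: image_iff atLeast0LessThan)
  then show ?thesis by (simp add: set_zip_upt Bex_def)
qed

lemma set_variables: "v \<in> set (variables F) \<longleftrightarrow> (\<exists>c \<in> set F. v \<in> snd ` set c)"
  by (force simp: variables_def dedup_props)

lemma length_filter_le_1:
  assumes "length (filter P xs) \<le> 1" "x \<in> set xs" "y \<in> set xs" "P x" "P y"
  shows "x = y"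
proof (cases "filter P xs")
  case Nil
  then show ?thesis using assms(2,4) by (auto simp: filter_empty_conv)
next
  case (Cons a as)
  then have "filter P xs = [a]" using assms(1) by simp
  moreover have "x \<in> set (filter P xs)" "y \<in> set (filter P xs)" using assms(2-5) by simp_all
  ultimately show ?thesis by simp
qed

lemma distinct_filter_le_1:
  "distinct xs \<longleftrightarrow> (\<forall>y. length (filter (\<lambda>x. x = y) xs) \<le> 1)"
proof (induction xs)
  case (Cons x xs)
  have "(\<forall>y. length (filter (\<lambda>z. z = y) (x # xs)) \<le> 1) \<longleftrightarrow>
      filter (\<lambda>z. z = x) xs = [] \<and> (\<forall>y. length (filter (\<lambda>z. z = y) xs) \<le> 1)"
    by (auto simp: le_Suc_eq)
  then show ?case using Cons by (auto simp: filter_empty_conv)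
qed simp

lemma length_filter_distinct_le_1:
  assumes "distinct xs" "\<And>x y. x \<in> set xs \<Longrightarrow> y \<in> set xs \<Longrightarrow> P x \<Longrightarrow> P y \<Longrightarrow> x = y"
  shows "length (filter P xs) \<le> 1"
proof -
  have "length (filter P xs) = card {x \<in> set xs. P x}"
    using distinct_card[OF distinct_filter[OF assms(1), of P]] by simp
  moreover have "card {x \<in> set xs. P x} \<le> 1"
    using assms(2) by (simp add: card_le_Suc0_iff_eq)
  ultimately show ?thesis by simp
qed

definition heads :: "clause list \<Rightarrow> element list" where
  "heads F = map (\<lambda>a. (2, fst a, snd a)) (List.product (variables F) [0..<length F]) @
     map (\<lambda>j. (5, v0, j)) [0..<length F]"

lemma heads_props: "distinct (heads F)" "length (heads F) = target F"
proof -
  have "distinct (List.product (variables F) [0..<length F])"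
    by (intro distinct_product) (simp_all add: variables_def dedup_props)
  then show "distinct (heads F)" by (auto simp: heads_def distinct_map inj_on_def)
  show "length (heads F) = target F" by (simp add: heads_def target_def)
qed

lemma hd_in_heads: "tr \<in> set (triples F) \<Longrightarrow> hd tr \<in> set (heads F) \<and> hd tr \<in> set tr"
  by (auto simp: in_triples heads_def true_triple_def false_triple_def literal_triple_def)

text \<open>Disjoint triples have distinct heads, and there are as many triples as possible heads,
  so none is left out.\<close>

lemma packing_heads:
  assumes W: "packing F W" and g: "g \<in> set (heads F)"
  shows "\<exists>tr \<in> set W. hd tr = g"
proof -
  have sub: "set W \<subseteq> set (triples F)" and len: "length W = target F"
    and le: "\<And>e. length (filter (\<lambda>tr. e \<in> set tr) W) \<le> 1" using W by (auto simp: packing_def)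
  have "distinct (map hd W)"
    unfolding distinct_filter_le_1
  proof
    fix e
    have "length (filter (\<lambda>x. x = e) (map hd W)) = length (filter (\<lambda>tr. hd tr = e) W)"
      by (simp add: filter_map comp_def)
    also have "\<dots> = length (filter (\<lambda>tr. hd tr = e) (filter (\<lambda>tr. e \<in> set tr) W))"
      using sub hd_in_heads by (auto intro!: arg_cong[where f = length] filter_cong)
    also have "\<dots> \<le> 1" using le[of e] length_filter_le order_trans by blast
    finally show "length (filter (\<lambda>x. x = e) (map hd W)) \<le> 1" .
  qed
  then have "card (set (map hd W)) = card (set (heads F))"
    using distinct_card[of "map hd W"] distinct_card[OF heads_props(1)] len heads_props(2) by simp
  moreover have "set (map hd W) \<subseteq> set (heads F)" using sub hd_in_heads by auto
  ultimately have "set (map hd W) = set (heads F)" by (intro card_subset_eq) auto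
  then have "g \<in> hd ` set W" using g by simp
  then show ?thesis by blast
qed

text \<open>The wheel of a variable is forced to be consistent by its shared elements of kind 1. A
  clause triple then occupies an element of the wheel triple that would make its literal
  false.\<close>

lemma packing_satisfiable:
  assumes W: "packing F W" shows "satisfiable F"
proof -
  let ?N = "length F"
  have sub: "set W \<subseteq> set (triples F)" using W by (simp add: packing_def)
  have unique: "tr = tr'" if "tr \<in> set W" "tr' \<in> set W" "e \<in> set tr" "e \<in> set tr'" for tr tr' e
  proof (rule length_filter_le_1[of "\<lambda>tr. e \<in> set tr" W])
    show "length (filter (\<lambda>tr. e \<in> set tr) W) \<le> 1" using W unfolding packing_def by blast
  qed (use that in simp_all)
  have wheel: "true_triple ?N v j \<in> set W \<or> false_triple v j \<in> set W" if v: "v \<in> set (variables F)" and j: "j < ?N" for v j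
  proof -
    have "(2, v, j) \<in> set (heads F)" using v j by (auto simp: heads_def)
    from packing_heads[OF W this] obtain tr where tr: "tr \<in> set W" "hd tr = (2, v, j)" by blast
    moreover have "tr \<in> set (triples F)" using tr(1) sub by blast
    ultimately have "tr = true_triple ?N v j \<or> tr = false_triple v j"
      by (auto simp: in_triples true_triple_def false_triple_def literal_triple_def)
    then show ?thesis using tr(1) by blast
  qed
  define succ where "succ j = (if Suc j = ?N then 0 else Suc j)" for j
  \<comment> \<open>The true triple at \<open>j\<close> and the false triple at the next position
    share the element of kind 1 there, so truth is passed on around the wheel.\<close>
  have succ_true: "true_triple ?N v (succ j) \<in> set W"
    if v: "v \<in> set (variables F)" and j: "j < ?N" and t: "true_triple ?N v j \<in> set W" for v j
  proof (rule ccontr)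
    assume "true_triple ?N v (succ j) \<notin> set W"
    moreover have "succ j < ?N" using j by (auto simp: succ_def)
    ultimately have f: "false_triple v (succ j) \<in> set W" using wheel[OF v, of "succ j"] by blast
    have "true_triple ?N v j = false_triple v (succ j)"
      by (rule unique[OF t f, of "(1, v, succ j)"]) (auto simp: true_triple_def false_triple_def succ_def)
    then show False by (simp add: true_triple_def false_triple_def)
  qed
  define \<alpha> where "\<alpha> v \<longleftrightarrow> true_triple ?N v 0 \<in> set W" for v
  have all_true: "true_triple ?N v j \<in> set W" if "v \<in> set (variables F)" "j < ?N" "\<alpha> v" for v j
    using that(2)
  proof (induction j)
    case 0
    then show ?case using that(3) by (simp add: \<alpha>_def)
  next
    case (Suc j)
    then show ?case using succ_true[OF that(1), of j] by (simp add: succ_def)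
  qed
  \<comment> \<open>Conversely, truth at any position travels forward until the wheel closes up at
    position 0, where \<open>\<alpha>\<close> is read off.\<close>
  have true_\<alpha>: "\<alpha> v" if "v \<in> set (variables F)" "j < ?N" "true_triple ?N v j \<in> set W" for v j
    using that(2,3)
  proof (induction "?N - j" arbitrary: j rule: less_induct)
    case less
    show ?case
    proof (cases "Suc j = ?N")
      case True
      then show ?thesis using succ_true[OF that(1) less.prems] by (simp add: succ_def \<alpha>_def)
    next
      case False
      then have "true_triple ?N v (Suc j) \<in> set W" using succ_true[OF that(1) less.prems] by (simp add: succ_def)
      then show ?thesis using less.hyps[of "Suc j"] less.prems False by simp
    qed
  qed
  have "\<exists>l \<in> set (F ! j). \<alpha> (snd l) = fst l" if j: "j < ?N" for j
  proof -
    have "(5, v0, j) \<in> set (heads F)" using j by (auto simp: heads_def)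
    from packing_heads[OF W this] obtain tr where tr: "tr \<in> set W" "hd tr = (5, v0, j)" by blast
    moreover have "tr \<in> set (triples F)" using tr(1) sub by blast
    ultimately obtain l where l: "l \<in> set (F ! j)" "tr = literal_triple j l"
      by (auto simp: in_triples true_triple_def false_triple_def literal_triple_def)
    have v: "snd l \<in> set (variables F)" using l(1) j by (auto simp: set_variables intro!: bexI[of _ "F ! j"])
    have "\<alpha> (snd l) = fst l"
    proof (rule ccontr)
      assume neq: "\<alpha> (snd l) \<noteq> fst l"
      show False
      proof (cases "fst l")
        case True
        then have f: "false_triple (snd l) j \<in> set W" using neq wheel[OF v j] true_\<alpha>[OF v j] by blast
        have "tr = false_triple (snd l) j"
          by (rule unique[OF tr(1) f, of "(3, snd l, j)"]) (auto simp: l(2) True literal_triple_def false_triple_def)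
        then show False by (simp add: l(2) literal_triple_def false_triple_def)
      next
        case False
        then have t: "true_triple ?N (snd l) j \<in> set W" using neq all_true[OF v j] by blast
        have "tr = true_triple ?N (snd l) j"
          by (rule unique[OF tr(1) t, of "(4, snd l, j)"]) (auto simp: l(2) False literal_triple_def true_triple_def)
        then show False by (simp add: l(2) literal_triple_def true_triple_def)
      qed
    qed
    then show ?thesis using l(1) by blast
  qed
  then have "satisfies \<alpha> F" unfolding satisfies_def by (metis in_set_conv_nth)
  then show ?thesis by (auto simp: satisfiable_def)
qed

lemma satisfiable_packing:
  assumes "satisfiable F" shows "\<exists>W. packing F W \<and> distinct W"
proof -
  let ?N = "length F"
  obtain \<alpha> where \<alpha>: "satisfies \<alpha> F" using assms by (auto simp: satisfiable_def)
  define wheel where "wheel a = (if \<alpha> (fst a) then true_triple ?N (fst a) (snd a) else false_triple (fst a) (snd a))" for a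
  have "\<exists>l \<in> set (F ! j). \<alpha> (snd l) = fst l" if "j < ?N" for j
    using \<alpha> that by (simp add: satisfies_def)
  then obtain lit where lit: "\<And>j. j < ?N \<Longrightarrow> lit j \<in> set (F ! j) \<and> \<alpha> (snd (lit j)) = fst (lit j)" by metis
  define ps where "ps = List.product (variables F) [0..<?N]"
  define W where "W = map wheel ps @ map (\<lambda>j. literal_triple j (lit j)) [0..<?N]"
  have hd_wheel: "hd (wheel a) = (2, fst a, snd a)" for a
    by (simp add: wheel_def true_triple_def false_triple_def)
  \<comment> \<open>The heads of the chosen triples are exactly the list of all heads; this yields
    both distinctness and the required size.\<close>
  have heads: "map hd W = heads F"
    by (simp add: W_def heads_def ps_def hd_wheel comp_def literal_triple_def)
  then have "distinct (map hd W)" using heads_props(1) by simp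
  then have dist: "distinct W" by (simp add: distinct_map)
  have len: "length W = target F" using heads heads_props(2) by (metis length_map)
  have sub: "set W \<subseteq> set (triples F)"
  proof
    fix tr assume "tr \<in> set W"
    then consider v j where "v \<in> set (variables F)" "j < ?N" "tr = wheel (v, j)"
      | j where "j < ?N" "tr = literal_triple j (lit j)"
      by (auto simp: W_def ps_def)
    then show "tr \<in> set (triples F)"
    proof cases
      case 1
      then have "tr = true_triple ?N v j \<or> tr = false_triple v j" by (simp add: wheel_def)
      then show ?thesis unfolding in_triples using 1(1,2) by blast
    next
      case 2
      then show ?thesis unfolding in_triples using lit by blast
    qed
  qed
  have cases: "(\<exists>v j. v \<in> set (variables F) \<and> j < ?N \<and> tr = (if \<alpha> v then true_triple ?N v j else false_triple v j)) \<or>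
      (\<exists>j < ?N. tr = literal_triple j (lit j))" if "tr \<in> set W" for tr
  proof -
    have "(\<exists>a \<in> set ps. tr = wheel a) \<or> (\<exists>j < ?N. tr = literal_triple j (lit j))"
      using that by (simp add: W_def image_iff atLeast0LessThan Bex_def)
    then show ?thesis unfolding ps_def wheel_def by (metis SigmaE atLeastLessThan_iff fst_conv snd_conv set_product set_upt)
  qed
  \<comment> \<open>Since a variable uses only its true or only its false triples, the cyclic
    successor need only be injective to keep their elements of kind 1 apart.\<close>
  have inj_next: "j = j'" if "j < ?N" "j' < ?N"
    "(if Suc j = ?N then 0 else Suc j) = (if Suc j' = ?N then 0 else Suc j')" for j j'
    using that by (auto split: if_splits)
  have "tr = tr'" if tr: "tr \<in> set W" "tr' \<in> set W" "e \<in> set tr" "e \<in> set tr'" for tr tr' e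
    using cases[OF tr(1)] cases[OF tr(2)]
  proof (elim disjE exE conjE)
    fix v j v' j'
    assume "j < ?N" "j' < ?N"
      "tr = (if \<alpha> v then true_triple ?N v j else false_triple v j)"
      "tr' = (if \<alpha> v' then true_triple ?N v' j' else false_triple v' j')"
    then show ?thesis using tr(3,4) inj_next[of j j']
      by (auto simp: true_triple_def false_triple_def split: if_splits)
  next
    fix v j j'
    assume "j < ?N" "j' < ?N" "tr = (if \<alpha> v then true_triple ?N v j else false_triple v j)"
      "tr' = literal_triple j' (lit j')"
    then show ?thesis using tr(3,4) lit[of j']
      by (auto simp: true_triple_def false_triple_def literal_triple_def split: if_splits)
  next
    fix j v' j'
    assume "j < ?N" "j' < ?N" "tr = literal_triple j (lit j)"
      "tr' = (if \<alpha> v' then true_triple ?N v' j' else false_triple v' j')"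
    then show ?thesis using tr(3,4) lit[of j]
      by (auto simp: true_triple_def false_triple_def literal_triple_def split: if_splits)
  next
    fix j j'
    assume "tr = literal_triple j (lit j)" "tr' = literal_triple j' (lit j')"
    then show ?thesis using tr(3,4) by (auto simp: literal_triple_def split: if_splits)
  qed
  then have "length (filter (\<lambda>tr. e \<in> set tr) W) \<le> 1" for e
    by (intro length_filter_distinct_le_1[OF dist]) blast
  then show ?thesis using sub len dist by (auto simp: packing_def)
qed


subsection \<open>From packings to elections\<close>

lemma distinct_elements: "distinct (elements F)"
proof -
  have 1: "distinct (concat (map (\<lambda>v. concat (map (\<lambda>j. [(1 :: nat, v, j), (2, v, j), (3, v, j), (4, v, j)]) [0..<n])) vs))"
    if "distinct vs" for vs :: "var list" and n
  proof -
    have "distinct (concat (map (\<lambda>j. [(1 :: nat, v, j), (2, v, j), (3, v, j), (4, v, j)]) [0..<n]))" for v :: var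
      by (induction n) auto
    then show ?thesis using that by (induction vs) auto
  qed
  have 2: "distinct (concat (map (\<lambda>j. [(5 :: nat, v0, j), (6, v0, j)]) [0..<n]))" for n
    by (induction n) auto
  have "distinct (variables F)" by (simp add: variables_def dedup_props)
  from 1[OF this] 2 show ?thesis unfolding elements_def by auto
qed

lemma triple_props:
  assumes "tr = specials \<or> tr \<in> set (triples F)"
  shows "distinct tr" "set tr \<subseteq> set (elements F)" "length tr = 3"
proof -
  have lit: "snd l \<in> set (variables F)" if "j < length F" "l \<in> set (F ! j)" for j l
    using that by (auto simp: set_variables intro!: bexI[of _ "F ! j"])
  show "distinct tr" "length tr = 3"
    using assms by (auto simp: in_triples true_triple_def false_triple_def literal_triple_def)
  show "set tr \<subseteq> set (elements F)"
    using assms lit unfolding in_triples elements_def true_triple_def false_triple_def literal_triple_def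
    by (elim disjE bexE exE conjE) (auto split: if_splits)
qed

lemma take_triple_vote:
  assumes "length tr = 3"
  shows "element_name e \<in> set (take 3 (triple_vote es tr)) \<longleftrightarrow> e \<in> set tr"
  using assms by (auto simp: triple_vote_def take_map image_iff)

lemma score3_triples:
  assumes "\<And>tr. tr \<in> set W \<Longrightarrow> length tr = 3"
  shows "score3 (map (triple_vote es) W) (element_name e) = length (filter (\<lambda>tr. e \<in> set tr) W)"
proof -
  have "filter (\<lambda>tr. element_name e \<in> set (take 3 (triple_vote es tr))) W = filter (\<lambda>tr. e \<in> set tr) W"
    using assms take_triple_vote by (intro filter_cong) auto
  then show ?thesis by (simp add: score3_def filter_map comp_def)
qed

lemma valid_triple_votes:
  assumes "set W \<subseteq> insert specials (set (triples F))"
  shows "valid_votes (map element_name (elements F)) (map (triple_vote (elements F)) W)"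
proof -
  have "distinct (triple_vote (elements F) tr) \<and> set (triple_vote (elements F) tr) = element_name ` set (elements F)"
    if "tr \<in> set W" for tr
  proof -
    have tr: "tr = specials \<or> tr \<in> set (triples F)" using that assms by blast
    note p = triple_props[OF tr]
    have "distinct (tr @ filter (\<lambda>e. e \<notin> set tr) (elements F))"
      "set (tr @ filter (\<lambda>e. e \<notin> set tr) (elements F)) = set (elements F)"
      using p distinct_elements[of F] by auto
    moreover have "inj element_name" by (simp add: inj_def)
    ultimately show ?thesis unfolding triple_vote_def set_map
      by (metis distinct_map inj_on_subset subset_UNIV)
  qed
  then show ?thesis by (auto simp: valid_votes_def)
qed

text \<open>No triple contains a special element, so \<open>p\<close> stays at the single point from
  the registered vote. Winning then means that no candidate exceeds one point, and the two dummies
  tie with \<open>p\<close>.\<close>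

lemma wins3_packing:
  assumes "set W \<subseteq> set (triples F)"
  shows "wins3 (map element_name (elements F)) (triple_vote (elements F) specials # map (triple_vote (elements F)) W)
      (element_name (0, v0, 0)) \<longleftrightarrow> (\<forall>e. length (filter (\<lambda>tr. e \<in> set tr) W) \<le> 1)"
proof -
  let ?es = "elements F"
  let ?n = "\<lambda>e. length (filter (\<lambda>tr. e \<in> set tr) W)"
  have W: "length tr = 3" if "tr \<in> set W" for tr using triple_props(3)[of tr F] that assms by blast
  have score: "score3 (map (triple_vote ?es) (specials # W)) (element_name e)
      = (if e \<in> set specials then 1 else 0) + ?n e" for e
    by (subst score3_triples) (use W in auto)
  have "e \<notin> set tr" if "e \<in> set specials" "tr \<in> set W" for e tr
    using that assms by (auto simp: in_triples true_triple_def false_triple_def literal_triple_def dest!: subsetD split: if_splits)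
  then have special: "?n e = 0" if "e \<in> set specials" for e
    using that by (auto simp: filter_empty_conv)
  have outside: "?n e = 0" if "e \<notin> set ?es" for e
    using that assms triple_props(2)[of _ F] by (auto simp: filter_empty_conv)
  have p: "score3 (map (triple_vote ?es) (specials # W)) (element_name (0, v0, 0)) = 1"
    unfolding score using special[of "(0, v0, 0)"] by simp
  have "wins3 (map element_name ?es) (map (triple_vote ?es) (specials # W)) (element_name (0, v0, 0)) \<longleftrightarrow>
      (\<forall>e \<in> set ?es. (if e \<in> set specials then 1 else 0) + ?n e \<le> 1)"
    unfolding wins3_def p by (simp only: set_map ball_simps score)
  also have "\<dots> \<longleftrightarrow> (\<forall>e. ?n e \<le> 1)"
  proof -
    have "(if e \<in> set specials then 1 else 0) + ?n e \<le> 1 \<longleftrightarrow> ?n e \<le> 1" for e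
      using special[of e] by (cases "e \<in> set specials") simp_all
    moreover have "?n e \<le> 1" if "e \<notin> set ?es" for e using outside[OF that] by simp
    ultimately show ?thesis by blast
  qed
  finally show ?thesis by simp
qed

text \<open>The checker compares the required number of votes as a word, whereas a packing has a
  size.\<close>

lemma binary_inject: "binary m = binary n \<Longrightarrow> m = n"
proof (induction m arbitrary: n rule: less_induct)
  case (less m)
  show ?case
  proof (cases "m = 0 \<or> n = 0")
    case True
    then show ?thesis using less.prems by (auto simp: binary.simps[of m] binary.simps[of n] split: if_splits)
  next
    case False
    then have "odd m = odd n" "binary (m div 2) = binary (n div 2)"
      using less.prems by (auto simp: binary.simps[of m] binary.simps[of n])
    moreover have "m div 2 = n div 2" using less.IH[of "m div 2" "n div 2"] False calculation by simp
    ultimately show ?thesis by (metis odd_two_times_div_two_succ even_two_times_div_two)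
  qed
qed

lemma select_map: "select y (map f U) = map f (select y U)"
  by (simp add: select_def zip_map2 filter_map comp_def split_def)

lemma control_instance_correct:
  "control_instance F \<in> exact_control_by_adding_voters (approval_winners 3) \<longleftrightarrow> satisfiable F"
proof -
  let ?es = "elements F" and ?x = "control_instance F"
  let ?U = "map (triple_vote ?es) (triples F)"
  have p: "element_name (0, v0, 0) \<in> set (map element_name ?es)" by (simp add: elements_def)
  have dC: "distinct (map element_name ?es)"
    using distinct_elements[of F] by (simp add: distinct_map inj_on_def)
  have check: "check_adding ?x y \<longleftrightarrow> target F = length (select y (triples F)) \<and>
     wins3 (map element_name ?es) (triple_vote ?es specials # map (triple_vote ?es) (select y (triples F)))
       (element_name (0, v0, 0))" for y
    unfolding control_instance_def check_adding_enc
    using p dC valid_triple_votes[of "[specials]" F] valid_triple_votes[of "triples F" F] binary_inject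
    by (auto simp: select_map)
  have subset: "set (select y (triples F)) \<subseteq> set (triples F)" for y
    using set_mset_mono[OF select_subset[of y "triples F"]] by simp
  have pack: "check_adding ?x y \<longleftrightarrow> packing F (select y (triples F))" for y
    unfolding check packing_def using wins3_packing[OF subset[of y]] subset[of y] by auto
  show ?thesis
    unfolding exact_control_iff_check pack
  proof
    assume "\<exists>y. length y \<le> length ?x \<and> packing F (select y (triples F))"
    then show "satisfiable F" using packing_satisfiable by blast
  next
    assume "satisfiable F"
    then obtain W where W: "packing F W" "distinct W" using satisfiable_packing by blast
    \<comment> \<open>A clause with a repeated literal lists a triple twice; as \<open>W\<close> is
      distinct, inclusion of the sets is enough for inclusion of the multisets.\<close>
    have "mset W \<subseteq># mset (triples F)"
    proof (rule mset_subset_eqI)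
      fix tr
      have "count (mset W) tr \<le> 1" using W(2) by (simp add: distinct_count_atmost_1)
      moreover have "count (mset W) tr > 0 \<Longrightarrow> count (mset (triples F)) tr > 0"
        using W(1) by (auto simp: packing_def)
      ultimately show "count (mset W) tr \<le> count (mset (triples F)) tr" by linarith
    qed
    from select_exists[OF this] obtain y where y: "length y = length (triples F)" "mset (select y (triples F)) = mset W"
      by blast
    have "length (filter P (select y (triples F))) = length (filter P W)" for P
      using y(2) by (metis mset_filter size_mset)
    then have "packing F (select y (triples F))"
      using W(1) y(2) unfolding packing_def by (metis mset_eq_length mset_eq_setD)
    moreover have "length y \<le> length ?x"
      using y(1) length_enc_list[of ?U enc_vote] by (simp add: control_instance_def)
    ultimately show "\<exists>y. length y \<le> length ?x \<and> packing F (select y (triples F))" by blast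
  qed
qed

theorem exact_control_NP_hard: "NP_hard (exact_control_by_adding_voters (approval_winners 3))"
  unfolding NP_hard_def
proof
  fix A assume "A \<in> class_NP"
  then obtain f :: "bool list \<Rightarrow> clause list" where f: "FP f" "\<And>x. x \<in> A \<longleftrightarrow> satisfiable (f x)"
    using SAT_hard by blast
  have "polytime_computable (\<lambda>x. control_instance (f x))"
    by (rule FP_polytime_computable) (rule FP_control_instance[OF f(1)])
  then show "polytime_reducible A (exact_control_by_adding_voters (approval_winners 3))"
    unfolding polytime_reducible_def using f(2) control_instance_correct by blast
qed

theorem theorem4:
  shows "NP_complete (exact_control_by_adding_voters (approval_winners 3)) \<and>
         conformant_manipulation (approval_winners 3) \<in> class_P"
  using exact_control_in_NP exact_control_NP_hard conformant_in_P by (simp add: NP_complete_def)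


end
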